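(* Let $\mathrm{Ricci}\in\Omega\otimes_{\mathcal{B}}\Omega$ be the Ricci tensor of the quantum projective space of (complex) dimension $r$, defined with the splitting map $s_\wedge$ whose coefficients are $$c_{+-}=\frac{1}{1+q^{(\alpha_s,\alpha_s)}q^{2(\omega_s,2\rho)}},\qquad c_{-+}=\frac{1}{1+q^{-(\alpha_s,\alpha_s)}q^{-2(\omega_s,2\rho)}}.$$ Then $$\mathrm{Ricci}=-\frac{q^{(\alpha_s,\alpha_s)}}{1+q^{(\alpha_s,\alpha_s)}q^{2(\omega_s,2\rho)}}\,\mathrm{qdim}(V)\,g=-\frac{q^2}{1+q^{2r+2}}[r+1]_q\,g.$$ Hence the quantum projective spaces, equipped with the Fubini–Study quantum metric $g$, satisfy a quantum analogue of the Einstein condition, i.e. $\mathrm{Ricci}=k\,g$ for a scalar $k$.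
   Context: **Quantum group data.** Fix an integer $r\ge 1$, a real number $0<q<1$ and $s\in\{1,r\}$. $U_q(\mathfrak{sl}_{r+1})$ is the quantized enveloping algebra with generators $K_i^{\pm1},E_i,F_i$, $1\le i\le r$ (Klimyk–Schmüdgen conventions: $\Delta(K_i)=K_i\otimes K_i$, $\Delta(E_i)=E_i\otimes K_i+1\otimes E_i$, $\Delta(F_i)=F_i\otimes 1+K_i^{-1}\otimes F_i$; $K_i$ acts on a vector of weight $\mu$ by $q^{(\alpha_i,\mu)}$). Here $\alpha_i$ are the simple roots, $\omega_i$ the fundamental weights, $\rho=\sum_i\omega_i$, $w_0$ the longest Weyl group element, $(\cdot,\cdot)$ the invariant form on weights with $(\alpha_i,\alpha_i)=2$. Put $a=(\alpha_s,\alpha_s)=2$, $w=(\omega_s,\omega_s)$, $m=(\omega_s,2\rho)=r$. $V(\lambda)$ is the simple type 1 module of highest weight $\lambda$, $V=V(\omega_s)$, and $V^*$ is its dual with $(Xf)(v)=f(S(X)v)$, $S$ the antipode. $\hat{R}_{X,Y}:X\otimes Y\to Y\otimes X$ is the braiding on finite-dimensional type 1 modules determined by being a module map with $\hat{R}_{V(\lambda),V(\mu)}(v\otimes u)=q^{(\lambda,w_0\mu)}u\otimes v$ for $v$ a highest weight vector of $V(\lambda)$ and $u$ a lowest weight vector of $V(\mu)$. Let $(v_i)$ be a weight basis of $V$ with weights $\lambda_i$ and dual basis $(f^i)$ of $V^*$. Define $\mathsf{E}(f^i\otimes v_j)=\delta_{ij}$, $\mathsf{E}'(v_i\otimes f^j)=q^{(\lambda_i,2\rho)}\delta_{ij}$,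 $\mathsf{C}=\sum_i v_i\otimes f^i$, $\mathsf{C}'=\sum_i q^{-(\lambda_i,2\rho)}f^i\otimes v_i$. Also $\mathrm{qdim}(V)=\sum_i q^{(\lambda_i,2\rho)}$ and $[x]_q=\frac{q^x-q^{-x}}{q-q^{-1}}$. Subscripts indicate the tensor legs on which a map acts ($\mathsf{C}_n,\mathsf{C}'_n$ insert the element at legs $n,n+1$); products of maps are compositions (rightmost first), legs being renumbered after each contraction or insertion. Put $$\mathsf{S}_{123}=(\hat{R}_{V,V^*})_{23}(\hat{R}_{V,V})_{12}(\hat{R}_{V,V^*}^{-1})_{23},\quad \tilde{\mathsf{S}}_{234}=(\hat{R}_{V,V^*})_{23}(\hat{R}_{V^*,V^*}^{-1})_{34}(\hat{R}_{V,V^*}^{-1})_{23},\quad \mathsf{T}_{1234}=\mathsf{S}_{123}\tilde{\mathsf{S}}_{234}=\tilde{\mathsf{S}}_{234}\mathsf{S}_{123}$$ (acting on $V\otimes V^*\otimes V$, $V^*\otimes V\otimes V^*$, $V\otimes V^*\otimes V\otimes V^*$ at the indicated legs). **Index-free notation.** A family $x=(x^{ij})_{1\le i,j\le r+1}$ is identified with $\sum_{i,j}v_i\otimes f^j\otimes x^{ij}$; products of families $xy$ (also $x\otimes y$, $x\wedge y$, $(x,y)$) denote $\sum v_i\otimes f^j\otimes v_k\otimes f^l\otimes x^{ij}y^{kl}$ (resp. with $\otimes_{\mathcal{B}}$, $\wedge$, the inverse metric), and similarly for more factors. The maps above act on the $V,V^*$ legs; other maps act on components. Elements such as $g_{+-}$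 below carry no legs. **Algebra and first-order calculus.** $\mathcal{B}$ is the unital algebra generated by $p^{ij}$, $1\le i,j\le r+1$, with relations $\mathsf{S}_{123}pp=q^{w}pp$, $\tilde{\mathsf{S}}_{234}pp=q^{-w}pp$, $\mathsf{E}'_{12}p=q^{m}$. The Heckenberger–Kolb first-order differential calculus (FODC) is $\Omega=\Omega_+\oplus\Omega_-$, with $\Omega_+,\Omega_-$ generated as left $\mathcal{B}$-modules by $\partial p^{ij}$, resp. $\bar\partial p^{ij}$, with relations $$\tilde{\mathsf{S}}_{234}p\,\partial p=q^{-w}p\,\partial p,\quad \mathsf{E}'_{12}\partial p=0,\qquad \mathsf{S}_{123}p\,\bar\partial p=q^{w}p\,\bar\partial p,\quad \mathsf{E}'_{12}\bar\partial p=0,$$ right module structure $\partial p\,p=q^{a}\mathsf{T}_{1234}p\,\partial p$, $\bar\partial p\,p=q^{-a}\mathsf{T}_{1234}p\,\bar\partial p$, and differential $\mathrm{d}=\partial+\bar\partial$, where $\partial,\bar\partial:\mathcal{B}\to\Omega_\pm$ are the derivations with $p^{ij}\mapsto\partial p^{ij},\bar\partial p^{ij}$. **Universal calculus.** $\Omega^\bullet$ is the quotient of the tensor algebra $T_{\mathcal{B}}(\Omega)$ by the two-sided ideal generated by $\{\sum_i\mathrm{d}a_i\otimes\mathrm{d}b_i:\sum_i a_i\mathrm{d}b_i=0\}\subset\Omega\otimes_{\mathcal{B}}\Omega$; its product is $\wedge$, and $\mathrm{d}(a\,\mathrm{d}b)=\mathrm{d}a\wedge\mathrm{d}b$. **Metric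 and inverse metric.** $g=g_{+-}+g_{-+}$ with $g_{+-}=\mathsf{E}'_{12}\mathsf{E}_{23}\,\partial p\otimes\bar\partial p$ and $g_{-+}=\mathsf{E}'_{12}\mathsf{E}_{23}\,\bar\partial p\otimes\partial p$ in $\Omega\otimes_{\mathcal{B}}\Omega$ (central elements). The inverse metric is the (well-defined) $\mathcal{B}$-bimodule map $(\cdot,\cdot):\Omega\otimes_{\mathcal{B}}\Omega\to\mathcal{B}$ with $(\partial p,\partial p)=(\bar\partial p,\bar\partial p)=0$, $(\partial p,\bar\partial p)=q^{a}q^{-w-m}\mathsf{S}_{123}\mathsf{C}_3p-q^{a}q^{-m}pp$, $(\bar\partial p,\partial p)=\mathsf{C}'_2p-q^{-m}pp$. **Connection and Riemann tensor.** The quantum Levi-Civita connection is the (well-defined) linear map $\nabla:\Omega\to\Omega\otimes_{\mathcal{B}}\Omega$ with $\nabla(b\omega)=\mathrm{d}b\otimes\omega+b\nabla(\omega)$ and $$\nabla(\partial p)=q^{a}\mathsf{E}_{23}\mathsf{T}_{1234}\,\bar\partial p\otimes\partial p-q^{a}q^{-m}\,p\,g_{-+},\qquad \nabla(\bar\partial p)=\mathsf{E}_{23}\,\partial p\otimes\bar\partial p-q^{-m}\,p\,g_{+-}.$$ The Riemann tensor is $R_\nabla:=(\mathrm{d}\otimes\mathrm{id}-(\wedge\otimes\mathrm{id})\circ(\mathrm{id}\otimes\nabla))\circ\nabla:\Omega\to\Omega^2\otimes_{\mathcal{B}}\Omega$. **Generalized braiding.** $\sigma$ is the (well-defined) $\mathcal{B}$-bimodule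 map $\Omega\otimes_{\mathcal{B}}\Omega\to\Omega\otimes_{\mathcal{B}}\Omega$ given by $$\sigma(\partial p\otimes\partial p)=q^{a}\mathsf{S}_{123}\tilde{\mathsf{S}}_{234}\,\partial p\otimes\partial p,\qquad \sigma(\bar\partial p\otimes\bar\partial p)=q^{-a}\mathsf{S}_{123}\tilde{\mathsf{S}}_{234}\,\bar\partial p\otimes\bar\partial p,$$ $$\sigma(\partial p\otimes\bar\partial p)=q^{2a-2w}\mathsf{S}_{123}\tilde{\mathsf{S}}_{234}^{-1}\,\bar\partial p\otimes\partial p+(1-q^{a})q^{a}q^{-m}\,p\,g_{-+}\,p,$$ $$\sigma(\bar\partial p\otimes\partial p)=q^{2w-2a}\mathsf{S}_{123}^{-1}\tilde{\mathsf{S}}_{234}\,\partial p\otimes\bar\partial p+(1-q^{-a})q^{-m}\,p\,g_{+-}\,p.$$ **Splitting map.** For scalars with $c_{+-}+c_{-+}=1$, the $\mathcal{B}$-bimodule map $s_\wedge:\Omega^2\to\Omega\otimes_{\mathcal{B}}\Omega$ (satisfying $\wedge\circ s_\wedge=\mathrm{id}$) is induced from $\Omega\otimes_{\mathcal{B}}\Omega$ by: $\frac{1}{1+q^{-a}}(\mathrm{id}-q^{-a}\sigma)$ on $\Omega_+\otimes_{\mathcal{B}}\Omega_+$, $\frac{1}{1+q^{a}}(\mathrm{id}-q^{a}\sigma)$ on $\Omega_-\otimes_{\mathcal{B}}\Omega_-$, $c_{+-}\mathrm{id}-c_{-+}\sigma$ on $\Omega_+\otimes_{\mathcal{B}}\Omega_-$,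 $c_{-+}\mathrm{id}-c_{+-}\sigma$ on $\Omega_-\otimes_{\mathcal{B}}\Omega_+$. **Ricci tensor.** $\mathrm{Ricci}:=((\cdot,\cdot)\otimes\mathrm{id}\otimes\mathrm{id})\circ(\mathrm{id}\otimes s_\wedge\otimes\mathrm{id})\circ(\mathrm{id}\otimes R_\nabla)(g)\in\Omega\otimes_{\mathcal{B}}\Omega$. *)

theory Defs
  imports "HOL-Analysis.Analysis" "HOL-Library.Poly_Mapping"
begin

section \<open>Weights of type A\<close>

text \<open>
  Weights of \<open>sl\<^sub>r\<^sub>+\<^sub>1\<close> are given by their coordinates \<open>1..r+1\<close> in the standard basis
  \<open>\<epsilon>\<^sub>1, ..., \<epsilon>\<^sub>r\<^sub>+\<^sub>1\<close> (coordinate sum zero), so that the invariant form is the dot product and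
  \<open>\<alpha>\<^sub>i = \<epsilon>\<^sub>i - \<epsilon>\<^sub>i\<^sub>+\<^sub>1\<close>.
\<close>

type_synonym weight = "nat \<Rightarrow> real"

definition wform :: "nat \<Rightarrow> weight \<Rightarrow> weight \<Rightarrow> real" where
  "wform r l m = (\<Sum>k = 1..r+1. l k * m k)"

definition sroot :: "nat \<Rightarrow> weight" where
  "sroot i = (\<lambda>k. of_bool (k = i) - of_bool (k = i + 1))"

definition fweight :: "nat \<Rightarrow> nat \<Rightarrow> weight" where
  "fweight r i = (\<lambda>k. if k \<in> {1..r+1} then of_bool (k \<le> i) - real i / real (r + 1) else 0)"

definition two_rho :: "nat \<Rightarrow> weight" where
  "two_rho r = (\<lambda>k. 2 * (\<Sum>i = 1..r. fweight r i k))"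

definition weight_lattice :: "nat \<Rightarrow> weight set" where
  "weight_lattice r = {l. \<exists>c :: nat \<Rightarrow> int. l = (\<lambda>k. \<Sum>i = 1..r. of_int (c i) * fweight r i k)}"

text \<open>The longest element of the Weyl group (the symmetric group) reverses the coordinates.\<close>

definition w0 :: "nat \<Rightarrow> weight \<Rightarrow> weight" where
  "w0 r l = (\<lambda>k. l (r + 2 - k))"

definition cpow :: "real \<Rightarrow> real \<Rightarrow> complex" where
  "cpow q x = complex_of_real (q powr x)"

definition qnumber :: "real \<Rightarrow> real \<Rightarrow> complex" where
  "qnumber q x = (cpow q x - cpow q (- x)) / (cpow q 1 - cpow q (- 1))"


section \<open>Modules over the quantized enveloping algebra\<close>

text \<open>
  A finite-dimensional module with a chosen basis indexed by \<open>'n\<close>: the matrices by which the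
  generators \<open>K\<^sub>i\<close>, \<open>E\<^sub>i\<close>, \<open>F\<^sub>i\<close> act, for \<open>i \<in> {1..r}\<close>.
\<close>

record ('n::finite) uq_rep =
  Kop :: "nat \<Rightarrow> complex^'n^'n"
  Eop :: "nat \<Rightarrow> complex^'n^'n"
  Fop :: "nat \<Rightarrow> complex^'n^'n"

definition serre :: "real \<Rightarrow> complex^'n^'n \<Rightarrow> complex^'n^'n \<Rightarrow> bool" where
  "serre q A B \<longleftrightarrow>
     A ** A ** B - mat (cpow q 1 + cpow q (- 1)) ** (A ** B ** A) + B ** A ** A = 0"

definition uq_module :: "nat \<Rightarrow> real \<Rightarrow> ('n::finite) uq_rep \<Rightarrow> bool" where
  "uq_module r q X \<longleftrightarrow>
     (\<forall>i\<in>{1..r}. invertible (Kop X i)) \<and>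
     (\<forall>i\<in>{1..r}. \<forall>j\<in>{1..r}.
        Kop X i ** Kop X j = Kop X j ** Kop X i \<and>
        Kop X i ** Eop X j ** matrix_inv (Kop X i)
          = mat (cpow q (wform r (sroot i) (sroot j))) ** Eop X j \<and>
        Kop X i ** Fop X j ** matrix_inv (Kop X i)
          = mat (cpow q (- wform r (sroot i) (sroot j))) ** Fop X j \<and>
        Eop X i ** Fop X j - Fop X j ** Eop X i
          = (if i = j then mat (1 / (cpow q 1 - cpow q (- 1))) ** (Kop X i - matrix_inv (Kop X i))
             else 0) \<and>
        (if i = j then True
         else if i + 1 = j \<or> j + 1 = i
           then serre q (Eop X i) (Eop X j) \<and> serre q (Fop X i) (Fop X j)
         else Eop X i ** Eop X j = Eop X j ** Eop X i \<and> Fop X i ** Fop X j = Fop X j ** Fop X i))"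

definition uq_submodule :: "nat \<Rightarrow> ('n::finite) uq_rep \<Rightarrow> (complex^'n) set \<Rightarrow> bool" where
  "uq_submodule r X W \<longleftrightarrow> vec.subspace W \<and>
     (\<forall>i\<in>{1..r}. \<forall>v\<in>W. Kop X i *v v \<in> W \<and> matrix_inv (Kop X i) *v v \<in> W \<and>
        Eop X i *v v \<in> W \<and> Fop X i *v v \<in> W)"

definition simple_uq_module :: "nat \<Rightarrow> real \<Rightarrow> ('n::finite) uq_rep \<Rightarrow> bool" where
  "simple_uq_module r q X \<longleftrightarrow> uq_module r q X \<and>
     (\<forall>W. uq_submodule r X W \<longrightarrow> W = {0} \<or> W = UNIV)"

definition weight_vector :: "nat \<Rightarrow> real \<Rightarrow> ('n::finite) uq_rep \<Rightarrow> weight \<Rightarrow> complex^'n \<Rightarrow> bool" where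
  "weight_vector r q X l v \<longleftrightarrow> v \<noteq> 0 \<and> l \<in> weight_lattice r \<and>
     (\<forall>i\<in>{1..r}. Kop X i *v v = cpow q (wform r (sroot i) l) *s v)"

definition highest_weight_vector ::
  "nat \<Rightarrow> real \<Rightarrow> ('n::finite) uq_rep \<Rightarrow> weight \<Rightarrow> complex^'n \<Rightarrow> bool" where
  "highest_weight_vector r q X l v \<longleftrightarrow>
     weight_vector r q X l v \<and> (\<forall>i\<in>{1..r}. Eop X i *v v = 0)"

definition lowest_weight_vector ::
  "nat \<Rightarrow> real \<Rightarrow> ('n::finite) uq_rep \<Rightarrow> weight \<Rightarrow> complex^'n \<Rightarrow> bool" where
  "lowest_weight_vector r q X l v \<longleftrightarrow>
     weight_vector r q X l v \<and> (\<forall>i\<in>{1..r}. Fop X i *v v = 0)"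

text \<open>The coordinate basis consists of weight vectors; in particular the module is of type 1.\<close>

definition weight_basis :: "nat \<Rightarrow> real \<Rightarrow> ('n::finite) uq_rep \<Rightarrow> ('n \<Rightarrow> weight) \<Rightarrow> bool" where
  "weight_basis r q X wt \<longleftrightarrow> (\<forall>k. weight_vector r q X (wt k) (axis k 1))"

text \<open>
  In the dual basis, the matrix of \<open>X\<close> on the dual module is the transpose of the matrix of \<open>S(X)\<close>,
  where \<open>S(K\<^sub>i) = K\<^sub>i\<close>-inverse, \<open>S(E\<^sub>i) = - E\<^sub>i K\<^sub>i\<close>-inverse, \<open>S(F\<^sub>i) = - K\<^sub>i F\<^sub>i\<close> is the antipode for
  the coproduct used in \<open>tensor_rep\<close>.
\<close>

definition dual_rep :: "('n::finite) uq_rep \<Rightarrow> 'n uq_rep" where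
  "dual_rep X = \<lparr>Kop = (\<lambda>i. transpose (matrix_inv (Kop X i))),
     Eop = (\<lambda>i. transpose (- (Eop X i ** matrix_inv (Kop X i)))),
     Fop = (\<lambda>i. transpose (- (Kop X i ** Fop X i)))\<rparr>"

definition kron :: "complex^'n^'n \<Rightarrow> complex^'m^'m \<Rightarrow> complex^('n \<times> 'm)^('n \<times> 'm)" where
  "kron A B = (\<chi> x y. A $ fst x $ fst y * B $ snd x $ snd y)"

definition tensv :: "complex^'n \<Rightarrow> complex^'m \<Rightarrow> complex^('n \<times> 'm)" where
  "tensv v u = (\<chi> x. v $ fst x * u $ snd x)"

definition tensor_rep :: "('n::finite) uq_rep \<Rightarrow> ('m::finite) uq_rep \<Rightarrow> ('n \<times> 'm) uq_rep" where
  "tensor_rep X Y = \<lparr>Kop = (\<lambda>i. kron (Kop X i) (Kop Y i)),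
     Eop = (\<lambda>i. kron (Eop X i) (Kop Y i) + kron (mat 1) (Eop Y i)),
     Fop = (\<lambda>i. kron (Fop X i) (mat 1) + kron (matrix_inv (Kop X i)) (Fop Y i))\<rparr>"

definition is_braiding :: "nat \<Rightarrow> real \<Rightarrow> ('n::finite) uq_rep \<Rightarrow> ('m::finite) uq_rep \<Rightarrow>
    complex^('n \<times> 'm)^('m \<times> 'n) \<Rightarrow> bool" where
  "is_braiding r q X Y R \<longleftrightarrow>
     (\<forall>i\<in>{1..r}. R ** Kop (tensor_rep X Y) i = Kop (tensor_rep Y X) i ** R \<and>
                 R ** Eop (tensor_rep X Y) i = Eop (tensor_rep Y X) i ** R \<and>
                 R ** Fop (tensor_rep X Y) i = Fop (tensor_rep Y X) i ** R) \<and>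
     (\<forall>l m v y u. highest_weight_vector r q X l v \<and> highest_weight_vector r q Y m y \<and>
        lowest_weight_vector r q Y (w0 r m) u \<longrightarrow>
        R *v tensv v u = cpow q (wform r l (w0 r m)) *s tensv u v)"

text \<open>For simple \<open>X\<close>, \<open>Y\<close> the two conditions determine the matrix uniquely.\<close>

definition braiding :: "nat \<Rightarrow> real \<Rightarrow> ('n::finite) uq_rep \<Rightarrow> ('m::finite) uq_rep \<Rightarrow>
    complex^('n \<times> 'm)^('m \<times> 'n)" where
  "braiding r q X Y = (THE R. is_braiding r q X Y R)"


section \<open>Maps on tensor legs and index-free notation\<close>

record ('n::finite) qps_data =
  rk :: nat
  node :: nat
  qpar :: real
  Vrep :: "'n uq_rep"
  wts :: "'n \<Rightarrow> weight"

definition qpow :: "('n::finite) qps_data \<Rightarrow> real \<Rightarrow> complex" where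
  "qpow D x = cpow (qpar D) x"

definition ca :: "('n::finite) qps_data \<Rightarrow> real" where
  "ca D = wform (rk D) (sroot (node D)) (sroot (node D))"

definition cw :: "('n::finite) qps_data \<Rightarrow> real" where
  "cw D = wform (rk D) (fweight (rk D) (node D)) (fweight (rk D) (node D))"

definition cm :: "('n::finite) qps_data \<Rightarrow> real" where
  "cm D = wform (rk D) (fweight (rk D) (node D)) (two_rho (rk D))"

definition wrho :: "('n::finite) qps_data \<Rightarrow> 'n \<Rightarrow> real" where
  "wrho D i = wform (rk D) (wts D i) (two_rho (rk D))"

definition qdim :: "('n::finite) qps_data \<Rightarrow> complex" where
  "qdim D = (\<Sum>i\<in>UNIV. qpow D (wrho D i))"

definition legs12 :: "complex^('n::finite \<times> 'n)^('n \<times> 'n) \<Rightarrow> complex^('n \<times> 'n \<times> 'n)^('n \<times> 'n \<times> 'n)" where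
  "legs12 M = (\<chi> x y. case (x, y) of ((a, b, c), (a', b', c')) \<Rightarrow>
     M $ (a, b) $ (a', b') * of_bool (c = c'))"

definition legs23 :: "complex^('n::finite \<times> 'n)^('n \<times> 'n) \<Rightarrow> complex^('n \<times> 'n \<times> 'n)^('n \<times> 'n \<times> 'n)" where
  "legs23 M = kron (mat 1) M"

definition RVV :: "('n::finite) qps_data \<Rightarrow> complex^('n \<times> 'n)^('n \<times> 'n)" where
  "RVV D = braiding (rk D) (qpar D) (Vrep D) (Vrep D)"

definition RVd :: "('n::finite) qps_data \<Rightarrow> complex^('n \<times> 'n)^('n \<times> 'n)" where
  "RVd D = braiding (rk D) (qpar D) (Vrep D) (dual_rep (Vrep D))"

definition Rdd :: "('n::finite) qps_data \<Rightarrow> complex^('n \<times> 'n)^('n \<times> 'n)" where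
  "Rdd D = braiding (rk D) (qpar D) (dual_rep (Vrep D)) (dual_rep (Vrep D))"

text \<open>
  The operators \<open>S\<close> and \<open>S~\<close>, first on three legs, then (\<open>S123\<close>, \<open>S234\<close>) on the four legs
  \<open>V \<otimes> V* \<otimes> V \<otimes> V*\<close>. All indices, also those of the basis of \<open>V*\<close>, have type \<open>'n\<close>.
\<close>

definition Smat :: "('n::finite) qps_data \<Rightarrow> complex^('n \<times> 'n \<times> 'n)^('n \<times> 'n \<times> 'n)" where
  "Smat D = legs23 (RVd D) ** legs12 (RVV D) ** legs23 (matrix_inv (RVd D))"

definition Stmat :: "('n::finite) qps_data \<Rightarrow> complex^('n \<times> 'n \<times> 'n)^('n \<times> 'n \<times> 'n)" where
  "Stmat D = legs12 (RVd D) ** legs23 (matrix_inv (Rdd D)) ** legs12 (matrix_inv (RVd D))"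

definition S123 ::
  "('n::finite) qps_data \<Rightarrow> complex^('n \<times> 'n \<times> 'n \<times> 'n)^('n \<times> 'n \<times> 'n \<times> 'n)" where
  "S123 D = (\<chi> x y. case (x, y) of ((a, b, c, d), (a', b', c', d')) \<Rightarrow>
     Smat D $ (a, b, c) $ (a', b', c') * of_bool (d = d'))"

definition S234 ::
  "('n::finite) qps_data \<Rightarrow> complex^('n \<times> 'n \<times> 'n \<times> 'n)^('n \<times> 'n \<times> 'n \<times> 'n)" where
  "S234 D = kron (mat 1) (Stmat D)"

definition T1234 ::
  "('n::finite) qps_data \<Rightarrow> complex^('n \<times> 'n \<times> 'n \<times> 'n)^('n \<times> 'n \<times> 'n \<times> 'n)" where
  "T1234 D = S123 D ** S234 D"

text \<open>
  A family \<open>x\<close> stands for \<open>\<Sum>\<^sub>l e\<^sub>l \<otimes> x l\<close>, where \<open>e\<^sub>l\<close> runs over the basis of the legs. The argument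
  \<open>sc\<close> is the scalar multiplication of the space in which the components live.
\<close>

definition leg_map ::
  "(complex \<Rightarrow> 'v \<Rightarrow> 'v::ab_group_add) \<Rightarrow> complex^'i^'j \<Rightarrow> ('i \<Rightarrow> 'v) \<Rightarrow> 'j \<Rightarrow> 'v" where
  "leg_map sc M x = (\<lambda>k. \<Sum>l\<in>UNIV. sc (M $ k $ l) (x l))"

definition fam_prod ::
  "('u \<Rightarrow> 'v \<Rightarrow> 'w) \<Rightarrow> ('n \<times> 'n \<Rightarrow> 'u) \<Rightarrow> ('n \<times> 'n \<Rightarrow> 'v) \<Rightarrow> 'n \<times> 'n \<times> 'n \<times> 'n \<Rightarrow> 'w" where
  "fam_prod f x y = (\<lambda>(i, j, k, l). f (x (i, j)) (y (k, l)))"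

definition E23 :: "('n::finite \<times> 'n \<times> 'n \<times> 'n \<Rightarrow> 'v::ab_group_add) \<Rightarrow> 'n \<times> 'n \<Rightarrow> 'v" where
  "E23 x = (\<lambda>(i, l). \<Sum>j\<in>UNIV. x (i, j, j, l))"

definition E'12 ::
  "('n::finite) qps_data \<Rightarrow> (complex \<Rightarrow> 'v \<Rightarrow> 'v::ab_group_add) \<Rightarrow> ('n \<times> 'n \<Rightarrow> 'v) \<Rightarrow> 'v" where
  "E'12 D sc x = (\<Sum>i\<in>UNIV. sc (qpow D (wrho D i)) (x (i, i)))"

definition C3 :: "('n \<times> 'n \<Rightarrow> 'v::ab_group_add) \<Rightarrow> 'n \<times> 'n \<times> 'n \<times> 'n \<Rightarrow> 'v" where
  "C3 x = (\<lambda>(i, j, k, l). if k = l then x (i, j) else 0)"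

definition C'2 :: "('n::finite) qps_data \<Rightarrow> (complex \<Rightarrow> 'v \<Rightarrow> 'v::ab_group_add) \<Rightarrow>
    ('n \<times> 'n \<Rightarrow> 'v) \<Rightarrow> 'n \<times> 'n \<times> 'n \<times> 'n \<Rightarrow> 'v" where
  "C'2 D sc x = (\<lambda>(i, k, l, j). if k = l then sc (qpow D (- wrho D k)) (x (i, j)) else 0)"

text \<open>The components of the family \<open>M x - c x\<close>.\<close>

definition eigen_rels ::
  "(complex \<Rightarrow> 'v \<Rightarrow> 'v::ab_group_add) \<Rightarrow> complex^'i^'i \<Rightarrow> complex \<Rightarrow> ('i::finite \<Rightarrow> 'v) \<Rightarrow> 'v set" where
  "eigen_rels sc M c x = range (\<lambda>k. leg_map sc M x k - sc c (x k))"


section \<open>The algebra\<close>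

text \<open>The free unital algebra on \<open>'x\<close> is the monoid algebra of the free monoid on \<open>'x\<close>.\<close>

datatype 'x free_monoid = Word "'x list"

instantiation free_monoid :: (type) monoid_add
begin

definition "0 = Word []"

fun plus_free_monoid :: "'a free_monoid \<Rightarrow> 'a free_monoid \<Rightarrow> 'a free_monoid" where
  "Word xs + Word ys = Word (xs @ ys)"

instance
proof
  fix a b c :: "'a free_monoid"
  show "a + b + c = a + (b + c)" by (cases a; cases b; cases c) simp
  show "0 + a = a" by (cases a) (simp add: zero_free_monoid_def)
  show "a + 0 = a" by (cases a) (simp add: zero_free_monoid_def)
qed

end

type_synonym 'x free_algebra = "'x free_monoid \<Rightarrow>\<^sub>0 complex"

definition fgen :: "'x \<Rightarrow> 'x free_algebra" where
  "fgen x = Poly_Mapping.single (Word [x]) 1"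

definition fconst :: "complex \<Rightarrow> 'x free_algebra" where
  "fconst c = Poly_Mapping.single 0 c"

definition two_sided_ideal :: "('r::ring_1) set \<Rightarrow> bool" where
  "two_sided_ideal I \<longleftrightarrow> 0 \<in> I \<and> (\<forall>x\<in>I. \<forall>y\<in>I. x + y \<in> I) \<and> (\<forall>x\<in>I. \<forall>b. b * x \<in> I \<and> x * b \<in> I)"

definition B_rels :: "('n::finite) qps_data \<Rightarrow> ('n \<times> 'n) free_algebra set" where
  "B_rels D =
     (let sc = (\<lambda>c x. fconst c * x); pp = fam_prod (*) fgen fgen in
      eigen_rels sc (S123 D) (qpow D (cw D)) pp \<union>
      eigen_rels sc (S234 D) (qpow D (- cw D)) pp \<union>
      {E'12 D sc fgen - fconst (qpow D (cm D))})"

text \<open>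
  The data of the calculus: the quotient map \<open>bproj\<close> from the free algebra on the \<open>p\<^sup>i\<^sup>j\<close> onto \<open>\<B>\<close>
  (of type \<open>'b\<close>), the two module structures on \<open>\<Omega>\<close> (of type \<open>'o\<close>), the elements \<open>\<partial>p\<^sup>i\<^sup>j\<close> and
  \<open>\<partial>-bar p\<^sup>i\<^sup>j\<close> of \<open>\<Omega>\<close>, and the maps \<open>\<partial>\<close> and \<open>\<partial>-bar\<close>.
\<close>

record ('n, 'b, 'o) calculus =
  bproj :: "('n \<times> 'n) free_algebra \<Rightarrow> 'b"
  lmul :: "'b \<Rightarrow> 'o \<Rightarrow> 'o"
  rmul :: "'o \<Rightarrow> 'b \<Rightarrow> 'o"
  dp :: "'n \<times> 'n \<Rightarrow> 'o"
  bp :: "'n \<times> 'n \<Rightarrow> 'o"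
  del :: "'b \<Rightarrow> 'o"
  delbar :: "'b \<Rightarrow> 'o"

definition pgen :: "('n, 'b, 'o) calculus \<Rightarrow> 'n \<times> 'n \<Rightarrow> 'b" where
  "pgen A ij = bproj A (fgen ij)"

definition scal :: "('n, 'b, 'o) calculus \<Rightarrow> complex \<Rightarrow> 'b" where
  "scal A c = bproj A (fconst c)"

definition is_algebra_B :: "('n::finite) qps_data \<Rightarrow> ('n, 'b::ring_1, 'o) calculus \<Rightarrow> bool" where
  "is_algebra_B D A \<longleftrightarrow>
     (\<forall>x y. bproj A (x + y) = bproj A x + bproj A y) \<and>
     (\<forall>x y. bproj A (x * y) = bproj A x * bproj A y) \<and>
     bproj A 1 = 1 \<and>
     surj (bproj A) \<and>
     bproj A -` {0} = two_sided_ideal hull (B_rels D)"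


section \<open>The first-order calculus\<close>

definition is_bimodule :: "('b::ring_1 \<Rightarrow> 'm \<Rightarrow> 'm::ab_group_add) \<Rightarrow> ('m \<Rightarrow> 'b \<Rightarrow> 'm) \<Rightarrow> bool" where
  "is_bimodule lm rm \<longleftrightarrow>
     (\<forall>b x y. lm b (x + y) = lm b x + lm b y) \<and> (\<forall>b c x. lm (b + c) x = lm b x + lm c x) \<and>
     (\<forall>b c x. lm (b * c) x = lm b (lm c x)) \<and> (\<forall>x. lm 1 x = x) \<and>
     (\<forall>b x y. rm (x + y) b = rm x b + rm y b) \<and> (\<forall>b c x. rm x (b + c) = rm x b + rm x c) \<and>
     (\<forall>b c x. rm x (b * c) = rm (rm x b) c) \<and> (\<forall>x. rm x 1 = x) \<and>
     (\<forall>b c x. rm (lm b x) c = lm b (rm x c))"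

definition left_comb ::
  "('b \<Rightarrow> 'm \<Rightarrow> 'm) \<Rightarrow> ('i::finite \<Rightarrow> 'm) \<Rightarrow> 'b^'i \<Rightarrow> 'm::ab_group_add" where
  "left_comb lm d b = (\<Sum>i\<in>UNIV. lm (b $ i) (d i))"

definition left_submodule :: "(('b::ring_1)^'i) set \<Rightarrow> bool" where
  "left_submodule N \<longleftrightarrow> 0 \<in> N \<and> (\<forall>x\<in>N. \<forall>y\<in>N. x + y \<in> N) \<and> (\<forall>b. \<forall>x\<in>N. b *s x \<in> N)"

text \<open>
  The left module generated by the family \<open>d\<close> with relations \<open>rels\<close> (elements of the free left
  module \<open>'b^'i\<close>): a combination of the generators vanishes iff it follows from the relations.
\<close>

definition left_presented ::
  "('b::ring_1 \<Rightarrow> 'm::ab_group_add \<Rightarrow> 'm) \<Rightarrow> ('i::finite \<Rightarrow> 'm) \<Rightarrow> ('b^'i) set \<Rightarrow> bool" where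
  "left_presented lm d rels \<longleftrightarrow> left_comb lm d -` {0} = left_submodule hull rels"

text \<open>\<open>axis ij 1\<close> is the generator of the free left module that is mapped to \<open>\<partial>p\<^sup>i\<^sup>j\<close>,
  respectively \<open>\<partial>-bar p\<^sup>i\<^sup>j\<close>.\<close>

definition plus_rels ::
  "('n::finite) qps_data \<Rightarrow> ('n, 'b::ring_1, 'o) calculus \<Rightarrow> ('b^('n \<times> 'n)) set" where
  "plus_rels D A =
     (let sc = (\<lambda>c x. scal A c *s x); e = (\<lambda>ij. axis ij 1) in
      eigen_rels sc (S234 D) (qpow D (- cw D)) (fam_prod (*s) (pgen A) e) \<union> {E'12 D sc e})"

definition minus_rels ::
  "('n::finite) qps_data \<Rightarrow> ('n, 'b::ring_1, 'o) calculus \<Rightarrow> ('b^('n \<times> 'n)) set" where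
  "minus_rels D A =
     (let sc = (\<lambda>c x. scal A c *s x); e = (\<lambda>ij. axis ij 1) in
      eigen_rels sc (S123 D) (qpow D (cw D)) (fam_prod (*s) (pgen A) e) \<union> {E'12 D sc e})"

definition Omega_plus :: "('n::finite, 'b::ring_1, 'o::ab_group_add) calculus \<Rightarrow> 'o set" where
  "Omega_plus A = range (left_comb (lmul A) (dp A))"

definition Omega_minus :: "('n::finite, 'b::ring_1, 'o::ab_group_add) calculus \<Rightarrow> 'o set" where
  "Omega_minus A = range (left_comb (lmul A) (bp A))"

definition sc1 :: "('n, 'b, 'o) calculus \<Rightarrow> complex \<Rightarrow> 'o \<Rightarrow> 'o" where
  "sc1 A c x = lmul A (scal A c) x"

definition is_derivation ::
  "('n, 'b::ring_1, 'o::ab_group_add) calculus \<Rightarrow> ('b \<Rightarrow> 'o) \<Rightarrow> bool" where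
  "is_derivation A f \<longleftrightarrow> (\<forall>a b. f (a + b) = f a + f b) \<and> (\<forall>c. f (scal A c) = 0) \<and>
     (\<forall>a b. f (a * b) = rmul A (f a) b + lmul A a (f b))"

definition is_HK_calculus ::
  "('n::finite) qps_data \<Rightarrow> ('n, 'b::ring_1, 'o::ab_group_add) calculus \<Rightarrow> bool" where
  "is_HK_calculus D A \<longleftrightarrow>
     is_bimodule (lmul A) (rmul A) \<and>
     (\<forall>c x. rmul A x (scal A c) = lmul A (scal A c) x) \<and>
     (\<forall>x. \<exists>!z. z \<in> Omega_plus A \<times> Omega_minus A \<and> x = fst z + snd z) \<and>
     left_presented (lmul A) (dp A) (plus_rels D A) \<and>
     left_presented (lmul A) (bp A) (minus_rels D A) \<and>
     (\<forall>k. fam_prod (rmul A) (dp A) (pgen A) k =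
        sc1 A (qpow D (ca D))
          (leg_map (sc1 A) (T1234 D) (fam_prod (lmul A) (pgen A) (dp A)) k)) \<and>
     (\<forall>k. fam_prod (rmul A) (bp A) (pgen A) k =
        sc1 A (qpow D (- ca D))
          (leg_map (sc1 A) (T1234 D) (fam_prod (lmul A) (pgen A) (bp A)) k)) \<and>
     is_derivation A (del A) \<and> (\<forall>ij. del A (pgen A ij) = dp A ij) \<and>
     is_derivation A (delbar A) \<and> (\<forall>ij. delbar A (pgen A ij) = bp A ij)"

definition dif :: "('n, 'b, 'o::ab_group_add) calculus \<Rightarrow> 'b \<Rightarrow> 'o" where
  "dif A b = del A b + delbar A b"


section \<open>Tensor products over a ring and quotients\<close>

definition add_subgroup :: "('g::ab_group_add) set \<Rightarrow> bool" where
  "add_subgroup H \<longleftrightarrow> 0 \<in> H \<and> (\<forall>x\<in>H. \<forall>y\<in>H. x - y \<in> H)"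

definition balanced_rels ::
  "('m::ab_group_add \<Rightarrow> 'b \<Rightarrow> 'm) \<Rightarrow> ('b \<Rightarrow> 'l::ab_group_add \<Rightarrow> 'l) \<Rightarrow> ('m \<times> 'l \<Rightarrow>\<^sub>0 int) set" where
  "balanced_rels rm lm =
     {frag_of (x + x', y) - frag_of (x, y) - frag_of (x', y) | x x' y. True} \<union>
     {frag_of (x, y + y') - frag_of (x, y) - frag_of (x, y') | x y y'. True} \<union>
     {frag_of (rm x b, y) - frag_of (x, lm b y) | x b y. True}"

text \<open>
  \<open>t x y\<close> is \<open>x \<otimes> y\<close>. The tensor product \<open>'t\<close> of the right module \<open>'m\<close> and the left module \<open>'l\<close> is
  the free abelian group on \<open>'m \<times> 'l\<close> modulo the subgroup generated by the balancing relations.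
\<close>

definition is_tensor :: "('m::ab_group_add \<Rightarrow> 'b \<Rightarrow> 'm) \<Rightarrow> ('b \<Rightarrow> 'l::ab_group_add \<Rightarrow> 'l) \<Rightarrow>
    ('m \<Rightarrow> 'l \<Rightarrow> 't::ab_group_add) \<Rightarrow> bool" where
  "is_tensor rm lm t \<longleftrightarrow>
     (\<exists>f :: ('m \<times> 'l \<Rightarrow>\<^sub>0 int) \<Rightarrow> 't. Modules.additive f \<and> surj f \<and>
        f -` {0} = add_subgroup hull balanced_rels rm lm \<and>
        (\<forall>x y. t x y = f (frag_of (x, y))))"

text \<open>The additive map out of a tensor product sending \<open>x \<otimes> y\<close> to \<open>f x y\<close> (for \<open>f\<close> biadditive and
  balanced).\<close>

definition tlift ::
  "('m \<Rightarrow> 'l \<Rightarrow> 't::ab_group_add) \<Rightarrow> ('m \<Rightarrow> 'l \<Rightarrow> 'g::ab_group_add) \<Rightarrow> 't \<Rightarrow> 'g" where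
  "tlift t f = (THE h. Modules.additive h \<and> (\<forall>x y. h (t x y) = f x y))"

definition tmap :: "('m \<Rightarrow> 'l \<Rightarrow> 't::ab_group_add) \<Rightarrow> ('m' \<Rightarrow> 'l' \<Rightarrow> 't'::ab_group_add) \<Rightarrow>
    ('m \<Rightarrow> 'm') \<Rightarrow> ('l \<Rightarrow> 'l') \<Rightarrow> 't \<Rightarrow> 't'" where
  "tmap t t' f g = tlift t (\<lambda>x y. t' (f x) (g y))"

definition tleft :: "('m \<Rightarrow> 'l \<Rightarrow> 't::ab_group_add) \<Rightarrow> ('b \<Rightarrow> 'm \<Rightarrow> 'm) \<Rightarrow> 'b \<Rightarrow> 't \<Rightarrow> 't" where
  "tleft t lm b = tmap t t (lm b) id"

definition tright :: "('m \<Rightarrow> 'l \<Rightarrow> 't::ab_group_add) \<Rightarrow> ('l \<Rightarrow> 'b \<Rightarrow> 'l) \<Rightarrow> 't \<Rightarrow> 'b \<Rightarrow> 't" where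
  "tright t rm x b = tmap t t id (\<lambda>y. rm y b) x"

definition qlift :: "('a \<Rightarrow> 'c) \<Rightarrow> ('a \<Rightarrow> 'd) \<Rightarrow> 'c \<Rightarrow> 'd" where
  "qlift \<pi> f = (THE h. \<forall>x. h (\<pi> x) = f x)"

definition is_bimodule_map :: "('b \<Rightarrow> 'm \<Rightarrow> 'm::ab_group_add) \<Rightarrow> ('m \<Rightarrow> 'b \<Rightarrow> 'm) \<Rightarrow>
    ('b \<Rightarrow> 'l \<Rightarrow> 'l::ab_group_add) \<Rightarrow> ('l \<Rightarrow> 'b \<Rightarrow> 'l) \<Rightarrow> ('m \<Rightarrow> 'l) \<Rightarrow> bool" where
  "is_bimodule_map lm rm lm' rm' f \<longleftrightarrow> Modules.additive f \<and>
     (\<forall>b x. f (lm b x) = lm' b (f x)) \<and> (\<forall>b x. f (rm x b) = rm' (f x) b)"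


section \<open>The calculus in degree two\<close>

text \<open>In what follows \<open>t x y = x \<otimes> y\<close> in \<open>\<Omega> \<otimes>\<^sub>\<B> \<Omega>\<close>, which has type \<open>'t\<close>.\<close>

definition lmul2 :: "('n, 'b, 'o) calculus \<Rightarrow> ('o \<Rightarrow> 'o \<Rightarrow> 't::ab_group_add) \<Rightarrow> 'b \<Rightarrow> 't \<Rightarrow> 't" where
  "lmul2 A t = tleft t (lmul A)"

definition rmul2 :: "('n, 'b, 'o) calculus \<Rightarrow> ('o \<Rightarrow> 'o \<Rightarrow> 't::ab_group_add) \<Rightarrow> 't \<Rightarrow> 'b \<Rightarrow> 't" where
  "rmul2 A t = tright t (rmul A)"

definition sc2 :: "('n, 'b, 'o) calculus \<Rightarrow> ('o \<Rightarrow> 'o \<Rightarrow> 't::ab_group_add) \<Rightarrow> complex \<Rightarrow> 't \<Rightarrow> 't" where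
  "sc2 A t c = lmul2 A t (scal A c)"

definition sub_bimodule ::
  "('b \<Rightarrow> 'm \<Rightarrow> 'm::ab_group_add) \<Rightarrow> ('m \<Rightarrow> 'b \<Rightarrow> 'm) \<Rightarrow> 'm set \<Rightarrow> bool" where
  "sub_bimodule lm rm N \<longleftrightarrow> add_subgroup N \<and> (\<forall>b. \<forall>x\<in>N. lm b x \<in> N \<and> rm x b \<in> N)"

definition universal_rels ::
  "('n, 'b, 'o::ab_group_add) calculus \<Rightarrow> ('o \<Rightarrow> 'o \<Rightarrow> 't::ab_group_add) \<Rightarrow> 't set" where
  "universal_rels A t =
     {(\<Sum>(a, b)\<leftarrow>xs. t (dif A a) (dif A b)) | xs. (\<Sum>(a, b)\<leftarrow>xs. lmul A a (dif A b)) = 0}"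

text \<open>
  \<open>\<pi>\<close> is the projection of \<open>\<Omega> \<otimes>\<^sub>\<B> \<Omega>\<close> onto \<open>\<Omega>\<^sup>2\<close> (that is, \<open>\<pi> (x \<otimes> y) = x \<and> y\<close>). The generators of
  the ideal have degree two, so its degree-two component is the sub-bimodule they generate.
\<close>

definition is_Omega2 :: "('n, 'b, 'o::ab_group_add) calculus \<Rightarrow>
    ('o \<Rightarrow> 'o \<Rightarrow> 't::ab_group_add) \<Rightarrow> ('t \<Rightarrow> 'w::ab_group_add) \<Rightarrow> bool" where
  "is_Omega2 A t \<pi> \<longleftrightarrow> Modules.additive \<pi> \<and> surj \<pi> \<and>
     \<pi> -` {0} = sub_bimodule (lmul2 A t) (rmul2 A t) hull universal_rels A t"

definition lmulw :: "('n, 'b, 'o) calculus \<Rightarrow> ('o \<Rightarrow> 'o \<Rightarrow> 't::ab_group_add) \<Rightarrow> ('t \<Rightarrow> 'w) \<Rightarrow>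
    'b \<Rightarrow> 'w \<Rightarrow> 'w" where
  "lmulw A t \<pi> b = qlift \<pi> (\<lambda>x. \<pi> (lmul2 A t b x))"

definition rmulw :: "('n, 'b, 'o) calculus \<Rightarrow> ('o \<Rightarrow> 'o \<Rightarrow> 't::ab_group_add) \<Rightarrow> ('t \<Rightarrow> 'w) \<Rightarrow>
    'w \<Rightarrow> 'b \<Rightarrow> 'w" where
  "rmulw A t \<pi> x b = qlift \<pi> (\<lambda>x. \<pi> (rmul2 A t x b)) x"

definition is_diff1 :: "('n, 'b, 'o::ab_group_add) calculus \<Rightarrow>
    ('o \<Rightarrow> 'o \<Rightarrow> 't::ab_group_add) \<Rightarrow> ('t \<Rightarrow> 'w::ab_group_add) \<Rightarrow> ('o \<Rightarrow> 'w) \<Rightarrow> bool" where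
  "is_diff1 A t \<pi> d1 \<longleftrightarrow> Modules.additive d1 \<and>
     (\<forall>a b. d1 (lmul A a (dif A b)) = \<pi> (t (dif A a) (dif A b)))"


section \<open>Metric, connection, generalized braiding and splitting map\<close>

definition g_pm :: "('n::finite) qps_data \<Rightarrow> ('n, 'b, 'o) calculus \<Rightarrow>
    ('o \<Rightarrow> 'o \<Rightarrow> 't::ab_group_add) \<Rightarrow> 't" where
  "g_pm D A t = E'12 D (sc2 A t) (E23 (fam_prod t (dp A) (bp A)))"

definition g_mp :: "('n::finite) qps_data \<Rightarrow> ('n, 'b, 'o) calculus \<Rightarrow>
    ('o \<Rightarrow> 'o \<Rightarrow> 't::ab_group_add) \<Rightarrow> 't" where
  "g_mp D A t = E'12 D (sc2 A t) (E23 (fam_prod t (bp A) (dp A)))"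

definition q_metric :: "('n::finite) qps_data \<Rightarrow> ('n, 'b, 'o) calculus \<Rightarrow>
    ('o \<Rightarrow> 'o \<Rightarrow> 't::ab_group_add) \<Rightarrow> 't" where
  "q_metric D A t = g_pm D A t + g_mp D A t"

definition is_inverse_metric :: "('n::finite) qps_data \<Rightarrow> ('n, 'b::ring_1, 'o) calculus \<Rightarrow>
    ('o \<Rightarrow> 'o \<Rightarrow> 't::ab_group_add) \<Rightarrow> ('t \<Rightarrow> 'b) \<Rightarrow> bool" where
  "is_inverse_metric D A t ip \<longleftrightarrow>
     (let q = qpow D; a = ca D; w = cw D; m = cm D; p = pgen A;
          sc = (\<lambda>c x. scal A c * x); pp = fam_prod (*) p p in
      is_bimodule_map (lmul2 A t) (rmul2 A t) (*) (*) ip \<and>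
      (\<forall>k. ip (fam_prod t (dp A) (dp A) k) = 0) \<and>
      (\<forall>k. ip (fam_prod t (bp A) (bp A) k) = 0) \<and>
      (\<forall>k. ip (fam_prod t (dp A) (bp A) k) =
         sc (q a * q (- w - m)) (leg_map sc (S123 D) (C3 p) k) - sc (q a * q (- m)) (pp k)) \<and>
      (\<forall>k. ip (fam_prod t (bp A) (dp A) k) = C'2 D sc p k - sc (q (- m)) (pp k)))"

definition is_levi_civita :: "('n::finite) qps_data \<Rightarrow> ('n, 'b::ring_1, 'o::ab_group_add) calculus \<Rightarrow>
    ('o \<Rightarrow> 'o \<Rightarrow> 't::ab_group_add) \<Rightarrow> ('o \<Rightarrow> 't) \<Rightarrow> bool" where
  "is_levi_civita D A t nab \<longleftrightarrow>
     (let q = qpow D; a = ca D; m = cm D; sc = sc2 A t in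
      Modules.additive nab \<and>
      (\<forall>b x. nab (lmul A b x) = t (dif A b) x + lmul2 A t b (nab x)) \<and>
      (\<forall>k. nab (dp A k) =
         sc (q a) (E23 (leg_map sc (T1234 D) (fam_prod t (bp A) (dp A))) k)
           - sc (q a * q (- m)) (lmul2 A t (pgen A k) (g_mp D A t))) \<and>
      (\<forall>k. nab (bp A k) =
         E23 (fam_prod t (dp A) (bp A)) k - sc (q (- m)) (lmul2 A t (pgen A k) (g_pm D A t))))"

text \<open>The family \<open>p x p\<close> for \<open>x\<close> without legs.\<close>

definition sandwich :: "('n, 'b, 'o) calculus \<Rightarrow> ('o \<Rightarrow> 'o \<Rightarrow> 't::ab_group_add) \<Rightarrow> 't \<Rightarrow>
    'n \<times> 'n \<times> 'n \<times> 'n \<Rightarrow> 't" where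
  "sandwich A t x = fam_prod (\<lambda>b c. rmul2 A t (lmul2 A t b x) c) (pgen A) (pgen A)"

definition is_gen_braiding :: "('n::finite) qps_data \<Rightarrow> ('n, 'b::ring_1, 'o::ab_group_add) calculus \<Rightarrow>
    ('o \<Rightarrow> 'o \<Rightarrow> 't::ab_group_add) \<Rightarrow> ('t \<Rightarrow> 't) \<Rightarrow> bool" where
  "is_gen_braiding D A t sig \<longleftrightarrow>
     (let q = qpow D; a = ca D; w = cw D; m = cm D; sc = sc2 A t in
      is_bimodule_map (lmul2 A t) (rmul2 A t) (lmul2 A t) (rmul2 A t) sig \<and>
      (\<forall>k. sig (fam_prod t (dp A) (dp A) k) =
         sc (q a) (leg_map sc (S123 D ** S234 D) (fam_prod t (dp A) (dp A)) k)) \<and>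
      (\<forall>k. sig (fam_prod t (bp A) (bp A) k) =
         sc (q (- a)) (leg_map sc (S123 D ** S234 D) (fam_prod t (bp A) (bp A)) k)) \<and>
      (\<forall>k. sig (fam_prod t (dp A) (bp A) k) =
         sc (q (2 * a - 2 * w))
           (leg_map sc (S123 D ** matrix_inv (S234 D)) (fam_prod t (bp A) (dp A)) k)
         + sc ((1 - q a) * q a * q (- m)) (sandwich A t (g_mp D A t) k)) \<and>
      (\<forall>k. sig (fam_prod t (bp A) (dp A) k) =
         sc (q (2 * w - 2 * a))
           (leg_map sc (matrix_inv (S123 D) ** S234 D) (fam_prod t (dp A) (bp A)) k)
         + sc ((1 - q (- a)) * q (- m)) (sandwich A t (g_pm D A t) k)))"

definition is_splitting :: "('n::finite) qps_data \<Rightarrow> ('n, 'b::ring_1, 'o::ab_group_add) calculus \<Rightarrow>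
    ('o \<Rightarrow> 'o \<Rightarrow> 't::ab_group_add) \<Rightarrow> ('t \<Rightarrow> 'w::ab_group_add) \<Rightarrow> ('t \<Rightarrow> 't) \<Rightarrow>
    complex \<Rightarrow> complex \<Rightarrow> ('w \<Rightarrow> 't) \<Rightarrow> bool" where
  "is_splitting D A t \<pi> sig c_pm c_mp s \<longleftrightarrow>
     (let q = qpow D; a = ca D; sc = sc2 A t in
      is_bimodule_map (lmulw A t \<pi>) (rmulw A t \<pi>) (lmul2 A t) (rmul2 A t) s \<and>
      (\<forall>x\<in>Omega_plus A. \<forall>y\<in>Omega_plus A. s (\<pi> (t x y)) =
         sc (1 / (1 + q (- a))) (t x y - sc (q (- a)) (sig (t x y)))) \<and>
      (\<forall>x\<in>Omega_minus A. \<forall>y\<in>Omega_minus A. s (\<pi> (t x y)) =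
         sc (1 / (1 + q a)) (t x y - sc (q a) (sig (t x y)))) \<and>
      (\<forall>x\<in>Omega_plus A. \<forall>y\<in>Omega_minus A. s (\<pi> (t x y)) =
         sc c_pm (t x y) - sc c_mp (sig (t x y))) \<and>
      (\<forall>x\<in>Omega_minus A. \<forall>y\<in>Omega_plus A. s (\<pi> (t x y)) =
         sc c_mp (t x y) - sc c_pm (sig (t x y))))"


section \<open>Riemann and Ricci tensors\<close>

text \<open>
  \<open>t21 z y = z \<otimes> y\<close> in \<open>\<Omega>\<^sup>2 \<otimes>\<^sub>\<B> \<Omega>\<close>. The summands \<open>d \<otimes> id\<close> and \<open>(\<and> \<otimes> id) (id \<otimes> \<nabla>)\<close> are not separately
  well defined on \<open>\<Omega> \<otimes>\<^sub>\<B> \<Omega>\<close>, only their difference is; hence the lift of the difference.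
\<close>

definition wedge_id :: "('o \<Rightarrow> 'o \<Rightarrow> 't::ab_group_add) \<Rightarrow> ('t \<Rightarrow> 'w) \<Rightarrow>
    ('w \<Rightarrow> 'o \<Rightarrow> 'u::ab_group_add) \<Rightarrow> 'o \<Rightarrow> 't \<Rightarrow> 'u" where
  "wedge_id t \<pi> t21 x = tlift t (\<lambda>y z. t21 (\<pi> (t x y)) z)"

definition riemann :: "('o \<Rightarrow> 'o \<Rightarrow> 't::ab_group_add) \<Rightarrow> ('t \<Rightarrow> 'w) \<Rightarrow>
    ('w \<Rightarrow> 'o \<Rightarrow> 'u::ab_group_add) \<Rightarrow> ('o \<Rightarrow> 'w) \<Rightarrow> ('o \<Rightarrow> 't) \<Rightarrow> 'o \<Rightarrow> 'u" where
  "riemann t \<pi> t21 d1 nab x = tlift t (\<lambda>y z. t21 (d1 y) z - wedge_id t \<pi> t21 y (nab z)) (nab x)"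

text \<open>
  \<open>t3\<close>, \<open>t4\<close>, \<open>t4'\<close> are the tensor products for \<open>(\<Omega> \<otimes> \<Omega>) \<otimes> \<Omega>\<close>, \<open>\<Omega> \<otimes> (\<Omega>\<^sup>2 \<otimes> \<Omega>)\<close> and
  \<open>\<Omega> \<otimes> ((\<Omega> \<otimes> \<Omega>) \<otimes> \<Omega>)\<close>. \<open>contract_ip\<close> is \<open>(\<cdot>,\<cdot>) \<otimes> id \<otimes> id\<close> on the last of these, with
  \<open>\<B> \<otimes>\<^sub>\<B> \<Omega> \<otimes>\<^sub>\<B> \<Omega>\<close> identified with \<open>\<Omega> \<otimes>\<^sub>\<B> \<Omega>\<close>: it sends \<open>x \<otimes> ((y \<otimes> z) \<otimes> v)\<close> to \<open>(x, y) z \<otimes> v\<close>.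
\<close>

definition contract_ip :: "('n, 'b, 'o) calculus \<Rightarrow> ('o \<Rightarrow> 'o \<Rightarrow> 't::ab_group_add) \<Rightarrow>
    ('t \<Rightarrow> 'o \<Rightarrow> 'x::ab_group_add) \<Rightarrow> ('o \<Rightarrow> 'x \<Rightarrow> 'z::ab_group_add) \<Rightarrow> ('t \<Rightarrow> 'b) \<Rightarrow> 'z \<Rightarrow> 't" where
  "contract_ip A t t3 t4' ip =
     tlift t4' (\<lambda>x. tlift t3 (\<lambda>yz v. tlift t (\<lambda>y z. t (lmul A (ip (t x y)) z) v) yz))"

definition ricci :: "('n::finite) qps_data \<Rightarrow> ('n, 'b, 'o) calculus \<Rightarrow>
    ('o \<Rightarrow> 'o \<Rightarrow> 't::ab_group_add) \<Rightarrow> ('t \<Rightarrow> 'w) \<Rightarrow> ('w \<Rightarrow> 'o \<Rightarrow> 'u::ab_group_add) \<Rightarrow>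
    ('t \<Rightarrow> 'o \<Rightarrow> 'x::ab_group_add) \<Rightarrow> ('o \<Rightarrow> 'u \<Rightarrow> 'y::ab_group_add) \<Rightarrow>
    ('o \<Rightarrow> 'x \<Rightarrow> 'z::ab_group_add) \<Rightarrow>
    ('o \<Rightarrow> 'w) \<Rightarrow> ('t \<Rightarrow> 'b) \<Rightarrow> ('o \<Rightarrow> 't) \<Rightarrow> ('w \<Rightarrow> 't) \<Rightarrow> 't" where
  "ricci D A t \<pi> t21 t3 t4 t4' d1 ip nab s =
     (contract_ip A t t3 t4' ip
       \<circ> tmap t4 t4' id (tmap t21 t3 s id)
       \<circ> tmap t t4 id (riemann t \<pi> t21 d1 nab)) (q_metric D A t)"

end

theory Submission
  imports Defs
begin

text \<open>
  Write \<open>p\<close> for the matrix of the generators and \<open>q\<close> for the parameter. Contracting the defining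
  relations of the algebra and of the calculus shows that \<open>p\<close> is idempotent with quantum trace
  \<open>q\<^sup>r\<close>, and that \<open>p \<partial>p = 0\<close> and \<open>p \<partial>'p = \<partial>'p\<close> as matrix products, where \<open>\<partial>'\<close> is the
  antiholomorphic differential. By the Leibniz rule \<open>\<partial>p p = \<partial>p\<close> and \<open>\<partial>'p p = 0\<close>: the forms \<open>\<partial>p\<close> and
  \<open>\<partial>'p\<close> are the two off-diagonal blocks of \<open>dp\<close>, as in the classical description of projective space
  by projections of rank one. The metric \<open>g\<^sub>+\<^sub>-\<close> is the quantum trace of \<open>\<partial>p \<otimes> \<partial>'p\<close>, the connection
  maps \<open>\<partial>'p\<close> to \<open>\<partial>p \<otimes> \<partial>'p\<close> minus a multiple of \<open>p g\<^sub>+\<^sub>-\<close>, and the inverse metric of \<open>\<partial>p\<close> and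
  \<open>\<partial>'p\<close> is a multiple of \<open>1 - p\<close>. For such data \<open>ricci_of_projection\<close> computes the Ricci functional
  of the metric by matrix algebra; most terms of the curvature cancel or have trace zero.

  For \<open>g\<^sub>-\<^sub>+\<close> the products occur in the opposite order, twisted by the braidings (\<open>star\<close>). The braiding
  from \<open>V \<otimes> V*\<close> to \<open>V* \<otimes> V\<close>, with suitable weights, turns this twisted product into the ordinary
  product of matrices (\<open>hat_star\<close>). So the transformed families form a second projection with the roles of
  \<open>\<partial>\<close> and \<open>\<partial>'\<close> exchanged, and \<open>ricci_of_projection\<close> applies again.

  The generalized braiding enters only through the splitting map, where its values are contracted
  with a form of the type for which the inverse metric vanishes (\<open>contr1_sig\<close>). Hence the splitting
  map acts as the scalar \<open>c\<^sub>-\<^sub>+\<close> on the one part and \<open>c\<^sub>+\<^sub>-\<close> on the other, and the two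
  calculations give \<open>- c\<^sub>-\<^sub>+ q\<^sup>-\<^sup>2\<^sup>r qdim(V) g\<^sub>+\<^sub>-\<close> and \<open>- c\<^sub>+\<^sub>- q\<^sup>2 qdim(V) g\<^sub>-\<^sub>+\<close>. For the given
  coefficients both scalars are the same.

  The contractions need the operators \<open>S\<close> and \<open>S~\<close> explicitly. The fundamental module is a chain of
  weight vectors of multiplicity one (\<open>vector_rep_chain\<close>), a module map on a tensor product of chains
  is determined by its value on one vector (\<open>module_map_unique\<close>), and therefore the braidings are the
  usual Hecke matrices and a partial transpose of one of them (\<open>braiding_VV\<close>, \<open>braiding_V_dual\<close>,
  \<open>braiding_dual_dual\<close>). What is used of them is the quadratic relation, the braid relation, and that
  a contraction slides through crossings.
\<close>

section \<open>The universal property of tensor products\<close>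

definition zmult :: "int \<Rightarrow> 'g \<Rightarrow> 'g::ab_group_add" where
  "zmult n x = (\<Sum>i<nat n. x) - (\<Sum>i<nat (- n). x)"

text \<open>
  The homomorphism out of a free abelian group with prescribed values on the generators, with values
  in an arbitrary abelian group.
\<close>

definition frag_hom :: "('k \<Rightarrow> 'g) \<Rightarrow> ('k \<Rightarrow>\<^sub>0 int) \<Rightarrow> 'g::ab_group_add" where
  "frag_hom g c = (\<Sum>k\<in>Poly_Mapping.keys c. zmult (Poly_Mapping.lookup c k) (g k))"

lemma zmult_add: "zmult (m + n) x = zmult m x + zmult n x"
proof -
  have add: "(\<Sum>i<a + b. x) = (\<Sum>i<a. x) + (\<Sum>i<b. x)" for a b :: nat
    by (induction b) (auto simp: add.assoc)
  have "nat (m + n) + (nat (- m) + nat (- n)) = nat (- (m + n)) + (nat m + nat n)"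
    by linarith
  hence "(\<Sum>i<nat (m + n). x) + ((\<Sum>i<nat (- m). x) + (\<Sum>i<nat (- n). x)) =
     (\<Sum>i<nat (- (m + n)). x) + ((\<Sum>i<nat m. x) + (\<Sum>i<nat n. x))"
    by (simp only: add [symmetric])
  thus ?thesis by (simp add: zmult_def algebra_simps)
qed

lemma frag_hom_additive: "Modules.additive (frag_hom g)"
proof
  fix c d :: "'a \<Rightarrow>\<^sub>0 int"
  let ?K = "Poly_Mapping.keys c \<union> Poly_Mapping.keys d"
  have z0: "zmult 0 x = 0" for x :: 'b by (simp add: zmult_def)
  have *: "frag_hom g e = (\<Sum>k\<in>?K. zmult (Poly_Mapping.lookup e k) (g k))"
    if "Poly_Mapping.keys e \<subseteq> ?K" for e
    unfolding frag_hom_def using that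
    by (intro sum.mono_neutral_left) (auto simp: in_keys_iff z0)
  show "frag_hom g (c + d) = frag_hom g c + frag_hom g d"
    using keys_add[of c d]
    by (simp add: * lookup_add zmult_add sum.distrib)
qed

lemma frag_hom_of: "frag_hom g (frag_of k) = g k"
  by (simp add: frag_hom_def zmult_def)

definition balanced :: "('m::ab_group_add \<Rightarrow> 'b \<Rightarrow> 'm) \<Rightarrow> ('b \<Rightarrow> 'l::ab_group_add \<Rightarrow> 'l) \<Rightarrow>
    ('m \<Rightarrow> 'l \<Rightarrow> 'g::ab_group_add) \<Rightarrow> bool" where
  "balanced rm lm f \<longleftrightarrow> (\<forall>x x' y. f (x + x') y = f x y + f x' y) \<and>
     (\<forall>x y y'. f x (y + y') = f x y + f x y') \<and> (\<forall>x b y. f (rm x b) y = f x (lm b y))"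

lemma balancedI:
  assumes "\<And>x x' y. f (x + x') y = f x y + f x' y" "\<And>x y y'. f x (y + y') = f x y + f x y'"
    "\<And>x b y. f (rm x b) y = f x (lm b y)"
  shows "balanced rm lm f"
  using assms by (simp add: balanced_def)

lemma balanced_additive:
  assumes "balanced rm lm f"
  shows "Modules.additive (f x)" "Modules.additive (\<lambda>x. f x y)"
  using assms by (auto simp: balanced_def Modules.additive_def)

lemma balanced_mid: "balanced rm lm f \<Longrightarrow> f (rm x b) y = f x (lm b y)"
  by (simp add: balanced_def)

lemma add_subgroup_kernel: "Modules.additive h \<Longrightarrow> add_subgroup {x. h x = 0}"
  by (auto simp: add_subgroup_def additive.diff additive.zero)

lemma balanced_rels_kernel:
  assumes "Modules.additive H" "\<And>x y. H (frag_of (x, y)) = g x y"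
  shows "balanced_rels rm lm \<subseteq> {c. H c = 0} \<longleftrightarrow> balanced rm lm g"
proof
  assume *: "balanced_rels rm lm \<subseteq> {c. H c = 0}"
  note H = additive.diff[OF assms(1)] assms(2)
  show "balanced rm lm g"
  proof (rule balancedI)
    show "g (x + x') y = g x y + g x' y" for x x' y
    proof -
      have "frag_of (x + x', y) - frag_of (x, y) - frag_of (x', y) \<in> balanced_rels rm lm"
        unfolding balanced_rels_def by blast
      with * have "H (frag_of (x + x', y) - frag_of (x, y) - frag_of (x', y)) = 0" by blast
      thus ?thesis unfolding H by (simp add: algebra_simps)
    qed
    show "g x (y + y') = g x y + g x y'" for x y y'
    proof -
      have "frag_of (x, y + y') - frag_of (x, y) - frag_of (x, y') \<in> balanced_rels rm lm"
        unfolding balanced_rels_def by blast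
      with * have "H (frag_of (x, y + y') - frag_of (x, y) - frag_of (x, y')) = 0" by blast
      thus ?thesis unfolding H by (simp add: algebra_simps)
    qed
    show "g (rm x b) y = g x (lm b y)" for x b y
    proof -
      have "frag_of (rm x b, y) - frag_of (x, lm b y) \<in> balanced_rels rm lm"
        unfolding balanced_rels_def by blast
      with * have "H (frag_of (rm x b, y) - frag_of (x, lm b y)) = 0" by blast
      thus ?thesis by (simp add: H)
    qed
  qed
next
  note H = additive.diff[OF assms(1)] assms(2)
  assume "balanced rm lm g"
  thus "balanced_rels rm lm \<subseteq> {c. H c = 0}"
    by (auto simp: balanced_rels_def balanced_def H)
qed

lemma is_tensor_balanced:
  assumes "is_tensor rm lm t"
  shows "balanced rm lm t"
proof -
  obtain f where f: "Modules.additive f" "f -` {0} = add_subgroup hull balanced_rels rm lm"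
    "\<And>x y. t x y = f (frag_of (x, y))"
    using assms unfolding is_tensor_def by blast
  have "balanced_rels rm lm \<subseteq> {c. f c = 0}"
    using hull_subset[of "balanced_rels rm lm" add_subgroup] f(2) by auto
  thus ?thesis using balanced_rels_kernel[OF f(1), of t] f(3) by metis
qed

lemma tensor_induct:
  assumes t: "is_tensor rm lm t"
    and zero: "P 0" and pure: "\<And>x y. P (t x y)" and diff: "\<And>z w. P z \<Longrightarrow> P w \<Longrightarrow> P (z - w)"
  shows "P z"
proof -
  obtain f where f: "Modules.additive f" "surj f" "\<And>x y. t x y = f (frag_of (x, y))"
    using t unfolding is_tensor_def by blast
  have "P (f c)" for c
  proof (rule frag_induction[of c UNIV])
    show "P (f 0)" using zero by (simp add: additive.zero[OF f(1)])
    show "P (f (frag_of x))" for x using pure[of "fst x" "snd x"] f(3)[of "fst x" "snd x"] by simp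
    show "P (f (a - b))" if "P (f a)" "P (f b)" for a b
      using diff[OF that] by (simp add: additive.diff[OF f(1)])
  qed simp
  thus ?thesis using f(2) by (metis surj_def)
qed

lemma tensor_ext:
  assumes t: "is_tensor rm lm t" and "Modules.additive f" "Modules.additive g"
    and "\<And>x y. f (t x y) = g (t x y)"
  shows "f z = g z"
  using t
proof (rule tensor_induct)
  show "f 0 = g 0" using assms by (simp add: additive.zero)
  show "f (x - y) = g (x - y)" if "f x = g x" "f y = g y" for x y
    using assms that by (simp add: additive.diff)
qed (use assms in simp)

text \<open>
  A balanced map kills the balancing relations, hence factors through the quotient of the free
  group by the subgroup which they generate.
\<close>

lemma tlift_universal:
  assumes t: "is_tensor rm lm t" and g: "balanced rm lm g"
  shows "Modules.additive (tlift t g)"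
    and "tlift t g (t x y) = g x y"
proof -
  obtain f where f: "Modules.additive f" "surj f"
    "f -` {0} = add_subgroup hull balanced_rels rm lm" "\<And>x y. t x y = f (frag_of (x, y))"
    using t unfolding is_tensor_def by blast
  define H where "H = frag_hom (\<lambda>(x, y). g x y)"
  have H: "Modules.additive H" "\<And>x y. H (frag_of (x, y)) = g x y"
    unfolding H_def by (simp_all add: frag_hom_additive frag_hom_of)
  have "add_subgroup hull balanced_rels rm lm \<subseteq> {c. H c = 0}"
    using g balanced_rels_kernel[OF H] by (intro hull_minimal add_subgroup_kernel H) blast
  hence "H c = 0" if "f c = 0" for c using f(3) that by blast
  hence eq: "H c = H d" if "f c = f d" for c d
    using that additive.diff[OF f(1)] additive.diff[OF H(1)] by (metis diff_eq_diff_eq diff_self)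
  define h where "h z = H (inv f z)" for z
  have hf: "h (f c) = H c" for c
    unfolding h_def by (intro eq) (simp add: f(2) surj_f_inv_f)
  have h: "Modules.additive h \<and> (\<forall>x y. h (t x y) = g x y)"
  proof (intro conjI allI additive.intro)
    show "h (z + w) = h z + h w" for z w
    proof -
      obtain c d where "z = f c" "w = f d" using f(2) by (metis surj_def)
      thus ?thesis by (simp add: hf additive.add[OF f(1), symmetric] additive.add[OF H(1)])
    qed
    show "h (t x y) = g x y" for x y by (simp add: f(4) hf H(2))
  qed
  have "tlift t g = h" unfolding tlift_def
    by (intro the_equality h ext) (metis tensor_ext[OF t] h)
  with h show "Modules.additive (tlift t g)" "tlift t g (t x y) = g x y" by simp_all
qed

lemma tmap_universal:
  assumes t: "is_tensor rm lm t" and t': "balanced rm' lm' t'"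
    and "Modules.additive f" "Modules.additive g"
    and "\<And>x b y. t' (f (rm x b)) (g y) = t' (f x) (g (lm b y))"
  shows "Modules.additive (tmap t t' f g)"
    and "tmap t t' f g (t x y) = t' (f x) (g y)"
proof -
  have "balanced rm lm (\<lambda>x y. t' (f x) (g y))"
    using t' assms(3-5) by (auto simp: balanced_def additive.add)
  thus "Modules.additive (tmap t t' f g)" "tmap t t' f g (t x y) = t' (f x) (g y)"
    unfolding tmap_def using tlift_universal[OF t] by blast+
qed

lemma additive_id: "Modules.additive id" "Modules.additive (\<lambda>x. x)"
  by (auto simp: Modules.additive_def)

lemma additive_comp:
  "Modules.additive f \<Longrightarrow> Modules.additive g \<Longrightarrow> Modules.additive (\<lambda>x. f (g x))"
  by (auto simp: Modules.additive_def)

lemma additive_plus: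
  "Modules.additive f \<Longrightarrow> Modules.additive g \<Longrightarrow> Modules.additive (\<lambda>x. f x + g x)"
  by (auto simp: Modules.additive_def algebra_simps)

lemma tleft_universal:
  assumes t: "is_tensor rm lm t" and "\<And>b. Modules.additive (lm' b)"
    and "\<And>b c x. lm' b (rm x c) = rm (lm' b x) c"
  shows "Modules.additive (tleft t lm' b)"
    and "tleft t lm' b (t x y) = t (lm' b x) y"
  unfolding tleft_def
  using tmap_universal[OF t is_tensor_balanced[OF t], of "lm' b" id] assms(2,3)
    balanced_mid[OF is_tensor_balanced[OF t]]
  by (simp_all add: additive_id)

lemma tright_universal:
  assumes t: "is_tensor rm lm t" and "\<And>b. Modules.additive (\<lambda>y. rm' y b)"
    and "\<And>b c y. rm' (lm c y) b = lm c (rm' y b)"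
  shows "Modules.additive (\<lambda>z. tright t rm' z b)"
    and "tright t rm' (t x y) b = t x (rm' y b)"
  unfolding tright_def
  using tmap_universal[OF t is_tensor_balanced[OF t], of id "\<lambda>y. rm' y b"] assms(2,3)
    balanced_mid[OF is_tensor_balanced[OF t]]
  by (simp_all add: additive_id)

section \<open>The algebra and the first-order calculus\<close>

lemma fconst_central: "fconst c * x = x * fconst c"
proof (induction x rule: update_induct)
  case (update f a b)
  have "Poly_Mapping.update a b f = f + Poly_Mapping.single a b"
    using update by (intro poly_mapping_eqI) (auto simp: lookup_update lookup_add lookup_single in_keys_iff)
  moreover have "fconst c * Poly_Mapping.single a b = Poly_Mapping.single a b * fconst c"
    by (simp add: fconst_def mult_single mult.commute)
  ultimately show ?case using update by (simp add: algebra_simps)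
qed simp

locale fodc =
  fixes D :: "('n::finite) qps_data" and A :: "('n, 'b::ring_1, 'o::ab_group_add) calculus"
  assumes algB: "is_algebra_B D A" and HK: "is_HK_calculus D A"
begin

abbreviation "sc0 c (b::'b) \<equiv> scal A c * b"
abbreviation "lm \<equiv> lmul A"
abbreviation "rm \<equiv> rmul A"

lemma bproj_hom: "bproj A (x + y) = bproj A x + bproj A y" "bproj A (x * y) = bproj A x * bproj A y"
   "bproj A 1 = 1" "surj (bproj A)"
  using algB by (auto simp: is_algebra_B_def)

lemma bproj_additive: "Modules.additive (bproj A)"
  by (rule additive.intro) (rule bproj_hom)

lemma scal_hom [simp]: "scal A 0 = 0" "scal A 1 = 1" "scal A (c + d) = scal A c + scal A d"
   "scal A (c * d) = scal A c * scal A d" "scal A (- c) = - scal A c" "scal A (c - d) = scal A c - scal A d"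
proof -
  show a: "scal A (c + d) = scal A c + scal A d" for c d
    by (simp add: scal_def fconst_def single_add bproj_hom)
  have "Modules.additive (scal A)" by (rule additive.intro) (rule a)
  note additive.zero[OF this] additive.minus[OF this] additive.diff[OF this]
  thus "scal A 0 = 0" "scal A (- c) = - scal A c" "scal A (c - d) = scal A c - scal A d" by auto
  show "scal A 1 = 1" by (simp add: scal_def fconst_def bproj_hom(3))
  show "scal A (c * d) = scal A c * scal A d"
    by (simp add: scal_def fconst_def mult_single bproj_hom(2)[symmetric])
qed

lemma scal_central: "b * scal A c = scal A c * b"
  using bproj_hom(2) fconst_central bproj_hom(4) unfolding scal_def by (metis surjD)

lemma bimod: "is_bimodule lm rm"
  using HK by (simp add: is_HK_calculus_def)

lemma lm_simps: "lm b (x + y) = lm b x + lm b y" "lm (b + c) x = lm b x + lm c x"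
   "lm (b * c) x = lm b (lm c x)" "lm 1 x = x"
  and rm_simps: "rm (x + y) b = rm x b + rm y b" "rm x (b + c) = rm x b + rm x c"
   "rm x (b * c) = rm (rm x b) c" "rm x 1 = x"
  and lm_rm: "rm (lm b x) c = lm b (rm x c)"
  using bimod by (auto simp: is_bimodule_def)

lemma lm_additive: "Modules.additive (lm b)" "Modules.additive (\<lambda>b. lm b x)"
   and rm_additive: "Modules.additive (\<lambda>x. rm x b)" "Modules.additive (rm x)"
  by (auto simp: Modules.additive_def lm_simps rm_simps)

lemma rm_scal: "rm x (scal A c) = sc1 A c x"
  using HK by (simp add: is_HK_calculus_def sc1_def)

lemma module0: "module (sc0 :: complex \<Rightarrow> 'b \<Rightarrow> 'b)"
  by unfold_locales (auto simp: algebra_simps)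

lemma module1: "module (sc1 A)"
  by unfold_locales (auto simp: sc1_def lm_simps)

lemma lm_sc1: "lm b (sc1 A c x) = sc1 A c (lm b x)"
  by (simp add: rm_scal[symmetric] lm_rm)

lemma lm_sc0: "lm (scal A c * b) x = sc1 A c (lm b x)"
  by (simp add: lm_simps sc1_def)

lemma rm_sc1: "rm (sc1 A c x) b = sc1 A c (rm x b)"
  by (simp add: sc1_def lm_rm)

lemma dif_derivation: "dif A (a + b) = dif A a + dif A b" "dif A (scal A c) = 0"
  "dif A (a * b) = rm (dif A a) b + lm a (dif A b)"
  using HK by (auto simp: is_HK_calculus_def is_derivation_def dif_def rm_simps lm_simps algebra_simps)

lemma dif_1 [simp]: "dif A 1 = 0"
  using dif_derivation(2)[of 1] by simp

lemma dif_pgen: "dif A (pgen A k) = dp A k + bp A k"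
  using HK unfolding is_HK_calculus_def dif_def by metis

lemma Omega_split: "\<exists>x\<in>Omega_plus A. \<exists>y\<in>Omega_minus A. z = x + y"
proof -
  have "\<exists>!p. p \<in> Omega_plus A \<times> Omega_minus A \<and> z = fst p + snd p"
    using HK unfolding is_HK_calculus_def by blast
  thus ?thesis by (auto simp: mem_Times_iff)
qed

end

section \<open>The calculus in degree two, curvature and contraction\<close>

text \<open>
  Each map which occurs in the Ricci tensor is defined by a universal property. In this context these
  properties are shown to apply, so that the maps can be calculated on pure tensors. The last
  assumption says that the forms \<open>a db\<close> span; it is phrased as an induction rule because the Leibniz
  rules of \<open>d1\<close> are proved by induction along it.
\<close>

locale ricci_setup = fodc D A
  for D :: "('n::finite) qps_data" and A :: "('n, 'b::ring_1, 'o::ab_group_add) calculus" +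
  fixes t :: "'o \<Rightarrow> 'o \<Rightarrow> 't::ab_group_add"
    and \<pi> :: "'t \<Rightarrow> 'w::ab_group_add"
    and t21 :: "'w \<Rightarrow> 'o \<Rightarrow> 'u::ab_group_add"
    and t3 :: "'t \<Rightarrow> 'o \<Rightarrow> 'x::ab_group_add"
    and t4 :: "'o \<Rightarrow> 'u \<Rightarrow> 'y::ab_group_add"
    and t4' :: "'o \<Rightarrow> 'x \<Rightarrow> 'z::ab_group_add"
    and d1 :: "'o \<Rightarrow> 'w" and ip :: "'t \<Rightarrow> 'b" and nab :: "'o \<Rightarrow> 't"
    and s :: "'w \<Rightarrow> 't"
  assumes t: "is_tensor (rmul A) (lmul A) t"
    and Om2: "is_Omega2 A t \<pi>"
    and t21: "is_tensor (rmulw A t \<pi>) (lmul A) t21"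
    and t3: "is_tensor (rmul2 A t) (lmul A) t3"
    and t4: "is_tensor (rmul A) (tleft t21 (lmulw A t \<pi>)) t4"
    and t4': "is_tensor (rmul A) (tleft t3 (lmul2 A t)) t4'"
    and d1: "is_diff1 A t \<pi> d1"
    and ip: "is_bimodule_map (lmul2 A t) (rmul2 A t) (*) (*) ip"
    and nab_add: "Modules.additive nab"
    and nab_leibniz: "nab (lmul A b x) = t (dif A b) x + lmul2 A t b (nab x)"
    and s: "is_bimodule_map (lmulw A t \<pi>) (rmulw A t \<pi>) (lmul2 A t) (rmul2 A t) s"
    and dif_spans: "\<And>P x. P 0 \<Longrightarrow> (\<And>y z. P y \<Longrightarrow> P z \<Longrightarrow> P (y + z)) \<Longrightarrow>
       (\<And>a b. P (lmul A a (dif A b))) \<Longrightarrow> P x"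
begin

abbreviation "lm2 \<equiv> lmul2 A t"
abbreviation "rm2 \<equiv> rmul2 A t"
abbreviation "lmw \<equiv> lmulw A t \<pi>"
abbreviation "rmw \<equiv> rmulw A t \<pi>"
abbreviation "L21 \<equiv> tleft t21 (lmulw A t \<pi>)"
abbreviation "L3 \<equiv> tleft t3 (lmul2 A t)"

lemmas t_bal = is_tensor_balanced[OF t]
lemmas t21_bal = is_tensor_balanced[OF t21]
lemmas t3_bal = is_tensor_balanced[OF t3]
lemmas t4_bal = is_tensor_balanced[OF t4]
lemmas t4'_bal = is_tensor_balanced[OF t4']

lemma t_add: "t (x + x') y = t x y + t x' y" "t x (y + y') = t x y + t x y'"
   "t (rm x b) y = t x (lm b y)"
  using t_bal by (auto simp: balanced_def)

lemma lm2_additive: "Modules.additive (lm2 b)" and lm2_pure: "lm2 b (t x y) = t (lm b x) y"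
  unfolding lmul2_def using tleft_universal[OF t, of lm] lm_additive lm_rm by auto

lemma rm2_additive: "Modules.additive (\<lambda>z. rm2 z b)" and rm2_pure: "rm2 (t x y) b = t x (rm y b)"
  unfolding rmul2_def using tright_universal[OF t, of rm] rm_additive lm_rm by auto

lemma lm2_simps: "lm2 b (z + w) = lm2 b z + lm2 b w" "lm2 (b + c) z = lm2 b z + lm2 c z"
   "lm2 (b * c) z = lm2 b (lm2 c z)" "lm2 1 z = z"
proof -
  show "lm2 b (z + w) = lm2 b z + lm2 b w" by (rule additive.add[OF lm2_additive])
  show "lm2 (b + c) z = lm2 b z + lm2 c z"
    by (rule tensor_ext[OF t, of _ "\<lambda>z. lm2 b z + lm2 c z"])
       (auto intro!: lm2_additive additive_plus simp: lm2_pure lm_simps t_add)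
  show "lm2 (b * c) z = lm2 b (lm2 c z)"
    by (rule tensor_ext[OF t, of _ "\<lambda>z. lm2 b (lm2 c z)"])
       (auto intro!: lm2_additive additive_comp[of "lm2 b"] simp: lm2_pure lm_simps)
  show "lm2 1 z = z"
    by (rule tensor_ext[OF t, of _ "\<lambda>z. z"])
       (auto intro!: lm2_additive additive_id simp: lm2_pure lm_simps)
qed

lemma lm2_rm2: "rm2 (lm2 b z) c = lm2 b (rm2 z c)"
  by (rule tensor_ext[OF t, of "\<lambda>z. rm2 (lm2 b z) c" "\<lambda>z. lm2 b (rm2 z c)"])
     (auto intro!: additive_comp[OF rm2_additive lm2_additive] additive_comp[OF lm2_additive rm2_additive]
       simp: lm2_pure rm2_pure)

lemma module2: "module (sc2 A t)"
  by unfold_locales (auto simp: sc2_def lm2_simps)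

lemma t_sc: "t (sc1 A c x) y = sc2 A t c (t x y)" "t x (sc1 A c y) = sc2 A t c (t x y)"
proof -
  show 1: "t (sc1 A c x) y = sc2 A t c (t x y)" by (simp add: sc1_def sc2_def lm2_pure)
  show "t x (sc1 A c y) = sc2 A t c (t x y)"
    by (simp add: sc1_def t_add(3)[symmetric] rm_scal 1[unfolded sc1_def])
qed

lemma pi_additive: "Modules.additive \<pi>" and pi_surj: "surj \<pi>"
  and pi_kernel: "\<pi> -` {0} = sub_bimodule lm2 rm2 hull universal_rels A t"
  using Om2 by (auto simp: is_Omega2_def)

lemma pi_kernel_closed: "\<pi> z = 0 \<Longrightarrow> \<pi> (lm2 b z) = 0 \<and> \<pi> (rm2 z b) = 0"
proof -
  have "sub_bimodule lm2 rm2 (sub_bimodule lm2 rm2 hull universal_rels A t)"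
    by (rule hull_in) (fastforce simp: sub_bimodule_def add_subgroup_def)
  thus "\<pi> z = 0 \<Longrightarrow> \<pi> (lm2 b z) = 0 \<and> \<pi> (rm2 z b) = 0"
    unfolding pi_kernel[symmetric] sub_bimodule_def by auto
qed

lemma qlift_eq:
  assumes "Modules.additive f" "\<And>z. \<pi> z = 0 \<Longrightarrow> f z = 0"
  shows "qlift \<pi> f (\<pi> z) = f z"
proof -
  have eq: "f z = f w" if "\<pi> z = \<pi> w" for z w
    using assms(2)[of "z - w"] that by (simp add: additive.diff[OF assms(1)] additive.diff[OF pi_additive])
  define h where "h x = f (inv \<pi> x)" for x
  have h: "h (\<pi> x) = f x" for x
    unfolding h_def by (rule eq) (simp add: surj_f_inv_f pi_surj)
  hence "qlift \<pi> f = h" unfolding qlift_def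
    by (intro the_equality) (auto simp: fun_eq_iff, metis pi_surj surjD)
  thus ?thesis by (simp add: h)
qed

lemma lmw_pi: "lmw b (\<pi> z) = \<pi> (lm2 b z)"
  unfolding lmulw_def using pi_kernel_closed
  by (subst qlift_eq) (auto intro!: additive_comp[OF pi_additive] lm2_additive)

lemma rmw_pi: "rmw (\<pi> z) b = \<pi> (rm2 z b)"
  unfolding rmulw_def using pi_kernel_closed
  by (subst qlift_eq) (auto intro!: additive_comp[OF pi_additive] rm2_additive)

lemma lmw_additive: "Modules.additive (lmw b)"
proof
  fix x y show "lmw b (x + y) = lmw b x + lmw b y"
    using pi_surj additive.add[OF pi_additive] by (metis lmw_pi lm2_simps(1) surjD)
qed

lemma rmw_additive: "Modules.additive (\<lambda>x. rmw x b)"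
proof
  fix x y show "rmw (x + y) b = rmw x b + rmw y b"
    using pi_surj additive.add[OF pi_additive] additive.add[OF rm2_additive]
    by (metis rmw_pi surjD)
qed

lemma lmw_rmw: "rmw (lmw b x) c = lmw b (rmw x c)"
  using pi_surj lm2_rm2 by (metis rmw_pi lmw_pi surjD)

lemma d1_additive: "Modules.additive d1" and d1_dif: "d1 (lm a (dif A b)) = \<pi> (t (dif A a) (dif A b))"
  using d1 by (auto simp: is_diff1_def)

lemma pi_add: "\<pi> (x + y) = \<pi> x + \<pi> y" "\<pi> (x - y) = \<pi> x - \<pi> y" "\<pi> 0 = 0"
  using additive.add[OF pi_additive] additive.diff[OF pi_additive] additive.zero[OF pi_additive] by auto

lemma t_0: "t 0 y = 0" "t x 0 = 0" "t (x - x') y = t x y - t x' y" "t x (y - y') = t x y - t x y'"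
  using additive.zero[OF balanced_additive(1)[OF t_bal]] additive.zero[OF balanced_additive(2)[OF t_bal]]
    additive.diff[OF balanced_additive(1)[OF t_bal]] additive.diff[OF balanced_additive(2)[OF t_bal]]
  by auto

lemma d1_exact [simp]: "d1 (dif A b) = 0"
  using d1_dif[of 1 b] by (simp add: lm_simps t_0 pi_add)

lemma d1_lm: "d1 (lm b y) = \<pi> (t (dif A b) y) + lmw b (d1 y)"
proof (induction y rule: dif_spans)
  case 1 show ?case by (simp add: additive.zero[OF lm_additive(1)] additive.zero[OF d1_additive]
      additive.zero[OF lmw_additive] t_0 pi_add)
next
  case (2 y z) thus ?case
    by (simp add: lm_simps additive.add[OF d1_additive] additive.add[OF lmw_additive] t_add pi_add)
next
  case (3 a c)
  have "d1 (lm b (lm a (dif A c))) = \<pi> (t (dif A (b * a)) (dif A c))"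
    by (simp add: lm_simps(3)[symmetric] d1_dif)
  thus ?case by (simp add: d1_dif dif_derivation t_add pi_add lmw_pi lm2_pure)
qed

lemma d1_rm: "d1 (rm y b) = rmw (d1 y) b - \<pi> (t y (dif A b))"
proof (induction y rule: dif_spans)
  case 1 show ?case by (simp add: additive.zero[OF rm_additive(1)] additive.zero[OF d1_additive]
      additive.zero[OF rmw_additive] t_0 pi_add)
next
  case (2 y z) thus ?case
    by (simp add: rm_simps additive.add[OF d1_additive] additive.add[OF rmw_additive] t_add pi_add)
next
  case (3 a c)
  have "rm (lm a (dif A c)) b = lm a (dif A (c * b)) - lm (a * c) (dif A b)"
    by (simp add: dif_derivation lm_simps lm_rm algebra_simps)
  hence "d1 (rm (lm a (dif A c)) b) = \<pi> (t (dif A a) (dif A (c * b))) - \<pi> (t (dif A (a * c)) (dif A b))"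
    by (simp add: additive.diff[OF d1_additive] d1_dif)
  also have "\<dots> = \<pi> (t (dif A a) (rm (dif A c) b)) - \<pi> (t (lm a (dif A c)) (dif A b))"
    by (simp add: dif_derivation t_add pi_add)
  finally show ?case by (simp add: d1_dif rmw_pi rm2_pure)
qed

lemma t21_simps: "t21 (x + x') y = t21 x y + t21 x' y" "t21 x (y + y') = t21 x y + t21 x y'"
   "t21 (rmw x b) y = t21 x (lm b y)" "t21 0 y = 0" "t21 (x - x') y = t21 x y - t21 x' y"
  using t21_bal additive.zero[OF balanced_additive(2)[OF t21_bal]]
   additive.diff[OF balanced_additive(2)[OF t21_bal]] by (auto simp: balanced_def)

lemma L21_additive: "Modules.additive (L21 b)" and L21_pure: "L21 b (t21 x y) = t21 (lmw b x) y"
  using tleft_universal[OF t21, of lmw] lmw_additive lmw_rmw by auto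

abbreviation "wi \<equiv> wedge_id t \<pi> t21"

lemma wi_bal: "balanced rm lm (\<lambda>y z. t21 (\<pi> (t x y)) z)"
  by (rule balancedI) (simp_all add: t_add pi_add t21_simps rm2_pure[symmetric] rmw_pi[symmetric])

lemma wi_additive: "Modules.additive (wi x)" and wi_pure: "wi x (t y z) = t21 (\<pi> (t x y)) z"
  unfolding wedge_id_def using tlift_universal[OF t wi_bal] by auto

lemma wi_simps: "wi (x + y) z = wi x z + wi y z" "wi (lm b x) z = L21 b (wi x z)"
  "wi (rm x b) z = wi x (lm2 b z)"
proof -
  show "wi (x + y) z = wi x z + wi y z"
    by (rule tensor_ext[OF t, of _ "\<lambda>z. wi x z + wi y z"])
       (auto intro!: wi_additive additive_plus simp: wi_pure t_add pi_add t21_simps)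
  show "wi (lm b x) z = L21 b (wi x z)"
    by (rule tensor_ext[OF t, of _ "\<lambda>z. L21 b (wi x z)"])
       (auto intro!: wi_additive additive_comp[OF L21_additive]
         simp: wi_pure L21_pure lmw_pi lm2_pure)
  show "wi (rm x b) z = wi x (lm2 b z)"
    by (rule tensor_ext[OF t, of _ "\<lambda>z. wi x (lm2 b z)"])
       (auto intro!: wi_additive additive_comp[OF wi_additive] lm2_additive
         simp: wi_pure lm2_pure t_add)
qed

text \<open>
  \<open>curv\<close> is \<open>d \<otimes> id - (\<and> \<otimes> id) (id \<otimes> \<nabla>)\<close>; the Leibniz rules of \<open>d\<close> and \<open>\<nabla>\<close> produce the same
  extra term, so that the difference is balanced although its two summands are not.
\<close>

definition curv :: "'t \<Rightarrow> 'u" where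
  "curv = tlift t (\<lambda>y z. t21 (d1 y) z - wi y (nab z))"

lemma curv_bal: "balanced rm lm (\<lambda>y z. t21 (d1 y) z - wi y (nab z))"
proof (rule balancedI)
  show "t21 (d1 (rm x b)) y - wi (rm x b) (nab y) = t21 (d1 x) (lm b y) - wi x (nab (lm b y))" for x b y
    by (simp add: d1_rm t21_simps wi_simps nab_leibniz additive.add[OF wi_additive] wi_pure algebra_simps)
qed (simp_all add: additive.add[OF d1_additive] t21_simps wi_simps additive.add[OF nab_add]
   additive.add[OF wi_additive])

lemma curv_additive: "Modules.additive curv" and curv_pure: "curv (t y z) = t21 (d1 y) z - wi y (nab z)"
  unfolding curv_def using tlift_universal[OF t curv_bal] by auto

lemma curv_lm: "curv (lm2 b z) = wi (dif A b) z + L21 b (curv z)"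
  by (rule tensor_ext[OF t, of "\<lambda>z. curv (lm2 b z)" "\<lambda>z. wi (dif A b) z + L21 b (curv z)"])
     (auto intro!: additive_comp[OF curv_additive lm2_additive] additive_plus wi_additive
        additive_comp[OF L21_additive curv_additive]
       simp: curv_pure lm2_pure d1_lm t21_simps wi_simps wi_pure additive.diff[OF L21_additive] L21_pure)

abbreviation "riem \<equiv> riemann t \<pi> t21 d1 nab"

lemma riem_curv: "riem x = curv (nab x)"
  by (simp add: riemann_def curv_def)

lemma riem_additive: "Modules.additive riem"
  unfolding riem_curv by (rule additive_comp[OF curv_additive nab_add])

lemma riem_lm: "riem (lm b x) = L21 b (riem x)"
  by (simp add: riem_curv nab_leibniz additive.add[OF curv_additive] curv_pure curv_lm t21_simps)

lemma s_simps: "Modules.additive s" "s (lmw b x) = lm2 b (s x)" "s (rmw x b) = rm2 (s x) b"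
  using s by (auto simp: is_bimodule_map_def)

lemma L3_additive: "Modules.additive (L3 b)" and L3_pure: "L3 b (t3 x y) = t3 (lm2 b x) y"
  using tleft_universal[OF t3, of lm2] lm2_additive lm2_rm2 by auto

definition split_id :: "'u \<Rightarrow> 'x" where
  "split_id = tmap t21 t3 s id"

lemma split_id_additive: "Modules.additive split_id" and split_id_pure: "split_id (t21 x y) = t3 (s x) y"
  unfolding split_id_def using tmap_universal[OF t21 t3_bal s_simps(1) additive_id(1)]
   balanced_mid[OF t3_bal] by (auto simp: s_simps)

lemma split_id_lm: "split_id (L21 b z) = L3 b (split_id z)"
  by (rule tensor_ext[OF t21, of "\<lambda>z. split_id (L21 b z)" "\<lambda>z. L3 b (split_id z)"])
     (auto intro!: additive_comp[OF split_id_additive L21_additive]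
         additive_comp[OF L3_additive split_id_additive]
       simp: L21_pure L3_pure split_id_pure s_simps)

lemma ip_simps: "Modules.additive ip" "ip (lm2 b x) = b * ip x" "ip (rm2 x b) = ip x * b"
  using ip by (auto simp: is_bimodule_map_def)

lemma ip_t: "ip (z + z') = ip z + ip z'"
   "ip (t x (rm y b)) = ip (t x y) * b" "ip (t (lm b x) y) = b * ip (t x y)"
  by (simp_all add: t_add additive.add[OF ip_simps(1)] rm2_pure[symmetric] lm2_pure[symmetric] ip_simps)

text \<open>
  The composition \<open>x \<otimes> ((y \<otimes> z) \<otimes> v) \<mapsto> (x, y) z \<otimes> v\<close> in two stages, one for each nested tensor
  product in the second factor.
\<close>

definition contr1 :: "'o \<Rightarrow> 'o \<Rightarrow> 't \<Rightarrow> 't" where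
  "contr1 x v = tlift t (\<lambda>y z. t (lm (ip (t x y)) z) v)"

lemma contr1_bal: "balanced rm lm (\<lambda>y z. t (lm (ip (t x y)) z) v)"
  by (rule balancedI) (simp_all add: ip_t lm_simps t_add)

lemma contr1_additive: "Modules.additive (contr1 x v)"
  and contr1_pure: "contr1 x v (t y z) = t (lm (ip (t x y)) z) v"
  unfolding contr1_def using tlift_universal[OF t contr1_bal] by auto

definition contr2 :: "'o \<Rightarrow> 'x \<Rightarrow> 't" where
  "contr2 x = tlift t3 (\<lambda>yz v. contr1 x v yz)"

lemma contr2_bal: "balanced rm2 lm (\<lambda>yz v. contr1 x v yz)"
proof (rule balancedI)
  show "contr1 x (v + v') yz = contr1 x v yz + contr1 x v' yz" for v v' yz
    by (rule tensor_ext[OF t, of _ "\<lambda>yz. contr1 x v yz + contr1 x v' yz"])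
       (auto intro!: contr1_additive additive_plus simp: contr1_pure t_add)
  show "contr1 x v (rm2 yz b) = contr1 x (lm b v) yz" for yz b v
    by (rule tensor_ext[OF t, of "\<lambda>yz. contr1 x v (rm2 yz b)"])
       (auto intro!: contr1_additive additive_comp[OF contr1_additive rm2_additive]
         simp: contr1_pure t_add rm2_pure lm_rm[symmetric])
qed (simp add: additive.add[OF contr1_additive])

lemma contr2_additive: "Modules.additive (contr2 x)"
  and contr2_pure: "contr2 x (t3 yz v) = contr1 x v yz"
  unfolding contr2_def using tlift_universal[OF t3 contr2_bal] by auto

lemma contr1_simps: "contr1 (x + x') v z = contr1 x v z + contr1 x' v z"
  "contr1 (rm x b) v z = contr1 x v (lm2 b z)"
proof -
  show "contr1 (x + x') v z = contr1 x v z + contr1 x' v z"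
    by (rule tensor_ext[OF t, of _ "\<lambda>z. contr1 x v z + contr1 x' v z"])
       (auto intro!: contr1_additive additive_plus simp: contr1_pure ip_t lm_simps t_add)
  show "contr1 (rm x b) v z = contr1 x v (lm2 b z)"
    by (rule tensor_ext[OF t, of _ "\<lambda>z. contr1 x v (lm2 b z)"])
       (auto intro!: contr1_additive additive_comp[OF contr1_additive lm2_additive]
          simp: contr1_pure t_add lm2_pure)
qed

lemma contr2_simps: "contr2 (x + x') z = contr2 x z + contr2 x' z" "contr2 (rm x b) z = contr2 x (L3 b z)"
proof -
  show "contr2 (x + x') z = contr2 x z + contr2 x' z"
    by (rule tensor_ext[OF t3, of _ "\<lambda>z. contr2 x z + contr2 x' z"])
       (auto intro!: contr2_additive additive_plus simp: contr2_pure contr1_simps)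
  show "contr2 (rm x b) z = contr2 x (L3 b z)"
    by (rule tensor_ext[OF t3, of _ "\<lambda>z. contr2 x (L3 b z)"])
       (auto intro!: contr2_additive additive_comp[OF contr2_additive L3_additive]
          simp: contr2_pure contr1_simps L3_pure)
qed

lemma contract_pure: "contract_ip A t t3 t4' ip (t4' x z) = contr2 x z"
  and contract_additive: "Modules.additive (contract_ip A t t3 t4' ip)"
proof -
  have "balanced rm L3 contr2"
    by (rule balancedI) (simp_all add: contr2_simps additive.add[OF contr2_additive])
  moreover have "contract_ip A t t3 t4' ip = tlift t4' contr2"
    unfolding contract_ip_def contr2_def contr1_def ..
  ultimately show "contract_ip A t t3 t4' ip (t4' x z) = contr2 x z"
     "Modules.additive (contract_ip A t t3 t4' ip)"
    using tlift_universal[OF t4'] by auto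
qed

text \<open>
  The Ricci functional, of which the Ricci tensor is the value at the metric. It is additive, so the
  two parts of the metric can be treated separately.
\<close>

definition ric :: "'t \<Rightarrow> 't" where
  "ric = contract_ip A t t3 t4' ip \<circ> tmap t4 t4' id split_id \<circ> tmap t t4 id riem"

lemma ric_additive: "Modules.additive ric" and ric_pure: "ric (t x y) = contr2 x (split_id (riem y))"
proof -
  have 1: "Modules.additive (tmap t t4 id riem)" "tmap t t4 id riem (t x y) = t4 x (riem y)" for x y
    using tmap_universal[OF t t4_bal additive_id(1) riem_additive] balanced_mid[OF t4_bal]
    by (auto simp: riem_lm)
  have 2: "Modules.additive (tmap t4 t4' id split_id)"
     "tmap t4 t4' id split_id (t4 x z) = t4' x (split_id z)" for x z
    using tmap_universal[OF t4 t4'_bal additive_id(1) split_id_additive] balanced_mid[OF t4'_bal]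
    by (auto simp: split_id_lm)
  show "ric (t x y) = contr2 x (split_id (riem y))"
    by (simp add: ric_def 1 2 contract_pure)
  show "Modules.additive ric"
    unfolding ric_def by (auto simp: comp_def intro!: additive_comp[OF contract_additive] additive_comp[OF 2(1) 1(1)])
qed

lemma ricci_eq: "ricci D A t \<pi> t21 t3 t4 t4' d1 ip nab s = ric (q_metric D A t)"
  by (simp add: ricci_def ric_def split_id_def)

end

section \<open>The Ricci functional on a metric built from a projection\<close>

context ricci_setup
begin

lemma t_sum: "t (\<Sum>i\<in>I. f i) y = (\<Sum>i\<in>I. t (f i) y)" "t x (\<Sum>i\<in>I. g i) = (\<Sum>i\<in>I. t x (g i))"
  by (rule additive.sum[OF balanced_additive(2)[OF t_bal]]
      additive.sum[OF balanced_additive(1)[OF t_bal]])+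

lemma lm_sum: "lm (\<Sum>i\<in>I. f i) x = (\<Sum>i\<in>I. lm (f i) x)" "lm b (\<Sum>i\<in>I. g i) = (\<Sum>i\<in>I. lm b (g i))"
  by (rule additive.sum[OF lm_additive(2)] additive.sum[OF lm_additive(1)])+

lemma lm2_sum: "lm2 (\<Sum>i\<in>I. f i) x = (\<Sum>i\<in>I. lm2 (f i) x)"
  by (rule additive.sum) (simp add: Modules.additive_def lm2_simps)

lemma t_sum_assoc: "(\<Sum>l\<in>L. t (\<Sum>k\<in>K. rm (x k) (p k l)) (y l)) = (\<Sum>k\<in>K. t (x k) (\<Sum>l\<in>L. lm (p k l) (y l)))"
  unfolding t_sum t_add(3) by (rule sum.swap)

lemma t21_sum: "t21 (\<Sum>i\<in>I. f i) y = (\<Sum>i\<in>I. t21 (f i) y)"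
  by (rule additive.sum[OF balanced_additive(2)[OF t21_bal]])

lemma contr1_lm: "contr1 (lm b x) v z = lm2 b (contr1 x v z)"
  by (rule tensor_ext[OF t, of _ "\<lambda>z. lm2 b (contr1 x v z)"])
     (auto intro!: contr1_additive additive_comp[OF lm2_additive contr1_additive]
        simp: contr1_pure lm2_pure lm_simps ip_t)

lemma contr2_lm: "contr2 (lm b x) z = lm2 b (contr2 x z)"
  by (rule tensor_ext[OF t3, of _ "\<lambda>z. lm2 b (contr2 x z)"])
     (auto intro!: contr2_additive additive_comp[OF lm2_additive contr2_additive]
        simp: contr2_pure contr1_lm)

lemma ric_lm: "ric (lm2 b z) = lm2 b (ric z)"
  by (rule tensor_ext[OF t, of "\<lambda>z. ric (lm2 b z)" "\<lambda>z. lm2 b (ric z)"])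
     (auto intro!: additive_comp[OF ric_additive lm2_additive] additive_comp[OF lm2_additive ric_additive]
        simp: ric_pure lm2_pure contr2_lm)

definition ctr :: "'o \<Rightarrow> 'u \<Rightarrow> 't" where
  "ctr x u = contr2 x (split_id u)"

lemma ctr_additive: "Modules.additive (ctr x)" "Modules.additive (\<lambda>x. ctr x u)"
  unfolding ctr_def
  by (auto intro!: additive_comp[OF contr2_additive split_id_additive] additive.intro simp: contr2_simps)

lemma ctr_lm: "ctr (lm b x) u = lm2 b (ctr x u)" and ctr_rm: "ctr (rm x b) u = ctr x (L21 b u)"
  by (simp_all add: ctr_def contr2_lm contr2_simps split_id_lm)

lemma ctr_t21: "ctr x (t21 (\<pi> z) v) = contr1 x v (s (\<pi> z))"
  by (simp add: ctr_def split_id_pure contr2_pure)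

lemma ctr_scal: "ctr x (L21 (scal A c) u) = sc2 A t c (ctr x u)"
  by (simp add: ctr_rm[symmetric] rm_scal sc1_def ctr_lm sc2_def)

lemma curv_scal: "curv (sc2 A t c z) = L21 (scal A c) (curv z)"
proof -
  have "wi 0 z = 0" using wi_simps(1)[of 0 0 z] by simp
  thus ?thesis by (simp add: sc2_def curv_lm dif_derivation)
qed

text \<open>
  Think of \<open>P\<close> as a projection with \<open>dP = X + Y\<close> split into the parts of type \<open>(1 - P) dP P\<close> and
  \<open>P dP (1 - P)\<close>. Then \<open>X X = Y Y = 0\<close> as matrices, and the curvature of \<open>Y\<close> becomes
  \<open>- Y \<and> X \<otimes> Y - \<gamma> Y \<and> G - \<gamma> P curv(G)\<close>. Contracting with \<open>X\<close> under the trace, the last term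
  disappears because \<open>X P = X\<close> is traceless, and the first two are evaluated with
  \<open>(X, Y) = \<gamma>' (1 - P)\<close>.
\<close>

lemma ricci_of_projection:
  fixes P :: "'n \<times> 'n \<Rightarrow> 'b" and X Y :: "'n \<times> 'n \<Rightarrow> 'o" and v :: "'n \<Rightarrow> complex"
  assumes G: "G = sc2 A t lam (\<Sum>i\<in>UNIV. sc2 A t (v i) (\<Sum>j\<in>UNIV. t (X (i, j)) (Y (j, i))))"
    and dP: "\<And>k. dif A (P k) = X k + Y k"
    and PY: "\<And>i k. (\<Sum>j\<in>UNIV. lm (P (i, j)) (Y (j, k))) = Y (i, k)"
    and PX: "\<And>i k. (\<Sum>j\<in>UNIV. lm (P (i, j)) (X (j, k))) = 0"
    and XP: "\<And>i k. (\<Sum>j\<in>UNIV. rm (X (i, j)) (P (j, k))) = X (i, k)"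
    and YP: "\<And>i k. (\<Sum>j\<in>UNIV. rm (Y (i, j)) (P (j, k))) = 0"
    and trX: "(\<Sum>i\<in>UNIV. sc1 A (v i) (X (i, i))) = 0"
    and trP: "(\<Sum>i\<in>UNIV. scal A (v i) * P (i, i)) = scal A \<tau>"
    and nabY: "\<And>i k. nab (Y (i, k)) =
       (\<Sum>j\<in>UNIV. t (X (i, j)) (Y (j, k))) - sc2 A t \<gamma> (lm2 (P (i, k)) G)"
    and ipXY: "\<And>i k. (\<Sum>j\<in>UNIV. ip (t (X (i, j)) (Y (j, k)))) =
       scal A \<gamma>' * (of_bool (i = k) - P (i, k))"
    and sYX: "\<And>j k l v. contr1 (X j) v (s (\<pi> (t (Y k) (X l)))) =
       sc2 A t c (contr1 (X j) v (t (Y k) (X l)))"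
  shows "ric G = sc2 A t (- (c * \<gamma>' * (1 + lam * \<gamma> * ((\<Sum>i\<in>UNIV. v i) - \<tau>)))) G"
proof -
  interpret m1: module "sc1 A" by (rule module1)
  interpret m2: module "sc2 A t" by (rule module2)
  interpret m0: module "sc0" by (rule module0)
  \<comment> \<open>moving \<open>P\<close> across the tensor sign: \<open>X X = (X P) X = X (P X) = 0\<close>\<close>
  have XX: "(\<Sum>l\<in>UNIV. t (X (i, l)) (X (l, k))) = 0" for i k
    using t_sum_assoc[where L = UNIV and K = UNIV and x = "\<lambda>m. X (i, m)" and p = "\<lambda>m l. P (m, l)"
      and y = "\<lambda>l. X (l, k)"]
    by (simp add: XP PX t_0)
  have YY: "(\<Sum>l\<in>UNIV. t (Y (i, l)) (Y (l, k))) = 0" for i k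
    using t_sum_assoc[where L = UNIV and K = UNIV and x = "\<lambda>m. Y (i, m)" and p = "\<lambda>m l. P (m, l)"
      and y = "\<lambda>l. Y (l, k)"]
    by (simp add: YP PY t_0)
  \<comment> \<open>\<open>Y = P dP\<close>, so \<open>dY = dP dP\<close>, of which the mixed terms remain\<close>
  have d1Y: "d1 (Y (i, k)) = (\<Sum>l\<in>UNIV. \<pi> (t (X (i, l)) (Y (l, k)))) + (\<Sum>l\<in>UNIV. \<pi> (t (Y (i, l)) (X (l, k))))"
    for i k
  proof -
    have "Y (i, k) = (\<Sum>j\<in>UNIV. lm (P (i, j)) (dif A (P (j, k))))"
      by (simp add: dP lm_simps sum.distrib PX PY)
    hence "d1 (Y (i, k)) = (\<Sum>j\<in>UNIV. \<pi> (t (dif A (P (i, j))) (dif A (P (j, k)))))"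
      by (simp add: additive.sum[OF d1_additive] d1_dif)
    also have "\<dots> = \<pi> ((\<Sum>l\<in>UNIV. t (X (i, l)) (X (l, k))) + (\<Sum>l\<in>UNIV. t (X (i, l)) (Y (l, k)))
        + ((\<Sum>l\<in>UNIV. t (Y (i, l)) (X (l, k))) + (\<Sum>l\<in>UNIV. t (Y (i, l)) (Y (l, k)))))"
      by (simp add: dP t_add sum.distrib additive.sum[OF pi_additive, symmetric] add.assoc add.left_commute)
    finally show ?thesis by (simp add: XX YY pi_add additive.sum[OF pi_additive])
  qed
  have d1X: "d1 (X k) = - d1 (Y k)" for k
    using d1_exact[of "P k"] unfolding dP by (simp add: additive.add[OF d1_additive] eq_neg_iff_add_eq_0)
  have XXY: "(\<Sum>j\<in>UNIV. \<Sum>l\<in>UNIV. t21 (\<pi> (t (X (i, j)) (X (j, l)))) (Y (l, k))) = 0" for i k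
  proof -
    have "(\<Sum>j\<in>UNIV. \<Sum>l\<in>UNIV. t21 (\<pi> (t (X (i, j)) (X (j, l)))) (Y (l, k))) =
        (\<Sum>l\<in>UNIV. t21 (\<pi> (\<Sum>j\<in>UNIV. t (X (i, j)) (X (j, l)))) (Y (l, k)))"
      by (subst sum.swap) (simp add: additive.sum[OF pi_additive] t21_sum)
    thus ?thesis by (simp add: XX pi_add t21_simps)
  qed
  have XYY: "(\<Sum>j\<in>UNIV. \<Sum>l\<in>UNIV. t21 (\<pi> (t (X (i, l)) (Y (l, j)))) (Y (j, k))) = 0" for i k
  proof -
    have "(\<Sum>j\<in>UNIV. \<Sum>l\<in>UNIV. t21 (\<pi> (t (X (i, l)) (Y (l, j)))) (Y (j, k))) =
        (\<Sum>l\<in>UNIV. wi (X (i, l)) (\<Sum>j\<in>UNIV. t (Y (l, j)) (Y (j, k))))"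
      by (subst sum.swap) (simp add: additive.sum[OF wi_additive] wi_pure)
    thus ?thesis by (simp add: YY additive.zero[OF wi_additive])
  qed
  \<comment> \<open>the part of the curvature of \<open>Y\<close> which does not contain \<open>G\<close>\<close>
  define Z where "Z i k = (\<Sum>j\<in>UNIV. \<Sum>l\<in>UNIV. t21 (\<pi> (t (Y (i, l)) (X (l, j)))) (Y (j, k)))" for i k
  have wi_G: "(\<Sum>j\<in>UNIV. wi (X (i, j)) (sc2 A t \<gamma> (lm2 (P (j, k)) G))) = L21 (scal A \<gamma>) (wi (X (i, k)) G)" for i k
  proof -
    have "wi (X (i, j)) (sc2 A t \<gamma> (lm2 (P (j, k)) G)) = L21 (scal A \<gamma>) (wi (rm (X (i, j)) (P (j, k))) G)" for j
      by (simp add: sc2_def wi_simps(3)[symmetric] rm_scal rm_sc1 sc1_def wi_simps(2) lm_rm)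
    hence "(\<Sum>j\<in>UNIV. wi (X (i, j)) (sc2 A t \<gamma> (lm2 (P (j, k)) G))) =
      L21 (scal A \<gamma>) (\<Sum>j\<in>UNIV. wi (rm (X (i, j)) (P (j, k))) G)"
      by (simp add: additive.sum[OF L21_additive])
    also have "(\<Sum>j\<in>UNIV. wi (rm (X (i, j)) (P (j, k))) G) = wi (\<Sum>j\<in>UNIV. rm (X (i, j)) (P (j, k))) G"
      by (rule additive.sum[symmetric]) (simp add: Modules.additive_def wi_simps)
    finally show ?thesis by (simp add: XP)
  qed
  have curvXY: "curv (\<Sum>j\<in>UNIV. t (X (i, j)) (Y (j, k))) = L21 (scal A \<gamma>) (wi (X (i, k)) G) - Z i k" for i k
  proof -
    have "curv (\<Sum>j\<in>UNIV. t (X (i, j)) (Y (j, k))) =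
       (\<Sum>j\<in>UNIV. t21 (d1 (X (i, j))) (Y (j, k))) - (\<Sum>j\<in>UNIV. wi (X (i, j)) (nab (Y (j, k))))"
      by (simp add: additive.sum[OF curv_additive] curv_pure sum_subtractf)
    also have "(\<Sum>j\<in>UNIV. t21 (d1 (X (i, j))) (Y (j, k))) = - Z i k"
      using XYY[of i k] by (simp add: d1X d1Y additive.minus[OF balanced_additive(2)[OF t21_bal]]
         t21_simps t21_sum sum.distrib sum_negf sum_subtractf Z_def)
    also have "(\<Sum>j\<in>UNIV. wi (X (i, j)) (nab (Y (j, k)))) = - L21 (scal A \<gamma>) (wi (X (i, k)) G)"
      using XXY[of i k]
      by (simp add: nabY additive.diff[OF wi_additive] additive.sum[OF wi_additive] wi_pure
           sum_subtractf wi_G)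
    finally show ?thesis by simp
  qed
  \<comment> \<open>the terms \<open>X \<and> G\<close> from \<open>curvXY\<close> and from \<open>dP = X + Y\<close> cancel\<close>
  have riemY: "riem (Y (i, k)) =
      - Z i k - L21 (scal A \<gamma>) (wi (Y (i, k)) G) - L21 (scal A \<gamma>) (L21 (P (i, k)) (curv G))" for i k
  proof -
    have "riem (Y (i, k)) = L21 (scal A \<gamma>) (wi (X (i, k)) G) - Z i k
      - L21 (scal A \<gamma>) (wi (X (i, k)) G + wi (Y (i, k)) G + L21 (P (i, k)) (curv G))"
      by (simp add: riem_curv nabY additive.diff[OF curv_additive] curvXY curv_scal curv_lm dP wi_simps)
    thus ?thesis by (simp add: additive.add[OF L21_additive])
  qed
  define G0 where "G0 = (\<Sum>i\<in>UNIV. sc2 A t (v i) (\<Sum>j\<in>UNIV. t (X (i, j)) (Y (j, i))))"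
  \<comment> \<open>\<open>(X, Y) X = \<gamma>' (1 - P) X = \<gamma>' X\<close>\<close>
  have term1: "(\<Sum>i\<in>UNIV. sc2 A t (v i) (\<Sum>j\<in>UNIV. ctr (X (i, j)) (Z j i))) = sc2 A t (c * \<gamma>') G0"
  proof -
    have "(\<Sum>j\<in>UNIV. ctr (X (i, j)) (Z j i)) = sc2 A t (c * \<gamma>') (\<Sum>k\<in>UNIV. t (X (i, k)) (Y (k, i)))" for i
    proof -
      have "(\<Sum>j\<in>UNIV. ctr (X (i, j)) (Z j i)) =
         (\<Sum>j\<in>UNIV. \<Sum>k\<in>UNIV. \<Sum>l\<in>UNIV. sc2 A t c (t (lm (ip (t (X (i, j)) (Y (j, l)))) (X (l, k))) (Y (k, i))))"
        by (simp add: Z_def additive.sum[OF ctr_additive(1)] ctr_t21 sYX contr1_pure)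
      also have "\<dots> = (\<Sum>k\<in>UNIV. \<Sum>l\<in>UNIV. \<Sum>j\<in>UNIV. sc2 A t c (t (lm (ip (t (X (i, j)) (Y (j, l)))) (X (l, k))) (Y (k, i))))"
        by (subst sum.swap, rule sum.cong[OF refl], rule sum.swap)
      also have "\<dots> = (\<Sum>k\<in>UNIV. sc2 A t c (t (\<Sum>l\<in>UNIV. lm (\<Sum>j\<in>UNIV. ip (t (X (i, j)) (Y (j, l)))) (X (l, k))) (Y (k, i))))"
        by (simp add: t_sum lm_sum m2.scale_sum_right)
      also have "\<dots> = (\<Sum>k\<in>UNIV. sc2 A t c (t (sc1 A \<gamma>' (X (i, k))) (Y (k, i))))"
      proof -
        have "(\<Sum>l\<in>UNIV. lm (\<Sum>j\<in>UNIV. ip (t (X (i, j)) (Y (j, l)))) (X (l, k))) = sc1 A \<gamma>' (X (i, k))" for k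
        proof -
          have "(\<Sum>l\<in>UNIV. lm (of_bool (i = l)) (X (l, k))) = X (i, k)"
            by (subst sum.remove[of _ i]) (auto simp: lm_simps additive.zero[OF lm_additive(2)])
          thus ?thesis
            by (simp add: ipXY lm_sc0 m1.scale_sum_right[symmetric]
                additive.diff[OF lm_additive(2)] sum_subtractf PX)
        qed
        thus ?thesis by simp
      qed
      finally show ?thesis by (simp add: t_sc m2.scale_sum_right)
    qed
    thus ?thesis unfolding G0_def by (simp add: m2.scale_sum_right mult.commute mult.left_commute)
  qed
  have ctr_wi: "ctr (X (i, j)) (wi (Y (j, i)) G) = sc2 A t c (lm2 (ip (t (X (i, j)) (Y (j, i)))) G)" for i j
  proof -
    have sc: "ctr x (wi y (sc2 A t d z)) = sc2 A t d (ctr x (wi y z))" for x y d z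
      by (simp add: sc2_def wi_simps(3)[symmetric] rm_scal sc1_def wi_simps(2))
         (simp add: ctr_scal sc2_def)
    have sm: "ctr x (wi y (\<Sum>i\<in>I. f i)) = (\<Sum>i\<in>I. ctr x (wi y (f i)))" for x y I and f :: "'n \<Rightarrow> 't"
      by (simp add: additive.sum[OF ctr_additive(1)] additive.sum[OF wi_additive])
    have lmsc: "sc2 A t d (lm2 b z) = lm2 b (sc2 A t d z)" for b d z
      by (simp add: sc2_def lm2_simps(3)[symmetric] scal_central)
    show ?thesis
      by (simp add: G sc sm wi_pure ctr_t21 sYX contr1_pure lm2_pure[symmetric] lmsc
         additive.sum[OF lm2_additive] m2.scale_sum_right mult.commute mult.left_commute)
  qed
  have term2: "(\<Sum>i\<in>UNIV. sc2 A t (v i) (\<Sum>j\<in>UNIV. ctr (X (i, j)) (wi (Y (j, i)) G))) =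
     sc2 A t (c * \<gamma>' * ((\<Sum>i\<in>UNIV. v i) - \<tau>)) G"
  proof -
    have "(\<Sum>i\<in>UNIV. sc2 A t (v i) (\<Sum>j\<in>UNIV. ctr (X (i, j)) (wi (Y (j, i)) G))) =
       sc2 A t c (lm2 (\<Sum>i\<in>UNIV. scal A (v i) * (\<Sum>j\<in>UNIV. ip (t (X (i, j)) (Y (j, i))))) G)"
      by (simp add: ctr_wi m2.scale_sum_right[symmetric] lm2_sum[symmetric])
         (simp add: lm2_sum m2.scale_sum_right lm2_simps sc2_def[symmetric] mult.commute)
    also have "(\<Sum>i\<in>UNIV. scal A (v i) * (\<Sum>j\<in>UNIV. ip (t (X (i, j)) (Y (j, i))))) =
        scal A \<gamma>' * ((\<Sum>i\<in>UNIV. scal A (v i)) - (\<Sum>i\<in>UNIV. scal A (v i) * P (i, i)))"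
      by (simp add: ipXY scal_central[of "scal A _" \<gamma>'] right_diff_distrib sum_subtractf sum_distrib_left mult.assoc[symmetric]
           scal_hom(4)[symmetric] mult.commute[of \<gamma>'] del: scal_hom(4))
    also have "(\<Sum>i\<in>UNIV. scal A (v i)) = scal A (\<Sum>i\<in>UNIV. v i)"
      by (rule additive.sum[symmetric]) (simp add: Modules.additive_def)
    finally show ?thesis
      by (simp add: trP scal_hom(4)[symmetric] scal_hom(6)[symmetric] sc2_def[symmetric] mult.assoc
          del: scal_hom(4,6))
  qed
  \<comment> \<open>moving \<open>P\<close> to the left factor leaves the trace of \<open>X P = X\<close>\<close>
  have term3: "(\<Sum>i\<in>UNIV. sc2 A t (v i) (\<Sum>j\<in>UNIV. ctr (X (i, j)) (L21 (P (j, i)) (curv G)))) = 0"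
  proof -
    have "sc2 A t (v i) (\<Sum>j\<in>UNIV. ctr (X (i, j)) (L21 (P (j, i)) (curv G))) = ctr (sc1 A (v i) (X (i, i))) (curv G)" for i
      by (simp add: ctr_rm[symmetric] additive.sum[OF ctr_additive(2), symmetric] XP)
         (simp add: sc1_def sc2_def ctr_lm)
    thus ?thesis
      by (simp add: additive.sum[OF ctr_additive(2), symmetric] trX additive.zero[OF ctr_additive(2)])
  qed
  have "ric G0 = (\<Sum>i\<in>UNIV. sc2 A t (v i) (\<Sum>j\<in>UNIV. ctr (X (i, j)) (riem (Y (j, i)))))"
    unfolding G0_def
    by (simp add: additive.sum[OF ric_additive] sc2_def ric_lm ric_pure ctr_def)
  also have "\<dots> = - (\<Sum>i\<in>UNIV. sc2 A t (v i) (\<Sum>j\<in>UNIV. ctr (X (i, j)) (Z j i)))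
      - sc2 A t \<gamma> (\<Sum>i\<in>UNIV. sc2 A t (v i) (\<Sum>j\<in>UNIV. ctr (X (i, j)) (wi (Y (j, i)) G)))
      - sc2 A t \<gamma> (\<Sum>i\<in>UNIV. sc2 A t (v i) (\<Sum>j\<in>UNIV. ctr (X (i, j)) (L21 (P (j, i)) (curv G))))"
    by (simp add: riemY additive.diff[OF ctr_additive(1)] additive.minus[OF ctr_additive(1)] ctr_scal
        sum_subtractf sum_negf m2.scale_right_diff_distrib m2.scale_sum_right mult.commute)
  also have "\<dots> = - sc2 A t (c * \<gamma>') G0 - sc2 A t (\<gamma> * (c * \<gamma>' * ((\<Sum>i\<in>UNIV. v i) - \<tau>))) G"
    by (simp add: term1 term2 term3)
  finally have "ric G0 = - sc2 A t (c * \<gamma>') G0 - sc2 A t (\<gamma> * (c * \<gamma>' * ((\<Sum>i\<in>UNIV. v i) - \<tau>))) G" .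
  moreover have GG0: "G = sc2 A t lam G0" unfolding G G0_def ..
  moreover have "ric G = sc2 A t lam (ric G0)" by (simp add: GG0 sc2_def ric_lm)
  ultimately have "ric G = sc2 A t lam (- sc2 A t (c * \<gamma>') G0) -
      sc2 A t (lam * (\<gamma> * (c * \<gamma>' * ((\<Sum>i\<in>UNIV. v i) - \<tau>)))) G"
    by (simp add: m2.scale_right_diff_distrib mult.assoc)
  also have "sc2 A t lam (- sc2 A t (c * \<gamma>') G0) = - sc2 A t (c * \<gamma>') G"
    by (simp add: GG0 mult.commute)
  finally have "ric G = - sc2 A t (c * \<gamma>') G - sc2 A t (lam * (\<gamma> * (c * \<gamma>' * ((\<Sum>i\<in>UNIV. v i) - \<tau>)))) G" .
  moreover have "- (c * \<gamma>' * (1 + lam * \<gamma> * ((\<Sum>i\<in>UNIV. v i) - \<tau>))) =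
      - (c * \<gamma>') - lam * (\<gamma> * (c * \<gamma>' * ((\<Sum>i\<in>UNIV. v i) - \<tau>)))"
    by (simp add: algebra_simps)
  ultimately show ?thesis by (simp only: m2.scale_left_diff_distrib m2.scale_minus_left)
qed

end

section \<open>Matrices acting on functionals\<close>

text \<open>
  Identities between leg operators are checked on functionals of the output legs: \<open>ct M\<close> is the
  transpose of \<open>M\<close>, so that products are applied from left to right and contractions of
  output legs (evaluations, traces) are just particular arguments.
\<close>

definition ct :: "complex^'k^'l \<Rightarrow> ('l::finite \<Rightarrow> complex) \<Rightarrow> 'k::finite \<Rightarrow> complex" where
  "ct M F k = (\<Sum>l\<in>UNIV. M $ l $ k * F l)"

lemma ct_mult: "ct (A ** B) F = ct B (ct A F)"
proof
  fix k
  have "ct (A ** B) F k = (\<Sum>l\<in>UNIV. \<Sum>j\<in>UNIV. A $ l $ j * B $ j $ k * F l)"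
    by (simp add: ct_def matrix_matrix_mult_def sum_distrib_right)
  also have "\<dots> = (\<Sum>j\<in>UNIV. \<Sum>l\<in>UNIV. A $ l $ j * B $ j $ k * F l)" by (rule sum.swap)
  also have "\<dots> = ct B (ct A F) k"
    by (simp add: ct_def sum_distrib_left mult_ac)
  finally show "ct (A ** B) F k = ct B (ct A F) k" .
qed

lemma ct_ext:
  assumes "\<And>F k. ct A F k = ct B F k"
  shows "A = B"
proof -
  have "M $ l $ k = ct M (\<lambda>x. of_bool (x = l)) k" for M :: "complex^'b^'a" and l k
    by (simp add: ct_def of_bool_def if_distrib[of "(*) _"] cong: if_cong)
  thus ?thesis using assms by (simp add: vec_eq_iff)
qed

lemma ct_one [simp]: "ct (mat 1) F = F"
  by (auto simp: fun_eq_iff ct_def mat_def if_distrib[of "\<lambda>x. x * _"] cong: if_cong)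

lemma ct_linear: "ct M (\<lambda>k. F k + G k) k = ct M F k + ct M G k"
  "ct M (\<lambda>k. F k - G k) k = ct M F k - ct M G k" "ct M (\<lambda>k. c * F k) k = c * ct M F k"
  by (simp_all add: ct_def algebra_simps sum.distrib sum_subtractf sum_distrib_left)

lemma ct_linear_fun: "ct M (\<lambda>k. F k + G k) = (\<lambda>k. ct M F k + ct M G k)"
  "ct M (\<lambda>k. F k - G k) = (\<lambda>k. ct M F k - ct M G k)" "ct M (\<lambda>k. c * F k) = (\<lambda>k. c * ct M F k)"
  by (simp_all add: fun_eq_iff ct_linear)

lemma ct_matrix_linear: "ct (A + B) F k = ct A F k + ct B F k" "ct (A - B) F k = ct A F k - ct B F k"
   "ct (mat c ** B) F k = c * ct B F k"
proof -
  have "ct (mat c) F = (\<lambda>k. c * F k)" for F :: "'b \<Rightarrow> complex"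
    by (auto simp: fun_eq_iff ct_def mat_def if_distrib[of "\<lambda>x. x * _"] cong: if_cong)
  thus "ct (mat c ** B) F k = c * ct B F k" by (simp add: ct_mult ct_linear)
qed (simp_all add: ct_def algebra_simps sum.distrib sum_subtractf)

lemma ct_sum: "(\<Sum>i\<in>I. ct M (F i) k) = ct M (\<lambda>l. \<Sum>i\<in>I. F i l) k"
  unfolding ct_def sum_distrib_left by (rule sum.swap)

lemma sum_pair_UNIV: "(\<Sum>x\<in>UNIV. f x) = (\<Sum>a\<in>UNIV. \<Sum>b\<in>UNIV. f (a :: 'a::finite, b :: 'b::finite))"
  by (simp add: sum.cartesian_product case_prod_unfold UNIV_Times_UNIV[symmetric] del: UNIV_Times_UNIV)

lemma if_conj_sum: "(\<Sum>x\<in>UNIV. if P then f x else 0) = (if P then \<Sum>x\<in>UNIV. f x else (0::'a::comm_monoid_add))"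
  by simp

lemma ct_legs12: "ct (legs12 M) F (a, b, c) = ct M (\<lambda>(x, y). F (x, y, c)) (a, b)"
  by (simp add: ct_def legs12_def sum_pair_UNIV of_bool_def if_distrib[of "(*) _"] if_distrib[of "\<lambda>x. x * _"] cong: if_cong)

lemma ct_kron1: "ct (kron (mat 1) M) F (a, b) = ct M (\<lambda>y. F (a, y)) b"
proof -
  have "(if x = a then 1 else 0) * M $ y $ b * F (x, y) = (if x = a then M $ y $ b * F (a, y) else 0)" for x y
    by simp
  thus ?thesis by (simp add: ct_def kron_def mat_def sum_pair_UNIV if_conj_sum)
qed

lemma ct_legs23: "ct (legs23 M) F (a, b, c) = ct M (\<lambda>(y, z). F (a, y, z)) (b, c)"
  unfolding legs23_def ct_kron1 by (simp add: case_prod_unfold)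

lemma matrix_inv_eqI:
  fixes A B :: "complex^'n^'n"
  assumes "A ** B = mat 1"
  shows "matrix_inv A = B" "B ** A = mat 1"
proof -
  show BA: "B ** A = mat 1" using assms matrix_left_right_inverse by blast
  have "A ** matrix_inv A = mat 1 \<and> matrix_inv A ** A = mat 1"
    unfolding matrix_inv_def by (rule someI[of _ B]) (use assms BA in simp)
  thus "matrix_inv A = B" using BA by (metis matrix_mul_assoc matrix_mul_lid matrix_mul_rid)
qed

section \<open>The explicit braidings of the vector representation\<close>

text \<open>
  The generator of the Hecke algebra in its representation on a tensor square, scaled by \<open>\<theta>\<close>; the
  order \<open>lt\<close> decides on which half the diagonal entry sits.
\<close>

definition hecke_mat :: "('n::finite \<Rightarrow> 'n \<Rightarrow> bool) \<Rightarrow> complex \<Rightarrow> complex \<Rightarrow> complex^('n \<times> 'n)^('n \<times> 'n)" where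
  "hecke_mat lt \<kappa> \<theta> = (\<chi> x y. case y of (i, j) \<Rightarrow> \<theta> *
     (if i = j then \<kappa> * of_bool (x = (i, i))
      else of_bool (x = (j, i)) + (if lt i j then (\<kappa> - 1 / \<kappa>) * of_bool (x = (i, j)) else 0)))"

lemma ct_hecke: "ct (hecke_mat lt \<kappa> \<theta>) F (i, j) = \<theta> *
     (if i = j then \<kappa> * F (i, i) else F (j, i) + (if lt i j then (\<kappa> - 1 / \<kappa>) * F (i, j) else 0))"
proof -
  have d: "(\<Sum>x\<in>UNIV. of_bool (x = y) * G x) = G y" for y and G :: "'a \<times> 'a \<Rightarrow> complex"
    by (simp add: of_bool_def if_distrib[of "\<lambda>x. x * _"] cong: if_cong)
  show ?thesis
    by (simp add: ct_def hecke_mat_def mult.assoc sum_distrib_left[symmetric] distrib_right sum.distrib d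
        if_distrib[of "\<lambda>x. x * _"] if_conj_sum cong: if_cong)
qed

text \<open>
  \<open>\<phi>\<close> numbers the basis by \<open>1, ..., N\<close>, \<open>\<kappa>\<close> is the parameter \<open>q\<close>, and \<open>\<theta>\<close> is the scalar by which
  the braiding of the vector representation differs from the Hecke normalization.
\<close>

locale numbered_basis =
  fixes \<phi> :: "'n::finite \<Rightarrow> nat" and N :: nat and \<kappa> \<theta> :: complex
  assumes phi: "bij_betw \<phi> UNIV {1..N}" and kappa: "\<kappa> \<noteq> 0" and theta: "\<theta> \<noteq> 0"
begin

definition "h = \<kappa> - 1 / \<kappa>"

text \<open>
  The weights of the quantum trace: \<open>qq i\<close> is \<open>q\<close> to the power \<open>(\<lambda>\<^sub>i, 2\<rho>)\<close>, by \<open>qq_wrho\<close> below.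
\<close>

definition qf :: "nat \<Rightarrow> complex" where "qf n = \<kappa> ^ (N + 1) / \<kappa> ^ (2 * n)"

definition qq :: "'n \<Rightarrow> complex" where "qq i = qf (\<phi> i)"

lemma qq_nz [simp]: "qq i \<noteq> 0"
  by (simp add: qq_def qf_def kappa)

lemma phi_inj: "\<phi> i = \<phi> j \<longleftrightarrow> i = j"
  using phi by (auto simp: bij_betw_def inj_def)

lemma phi_range: "\<phi> i \<in> {1..N}"
  using phi by (auto simp: bij_betw_def)

lemma sum_phi: "(\<Sum>i\<in>{i. P (\<phi> i)}. f (\<phi> i)) = (\<Sum>n\<in>{n\<in>{1..N}. P n}. f n)"
proof (rule sum.reindex_bij_betw)
  have "\<phi> ` {i. P (\<phi> i)} = {n \<in> \<phi> ` UNIV. P n}" by auto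
  also have "\<phi> ` UNIV = {1..N}" using phi by (simp add: bij_betw_def)
  finally show "bij_betw \<phi> {i. P (\<phi> i)} {n \<in> {1..N}. P n}"
    using bij_betw_subset[OF phi] by blast
qed

lemma qf_Suc: "qf (Suc n) = qf n / \<kappa>\<^sup>2"
  by (simp add: qf_def power2_eq_square)

text \<open>
  The weights are a geometric progression with ratio \<open>\<kappa>\<close> to the power \<open>-2\<close>, so that \<open>h\<close> times a sum of
  consecutive weights is a difference of boundary terms. The weighted contractions
  below come down to this.
\<close>

lemma qf_telescope: "h * (\<Sum>n\<in>{m<..<Suc (m + d)}. qf n) = qf m / \<kappa> - \<kappa> * qf (Suc (m + d))"
proof (induction d)
  case 0
  have "{m<..<Suc m} = {}" by auto
  thus ?case using kappa by (simp add: qf_Suc power2_eq_square)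
next
  case (Suc d)
  have "{m<..<Suc (m + Suc d)} = insert (Suc (m + d)) {m<..<Suc (m + d)}" by auto
  hence "h * (\<Sum>n\<in>{m<..<Suc (m + Suc d)}. qf n) = h * qf (Suc (m + d)) + h * (\<Sum>n\<in>{m<..<Suc (m + d)}. qf n)"
    by (simp add: algebra_simps)
  also have "\<dots> = h * qf (Suc (m + d)) + (qf m / \<kappa> - \<kappa> * qf (Suc (m + d)))" by (simp only: Suc.IH)
  also have "\<dots> = qf m / \<kappa> - \<kappa> * qf (Suc (m + Suc d))"
    using kappa by (simp add: h_def qf_Suc field_simps power2_eq_square)
  finally show ?case .
qed

lemma qf_between: "m < n \<Longrightarrow> h * (\<Sum>k\<in>{m<..<n}. qf k) = qf m / \<kappa> - \<kappa> * qf n"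
  using qf_telescope[of m "n - Suc m"] by simp

lemma qinv_telescope: "h * (\<Sum>n\<in>{m<..m + d}. 1 / qf n) = \<kappa> / qf (m + d) - \<kappa> / qf m"
proof (induction d)
  case (Suc d)
  have "{m<..m + Suc d} = insert (m + Suc d) {m<..m + d}" by auto
  hence "h * (\<Sum>n\<in>{m<..m + Suc d}. 1 / qf n) = h / qf (m + Suc d) + h * (\<Sum>n\<in>{m<..m + d}. 1 / qf n)"
    by (simp add: algebra_simps)
  also have "\<dots> = h / qf (m + Suc d) + (\<kappa> / qf (m + d) - \<kappa> / qf m)" by (simp only: Suc.IH)
  also have "h / qf (m + Suc d) = (h * \<kappa>\<^sup>2) / qf (m + d)" by (simp add: qf_Suc)
  also have "h * \<kappa>\<^sup>2 = \<kappa> * \<kappa>\<^sup>2 - \<kappa>" using kappa by (simp add: h_def field_simps power2_eq_square)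
  also have "(\<kappa> * \<kappa>\<^sup>2 - \<kappa>) / qf (m + d) + (\<kappa> / qf (m + d) - \<kappa> / qf m) = \<kappa> / qf (m + Suc d) - \<kappa> / qf m"
    by (simp add: qf_Suc diff_divide_distrib)
  finally show ?case .
qed simp

lemma sum_qq_between:
  assumes "\<phi> a < \<phi> e"
  shows "h * (\<Sum>k\<in>{k. \<phi> a < \<phi> k \<and> \<phi> k < \<phi> e}. qq k) = qq a / \<kappa> - \<kappa> * qq e"
proof -
  have "{n \<in> {1..N}. \<phi> a < n \<and> n < \<phi> e} = {\<phi> a<..<\<phi> e}"
    using phi_range[of a] phi_range[of e] by auto
  thus ?thesis
    using sum_phi[where P = "\<lambda>n. \<phi> a < n \<and> n < \<phi> e" and f = qf] qf_between[OF assms] by (simp add: qq_def)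
qed

lemma sum_qq_below: "h * (\<Sum>k\<in>{k. \<phi> k < \<phi> e}. qq k) = \<kappa> ^ N - \<kappa> * qq e"
proof -
  have "{n \<in> {1..N}. n < \<phi> e} = {0<..<\<phi> e}"
    using phi_range[of e] by auto
  moreover have "0 < \<phi> e" using phi_range[of e] by simp
  ultimately show ?thesis
    using sum_phi[where P = "\<lambda>n. n < \<phi> e" and f = qf] qf_between[of 0 "\<phi> e"] kappa by (simp add: qq_def) (simp add: qf_def)
qed

lemma sum_inv_qq_above: "h * (\<Sum>k\<in>{k. \<phi> e < \<phi> k}. 1 / qq k) = \<kappa> ^ N - \<kappa> / qq e"
proof -
  have "{n \<in> {1..N}. \<phi> e < n} = {\<phi> e<..\<phi> e + (N - \<phi> e)}"
    using phi_range[of e] by auto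
  moreover have "\<kappa> / qf N = \<kappa> ^ N" using kappa by (simp add: qf_def mult_2 power_add)
  moreover have "\<phi> e + (N - \<phi> e) = N" using phi_range[of e] by auto
  ultimately show ?thesis
    using sum_phi[where P = "\<lambda>n. \<phi> e < n" and f = "\<lambda>n. 1 / qf n"] qinv_telescope[of "\<phi> e" "N - \<phi> e"]
    by (simp add: qq_def)
qed

text \<open>
  For a chain module \<open>V\<close> these will be the braidings of \<open>V*\<close> with \<open>V*\<close> (\<open>Um\<close>), of \<open>V\<close> with \<open>V\<close> (\<open>Qm\<close>),
  of \<open>V\<close> with \<open>V*\<close> (\<open>Rm\<close>), and the inverse of the last one (\<open>Rim\<close>). That \<open>Rim\<close> is a partial transpose of
  \<open>Um\<close> is the compatibility of the braiding with duality.
\<close>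

definition "Um = hecke_mat (\<lambda>i j. \<phi> i < \<phi> j) \<kappa> \<theta>"
definition "Qm = hecke_mat (\<lambda>i j. \<phi> j < \<phi> i) \<kappa> \<theta>"

definition Rm :: "complex^('n \<times> 'n)^('n \<times> 'n)" where
  "Rm = (\<chi> x y. case y of (k, l) \<Rightarrow> (if k = l then of_bool (x = (k, k)) / \<kappa>
      - h * (\<Sum>a\<in>{a. \<phi> a < \<phi> k}. qq k / qq a * of_bool (x = (a, a)))
      else of_bool (x = (l, k))) / \<theta>)"

definition Rim :: "complex^('n \<times> 'n)^('n \<times> 'n)" where
  "Rim = (\<chi> x y. case (x, y) of ((k, l), (e, c)) \<Rightarrow> Um $ (l, c) $ (k, e))"

lemma sum_delta_mult: "(\<Sum>x\<in>UNIV. of_bool (x = y) * G x) = G y" for y and G :: "'a::finite \<Rightarrow> complex"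
  by (simp add: of_bool_def if_distrib[of "\<lambda>x. x * _"] cong: if_cong)

lemma ct_Um: "ct Um F (i, j) = \<theta> * (if i = j then \<kappa> * F (i, i) else F (j, i) + (if \<phi> i < \<phi> j then h * F (i, j) else 0))"
  by (simp add: Um_def ct_hecke h_def)

lemma ct_Qm: "ct Qm F (i, j) = \<theta> * (if i = j then \<kappa> * F (i, i) else F (j, i) + (if \<phi> j < \<phi> i then h * F (i, j) else 0))"
  by (simp add: Qm_def ct_hecke h_def)

lemma ct_Rm: "ct Rm F (k, l) = (if k = l then F (k, k) / \<kappa>
      - h * (\<Sum>a\<in>{a. \<phi> a < \<phi> k}. qq k / qq a * F (a, a)) else F (l, k)) / \<theta>"
proof (cases "k = l")
  case True
  have "ct Rm F (k, k) = (\<Sum>x\<in>UNIV. (of_bool (x = (k, k)) * (F x / \<kappa>)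
      - (\<Sum>a\<in>{a. \<phi> a < \<phi> k}. of_bool (x = (a, a)) * (h * (qq k / qq a) * F x))) / \<theta>)"
    unfolding ct_def Rm_def by (rule sum.cong[OF refl]) (simp add: field_simps sum_distrib_left sum_distrib_right sum_divide_distrib)
  also have "\<dots> = ((\<Sum>x\<in>UNIV. of_bool (x = (k, k)) * (F x / \<kappa>))
      - (\<Sum>a\<in>{a. \<phi> a < \<phi> k}. \<Sum>x\<in>UNIV. of_bool (x = (a, a)) * (h * (qq k / qq a) * F x))) / \<theta>"
    by (simp add: sum_subtractf sum_divide_distrib[symmetric] sum.swap[of _ "{a. \<phi> a < \<phi> k}" UNIV])
  also have "\<dots> = (F (k, k) / \<kappa> - h * (\<Sum>a\<in>{a. \<phi> a < \<phi> k}. qq k / qq a * F (a, a))) / \<theta>"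
    unfolding sum_delta_mult by (simp add: sum_distrib_left mult.assoc)
  finally show ?thesis using True by simp
next
  case False
  have "ct Rm F (k, l) = (\<Sum>x\<in>UNIV. of_bool (x = (l, k)) * (F x / \<theta>))"
    unfolding ct_def Rm_def using False by (intro sum.cong[OF refl]) simp
  thus ?thesis using False unfolding sum_delta_mult by simp
qed

lemma ct_Rim: "ct Rim F (e, c) = \<theta> * (if e = c then \<kappa> * F (e, e) + h * (\<Sum>k\<in>{k. \<phi> k < \<phi> e}. F (k, k)) else F (c, e))"
proof -
  have U: "Um $ (l, c) $ (k, e) = \<theta> * (if k = e then \<kappa> * of_bool (l = e \<and> c = e)
     else of_bool (l = e \<and> c = k) + (if \<phi> k < \<phi> e then h * of_bool (l = k \<and> c = e) else 0))" for k l
    by (simp add: Um_def hecke_mat_def h_def)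
  show ?thesis
  proof (cases "e = c")
    case True
    have "ct Rim F (e, c) = (\<Sum>k\<in>UNIV. \<Sum>l\<in>UNIV. of_bool (l = k) * (\<theta> * (of_bool (k = e) * \<kappa> + (if \<phi> k < \<phi> e then h else 0)) * F (k, l)))"
      unfolding ct_def Rim_def sum_pair_UNIV
      by (intro sum.cong refl) (simp add: U, use True in auto)
    also have "\<dots> = (\<Sum>k\<in>UNIV. of_bool (k = e) * (\<theta> * \<kappa> * F (k, k)) + (if \<phi> k < \<phi> e then \<theta> * h * F (k, k) else 0))"
      by (simp add: sum_delta_mult) (intro sum.cong; simp add: algebra_simps)
    also have "\<dots> = \<theta> * (\<kappa> * F (e, e) + h * (\<Sum>k\<in>{k. \<phi> k < \<phi> e}. F (k, k)))"
      unfolding sum.distrib sum_delta_mult by (simp add: sum.If_cases sum_distrib_left algebra_simps)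
    finally show ?thesis using True by simp
  next
    case False
    have "ct Rim F (e, c) = (\<Sum>k\<in>UNIV. of_bool (k = c) * (\<Sum>l\<in>UNIV. of_bool (l = e) * (\<theta> * F (k, l))))"
      unfolding ct_def Rim_def sum_pair_UNIV sum_distrib_left
      by (intro sum.cong refl) (simp add: U, use False in auto)
    thus ?thesis using False unfolding sum_delta_mult by simp
  qed
qed

lemma Rm_Rim: "Rm ** Rim = mat 1"
proof (rule ct_ext)
  fix F and y :: "'n \<times> 'n"
  obtain e c where y: "y = (e, c)" by fastforce
  show "ct (Rm ** Rim) F y = ct (mat 1) F y"
  proof (cases "e = c")
    case False thus ?thesis using theta by (simp add: y ct_mult ct_Rim ct_Rm)
  next
    case True
    let ?B = "{k. \<phi> k < \<phi> e}"
    have "(\<Sum>k\<in>?B. \<Sum>a\<in>{a. \<phi> a < \<phi> k}. qq k / qq a * F (a, a)) =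
       (\<Sum>k\<in>?B. \<Sum>a | a \<in> ?B \<and> \<phi> a < \<phi> k. qq k / qq a * F (a, a))"
      by (intro sum.cong refl) auto
    also have "\<dots> = (\<Sum>a\<in>?B. \<Sum>k | k \<in> ?B \<and> \<phi> a < \<phi> k. qq k / qq a * F (a, a))"
      by (rule sum.swap_restrict) auto
    finally have "h * (\<Sum>k\<in>?B. \<Sum>a\<in>{a. \<phi> a < \<phi> k}. qq k / qq a * F (a, a)) =
       h * (\<Sum>a\<in>?B. \<Sum>k | k \<in> ?B \<and> \<phi> a < \<phi> k. qq k / qq a * F (a, a))" by simp
    also have "\<dots> = (\<Sum>a\<in>?B. (1 / \<kappa> - \<kappa> * qq e / qq a) * F (a, a))"
    proof (subst sum_distrib_left, intro sum.cong refl)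
      fix a assume a: "a \<in> ?B"
      have "h * (\<Sum>k | k \<in> ?B \<and> \<phi> a < \<phi> k. qq k / qq a * F (a, a)) =
        (h * (\<Sum>k\<in>{k. \<phi> a < \<phi> k \<and> \<phi> k < \<phi> e}. qq k)) / qq a * F (a, a)"
        by (simp add: sum_divide_distrib[symmetric] sum_distrib_right[symmetric] conj_commute)
      also have "\<dots> = (1 / \<kappa> - \<kappa> * qq e / qq a) * F (a, a)"
        using a by (simp add: sum_qq_between diff_divide_distrib)
      finally show "h * (\<Sum>k | k \<in> ?B \<and> \<phi> a < \<phi> k. qq k / qq a * F (a, a)) = (1 / \<kappa> - \<kappa> * qq e / qq a) * F (a, a)" .
    qed
    finally have *: "h * (\<Sum>k\<in>?B. \<Sum>a\<in>{a. \<phi> a < \<phi> k}. qq k / qq a * F (a, a)) =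
      (\<Sum>a\<in>?B. F (a, a)) / \<kappa> - \<kappa> * (\<Sum>a\<in>?B. qq e / qq a * F (a, a))"
      by (simp add: algebra_simps sum_subtractf sum_divide_distrib sum_distrib_left)
    have "ct (Rm ** Rim) F (e, e) = \<kappa> * (F (e, e) / \<kappa> - h * (\<Sum>a\<in>?B. qq e / qq a * F (a, a)))
       + h * (\<Sum>k\<in>?B. F (k, k) / \<kappa> - h * (\<Sum>a\<in>{a. \<phi> a < \<phi> k}. qq k / qq a * F (a, a)))"
      using theta by (simp add: ct_mult ct_Rim ct_Rm sum_divide_distrib[symmetric] field_simps)
    also have "\<dots> = \<kappa> * (F (e, e) / \<kappa> - h * (\<Sum>a\<in>?B. qq e / qq a * F (a, a))) + h * ((\<Sum>a\<in>?B. F (a, a)) / \<kappa>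
        - h * (\<Sum>k\<in>?B. \<Sum>a\<in>{a. \<phi> a < \<phi> k}. qq k / qq a * F (a, a)))"
      by (simp add: sum_subtractf sum_divide_distrib sum_distrib_left)
    also have "\<dots> = F (e, e)"
      unfolding * using kappa by (simp add: right_diff_distrib)
    finally show ?thesis using True by (simp add: y)
  qed
qed

lemma Rim_Rm: "Rim ** Rm = mat 1" and matrix_inv_Rm: "matrix_inv Rm = Rim"
  using matrix_inv_eqI[OF Rm_Rim] by auto

lemma ct_Rim_Rm [simp]: "ct Rim (ct Rm F) = F" "ct Rm (ct Rim F) = F"
  by (simp_all add: ct_mult[symmetric] Rm_Rim Rim_Rm)


text \<open>Contraction of the first two, or the last two, of three legs with weights \<open>u\<close>, followed by a
  functional \<open>G\<close> of the remaining leg.\<close>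

definition capl :: "('n \<Rightarrow> complex) \<Rightarrow> ('n \<Rightarrow> complex) \<Rightarrow> 'n \<times> 'n \<times> 'n \<Rightarrow> complex" where
  "capl u G = (\<lambda>(x, y, z). of_bool (x = y) * (u x * G z))"

definition capr :: "('n \<Rightarrow> complex) \<Rightarrow> ('n \<Rightarrow> complex) \<Rightarrow> 'n \<times> 'n \<times> 'n \<Rightarrow> complex" where
  "capr u G = (\<lambda>(x, y, z). of_bool (y = z) * (u y * G x))"

abbreviation "one1 \<equiv> \<lambda>_::'n. 1::complex"

text \<open>
  The inverse of \<open>Um\<close>, read off from the quadratic relation \<open>hecke_U\<close>.
\<close>

definition "Umi = mat (1 / \<theta>\<^sup>2) ** Um - mat (h / \<theta>)"

lemma hecke_U: "ct Um (ct Um F) y = \<theta>\<^sup>2 * F y + \<theta> * h * ct Um F y"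
proof -
  obtain i j where y: "y = (i, j)" by fastforce
  show ?thesis using kappa phi_inj[of i j]
    by (cases "i = j"; cases "\<phi> i < \<phi> j")
       (auto simp: y ct_Um h_def power2_eq_square field_simps not_less order.order_iff_strict)
qed

lemma hecke_Q: "ct Qm (ct Qm F) y = \<theta>\<^sup>2 * F y + \<theta> * h * ct Qm F y"
proof -
  obtain i j where y: "y = (i, j)" by fastforce
  show ?thesis using kappa phi_inj[of i j]
    by (cases "i = j"; cases "\<phi> i < \<phi> j")
       (auto simp: y ct_Qm h_def power2_eq_square field_simps not_less order.order_iff_strict)
qed

lemma ct_Umi: "ct Umi F y = ct Um F y / \<theta>\<^sup>2 - h / \<theta> * F y"
  using ct_matrix_linear(3)[of "h / \<theta>" "mat 1" F y]
  by (simp add: Umi_def ct_matrix_linear)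

lemma Um_Umi: "Um ** Umi = mat 1"
proof (rule ct_ext)
  fix F y
  show "ct (Um ** Umi) F y = ct (mat 1) F y"
    using theta by (simp add: ct_mult ct_Umi hecke_U field_simps power2_eq_square)
qed

lemma Umi_Um: "Umi ** Um = mat 1" and matrix_inv_Um: "matrix_inv Um = Umi"
  using matrix_inv_eqI[OF Um_Umi] by auto

lemma ct_legs23_inverse:
  fixes F :: "'n \<times> 'n \<times> 'n \<Rightarrow> complex"
  assumes "A ** B = mat 1"
  shows "ct (legs23 B) (ct (legs23 A) F) = F"
proof
  fix y :: "'n \<times> 'n \<times> 'n"
  obtain a b c where y: "y = (a, b, c)" by (metis prod.exhaust)
  have "ct B (ct A (\<lambda>(y, z). F (a, y, z))) = (\<lambda>(y, z). F (a, y, z))"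
    by (simp add: ct_mult[symmetric] assms)
  thus "ct (legs23 B) (ct (legs23 A) F) y = F y"
    by (simp add: y ct_legs23 case_prod_unfold)
qed

lemma ct_legs12_inverse:
  fixes F :: "'n \<times> 'n \<times> 'n \<Rightarrow> complex"
  assumes "A ** B = mat 1"
  shows "ct (legs12 B) (ct (legs12 A) F) = F"
proof
  fix y :: "'n \<times> 'n \<times> 'n"
  obtain a b c where y: "y = (a, b, c)" by (metis prod.exhaust)
  have "ct B (ct A (\<lambda>(x, y). F (x, y, c))) = (\<lambda>(x, y). F (x, y, c))"
    by (simp add: ct_mult[symmetric] assms)
  thus "ct (legs12 B) (ct (legs12 A) F) y = F y"
    by (simp add: y ct_legs12 case_prod_unfold)
qed

text \<open>
  A contraction changes its weights when its own two legs are crossed (\<open>cap_Rim\<close>, \<open>cap_Rm\<close>), and it can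
  be moved from one side of a third leg to the other (\<open>cap_slide_U\<close>, \<open>cap_slide_Q\<close>).
\<close>

lemma cap_Rim: "ct (legs12 Rim) (capl qq G) = (\<lambda>y. \<theta> * \<kappa> ^ N * capl one1 G y)"
  "ct (legs23 Rim) (capr qq G) = (\<lambda>y. \<theta> * \<kappa> ^ N * capr one1 G y)"
proof -
  have *: "ct Rim (\<lambda>(x, y). of_bool (x = y) * (qq x * g)) (e, c) = \<theta> * \<kappa> ^ N * (of_bool (e = c) * g)" for g e c
  proof (cases "e = c")
    case True
    have "ct Rim (\<lambda>(x, y). of_bool (x = y) * (qq x * g)) (e, c) = \<theta> * (\<kappa> * qq e + h * (\<Sum>k\<in>{k. \<phi> k < \<phi> e}. qq k)) * g"
      using True by (simp add: ct_Rim sum_distrib_right[symmetric] distrib_right mult.assoc)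
    thus ?thesis using True by (simp add: sum_qq_below)
  qed (auto simp: ct_Rim)
  show "ct (legs12 Rim) (capl qq G) = (\<lambda>y. \<theta> * \<kappa> ^ N * capl one1 G y)"
    by (auto simp: fun_eq_iff ct_legs12 capl_def *)
  show "ct (legs23 Rim) (capr qq G) = (\<lambda>y. \<theta> * \<kappa> ^ N * capr one1 G y)"
    by (auto simp: fun_eq_iff ct_legs23 capr_def *)
qed

lemma cap_Rm: "ct (legs12 Rm) (capl one1 G) y = capl qq G y / (\<theta> * \<kappa> ^ N)"
  "ct (legs23 Rm) (capr one1 G) y = capr qq G y / (\<theta> * \<kappa> ^ N)"
proof -
  have "capl qq G = ct (legs12 Rm) (\<lambda>y. \<theta> * \<kappa> ^ N * capl one1 G y)"
    using ct_legs12_inverse[OF Rim_Rm, of "capl qq G"] by (simp add: cap_Rim)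
  thus "ct (legs12 Rm) (capl one1 G) y = capl qq G y / (\<theta> * \<kappa> ^ N)"
    using theta kappa by (simp add: ct_linear)
  have "capr qq G = ct (legs23 Rm) (\<lambda>y. \<theta> * \<kappa> ^ N * capr one1 G y)"
    using ct_legs23_inverse[OF Rim_Rm, of "capr qq G"] by (simp add: cap_Rim)
  thus "ct (legs23 Rm) (capr one1 G) y = capr qq G y / (\<theta> * \<kappa> ^ N)"
    using theta kappa by (simp add: ct_linear)
qed

lemma cap_slide_U: "ct (legs23 Um) (ct (legs12 Rm) (capr qq G)) = capl qq G"
proof
  fix y :: "'n \<times> 'n \<times> 'n"
  obtain a b c where y: "y = (a, b, c)" by (metis prod.exhaust)
  have S: "(\<Sum>x\<in>{x. \<phi> x < \<phi> k}. d * (of_bool (x = z) * f x)) = (if \<phi> z < \<phi> k then d * f z else 0)"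
    for k z and d :: complex and f :: "'n \<Rightarrow> complex"
  proof -
    have "(\<Sum>x\<in>{x. \<phi> x < \<phi> k}. d * (of_bool (x = z) * f x)) =
       (\<Sum>x\<in>{x. \<phi> x < \<phi> k}. if x = z then d * f z else 0)"
      by (intro sum.cong) auto
    thus ?thesis by simp
  qed
  show "ct (legs23 Um) (ct (legs12 Rm) (capr qq G)) y = capl qq G y"
    using theta kappa
    by (auto simp: y ct_legs23 ct_legs12 ct_Um ct_Rm capr_def capl_def S phi_inj)
qed

lemma cap_slide_Q: "ct (legs12 Qm) (ct (legs23 Rm) (capl qq G)) = capr qq G"
proof
  fix y :: "'n \<times> 'n \<times> 'n"
  obtain a b c where y: "y = (a, b, c)" by (metis prod.exhaust)
  have S: "(\<Sum>x\<in>{x. \<phi> x < \<phi> k}. d * (of_bool (z = x) * f x) / qq x) = (if \<phi> z < \<phi> k then d * f z / qq z else 0)"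
    for k z and d :: complex and f :: "'n \<Rightarrow> complex"
  proof -
    have "(\<Sum>x\<in>{x. \<phi> x < \<phi> k}. d * (of_bool (z = x) * f x) / qq x) =
       (\<Sum>x\<in>{x. \<phi> x < \<phi> k}. if x = z then d * f z / qq z else 0)"
      by (intro sum.cong) auto
    thus ?thesis by simp
  qed
  show "ct (legs12 Qm) (ct (legs23 Rm) (capl qq G)) y = capr qq G y"
    using theta kappa
    by (auto simp: y ct_legs23 ct_legs12 ct_Qm ct_Rm capr_def capl_def S phi_inj)
qed

lemma cap_slide_Umi: "ct (legs23 Umi) (capl qq G) = ct (legs12 Rm) (capr qq G)"
  using ct_legs23_inverse[OF Um_Umi, of "ct (legs12 Rm) (capr qq G)"] by (simp add: cap_slide_U)

lemma YB_U: "ct (legs23 Um) (ct (legs12 Um) (ct (legs23 Um) F)) = ct (legs12 Um) (ct (legs23 Um) (ct (legs12 Um) F))"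
proof
  fix y :: "'n \<times> 'n \<times> 'n"
  obtain a b c where y: "y = (a, b, c)" by (metis prod.exhaust)
  have *: "(\<phi> a < \<phi> b \<or> a = b \<or> \<phi> b < \<phi> a) \<and> (\<phi> a < \<phi> c \<or> a = c \<or> \<phi> c < \<phi> a) \<and> (\<phi> c < \<phi> b \<or> c = b \<or> \<phi> b < \<phi> c)"
    using phi_inj by (metis linorder_neqE_nat)
  have k2: "\<kappa> * (\<kappa> * x) = x + \<kappa> * (h * x)" for x using kappa by (simp add: h_def field_simps)
  show "ct (legs23 Um) (ct (legs12 Um) (ct (legs23 Um) F)) y = ct (legs12 Um) (ct (legs23 Um) (ct (legs12 Um) F)) y"
    using * by (elim conjE disjE) (auto simp: y ct_legs23 ct_legs12 ct_Um algebra_simps k2)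
qed

lemma legs12_mult_entry: "(legs12 M ** X) $ (a, b, c) $ y = (\<Sum>u\<in>UNIV. \<Sum>v\<in>UNIV. M $ (a, b) $ (u, v) * X $ (u, v, c) $ y)"
  by (simp add: matrix_matrix_mult_def legs12_def sum_pair_UNIV of_bool_def if_distrib[of "(*) _"]
      if_distrib[of "\<lambda>x. x * _"] cong: if_cong)

lemma legs23_mult_entry: "(legs23 M ** X) $ (a, b, c) $ y = (\<Sum>u\<in>UNIV. \<Sum>v\<in>UNIV. M $ (b, c) $ (u, v) * X $ (a, u, v) $ y)"
proof -
  have "(if a = x then 1 else 0) * m * n = (if x = a then m * n else 0)" for x and m n :: complex by simp
  thus ?thesis by (simp add: matrix_matrix_mult_def legs23_def kron_def mat_def sum_pair_UNIV if_conj_sum)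
qed

lemma YB_U_mat: "legs23 Um ** (legs12 Um ** legs23 Um) = legs12 Um ** (legs23 Um ** legs12 Um)"
  by (rule ct_ext) (simp add: ct_mult YB_U)

text \<open>
  The entries of \<open>Rim\<close> are those of \<open>Um\<close> with one index pair transposed, so the braid relation
  for \<open>Um\<close> is also one which involves \<open>Rim\<close> twice.
\<close>

lemma YB_Rim: "legs12 Rim ** (legs23 Rim ** legs12 Um) = legs23 Um ** (legs12 Rim ** legs23 Rim)"
proof -
  have "(legs12 Rim ** (legs23 Rim ** legs12 Um)) $ x $ y = (legs23 Um ** (legs12 Rim ** legs23 Rim)) $ x $ y" for x y
  proof -
    obtain z w v where x: "x = (z, w, v)" by (metis prod.exhaust)
    obtain a b c where y: "y = (a, b, c)" by (metis prod.exhaust)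
    have "(legs12 Rim ** (legs23 Rim ** legs12 Um)) $ x $ y =
       (\<Sum>a'\<in>UNIV. \<Sum>x\<in>UNIV. \<Sum>u\<in>UNIV. Um $ (w, x) $ (z, a') * (Um $ (v, c) $ (x, u) * Um $ (a', u) $ (a, b)))"
      by (simp add: x y legs12_mult_entry legs23_mult_entry Rim_def sum_distrib_left)
         (simp add: legs12_def of_bool_def if_distrib[of "(*) _"] if_distrib[of "\<lambda>x. x * _"] cong: if_cong)
    also have "\<dots> = (\<Sum>x\<in>UNIV. \<Sum>u\<in>UNIV. \<Sum>a'\<in>UNIV. Um $ (v, c) $ (x, u) * (Um $ (w, x) $ (z, a') * Um $ (a', u) $ (a, b)))"
      by (subst sum.swap, rule sum.cong[OF refl], subst sum.swap) (simp add: mult_ac)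
    also have "\<dots> = (legs23 Um ** (legs12 Um ** legs23 Um)) $ (w, v, c) $ (z, a, b)"
      by (simp add: legs12_mult_entry legs23_mult_entry sum_distrib_left)
         (simp add: legs23_def kron_def mat_def of_bool_def if_distrib[of "(*) _"] if_distrib[of "\<lambda>x. x * _"] if_conj_sum cong: if_cong)
    also have "\<dots> = (legs12 Um ** (legs23 Um ** legs12 Um)) $ (w, v, c) $ (z, a, b)"
      by (simp only: YB_U_mat)
    also have "\<dots> = (\<Sum>w'\<in>UNIV. \<Sum>y'\<in>UNIV. \<Sum>x\<in>UNIV. Um $ (w, v) $ (w', y') * (Um $ (y', c) $ (x, b) * Um $ (w', x) $ (z, a)))"
      by (simp add: legs12_mult_entry legs23_mult_entry sum_distrib_left)
         (simp add: legs12_def of_bool_def if_distrib[of "(*) _"] if_distrib[of "\<lambda>x. x * _"] cong: if_cong)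
    also have "\<dots> = (legs23 Um ** (legs12 Rim ** legs23 Rim)) $ x $ y"
      by (simp add: x y legs12_mult_entry legs23_mult_entry Rim_def sum_distrib_left)
         (simp add: legs23_def kron_def mat_def Rim_def of_bool_def if_distrib[of "(*) _"] if_distrib[of "\<lambda>x. x * _"] if_conj_sum mult_ac cong: if_cong)
    finally show ?thesis .
  qed
  thus ?thesis by (simp add: vec_eq_iff)
qed

lemma YB_Rm: "ct (legs23 Umi) (ct (legs12 Rm) (ct (legs23 Rm) F)) = ct (legs12 Rm) (ct (legs23 Rm) (ct (legs12 Umi) F))"
proof -
  note inv = ct_legs12_inverse[OF Rm_Rim] ct_legs23_inverse[OF Rm_Rim] ct_legs12_inverse[OF Rim_Rm]
    ct_legs23_inverse[OF Rim_Rm] ct_legs12_inverse[OF Umi_Um] ct_legs23_inverse[OF Um_Umi]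
    ct_legs12_inverse[OF Um_Umi] ct_legs23_inverse[OF Umi_Um]
  have YB: "ct (legs12 Um) (ct (legs23 Rim) (ct (legs12 Rim) F)) = ct (legs23 Rim) (ct (legs12 Rim) (ct (legs23 Um) F))" for F
    by (simp only: ct_mult[symmetric] YB_Rim matrix_mul_assoc[symmetric])
  define H where "H = ct (legs23 Umi) (ct (legs12 Rm) (ct (legs23 Rm) F))"
  have "ct (legs23 Rim) (ct (legs12 Rim) (ct (legs23 Um) H)) = F"
    by (simp add: H_def inv)
  hence "ct (legs12 Um) (ct (legs23 Rim) (ct (legs12 Rim) H)) = F" by (simp add: YB)
  hence "ct (legs12 Rm) (ct (legs23 Rm) (ct (legs12 Umi) (ct (legs12 Um) (ct (legs23 Rim) (ct (legs12 Rim) H))))) =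
    ct (legs12 Rm) (ct (legs23 Rm) (ct (legs12 Umi) F))" by simp
  thus ?thesis by (simp add: inv H_def)
qed

section \<open>Contractions of the operators on three legs\<close>

text \<open>
  The matrices of the operators \<open>S~\<close> and \<open>S\<close> (see \<open>Stmat_D\<close>, \<open>Smat_D\<close> below). A contraction of output
  legs slides through the first crossings; where a crossing is met twice, the quadratic relation gives
  the second term.
\<close>

definition "Stm = legs12 Rm ** legs23 Umi ** legs12 Rim"
definition "Sm = legs23 Rm ** legs12 Qm ** legs23 Rim"

lemma ct_Stm: "ct Stm F = ct (legs12 Rim) (ct (legs23 Umi) (ct (legs12 Rm) F))"
  by (simp add: Stm_def ct_mult)

lemma ct_Sm: "ct Sm F = ct (legs23 Rim) (ct (legs12 Qm) (ct (legs23 Rm) F))"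
  by (simp add: Sm_def ct_mult)

lemma Stm_ev: "ct Stm (capl one1 G) y = capr qq G y / (\<theta> * \<kappa> ^ N)"
proof -
  have "ct (legs12 Rm) (capl one1 G) = (\<lambda>y. 1 / (\<theta> * \<kappa> ^ N) * capl qq G y)" by (rule ext) (simp add: cap_Rm)
  thus ?thesis
    by (simp only: ct_Stm ct_linear_fun cap_slide_Umi ct_legs12_inverse[OF Rm_Rim]) simp
qed

lemma Stm_trace: "ct Stm (capr qq G) y = \<kappa> ^ N / \<theta> * capl one1 G y - h / \<theta> * capr qq G y"
proof -
  have 1: "ct (legs23 Umi) (ct (legs23 Umi) F) = (\<lambda>y. 1 / \<theta>\<^sup>2 * F y - h / \<theta> * ct (legs23 Umi) F y)" for F
  proof -
    have "ct (legs23 Umi) F y = 1 / \<theta>\<^sup>2 * ct (legs23 Um) F y - h / \<theta> * F y" for F and y :: "'n \<times> 'n \<times> 'n"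
      by (cases y) (auto simp: ct_legs23 ct_Umi)
    hence "ct (legs23 Umi) (ct (legs23 Umi) F) y = 1 / \<theta>\<^sup>2 * ct (legs23 Um) (ct (legs23 Umi) F) y - h / \<theta> * ct (legs23 Umi) F y" for y
      by blast
    thus ?thesis by (simp add: fun_eq_iff ct_legs23_inverse[OF Umi_Um])
  qed
  have "ct Stm (capr qq G) = ct (legs12 Rim) (ct (legs23 Umi) (ct (legs23 Umi) (capl qq G)))"
    by (simp add: ct_Stm cap_slide_Umi)
  also have "\<dots> = ct (legs12 Rim) (\<lambda>y. 1 / \<theta>\<^sup>2 * capl qq G y - h / \<theta> * ct (legs12 Rm) (capr qq G) y)"
    by (simp only: 1) (simp only: cap_slide_Umi)
  finally show ?thesis
    using theta by (simp only: ct_linear cap_Rim ct_legs12_inverse[OF Rm_Rim]) (simp add: power2_eq_square)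
qed

lemma Sm_ev: "ct Sm (capr one1 G) y = \<theta> / \<kappa> ^ N * capl qq G y + \<theta> * h * capr one1 G y"
proof -
  have h: "ct (legs12 Qm) (ct (legs12 Qm) F) y = \<theta>\<^sup>2 * F y + \<theta> * h * ct (legs12 Qm) F y" for F and y :: "'n \<times> 'n \<times> 'n"
  proof -
    obtain a b c where y: "y = (a, b, c)" by (metis prod.exhaust)
    have *: "(\<lambda>(x, z). ct (legs12 Qm) F (x, z, c)) = ct Qm (\<lambda>(x, z). F (x, z, c))"
      by (auto simp: fun_eq_iff ct_legs12)
    show ?thesis unfolding y ct_legs12[of Qm "ct (legs12 Qm) F"] * hecke_Q by (simp add: ct_legs12)
  qed
  have "ct (legs23 Rm) (capr one1 G) = (\<lambda>y. 1 / (\<theta> * \<kappa> ^ N) * capr qq G y)" by (rule ext) (simp add: cap_Rm)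
  moreover have "ct (legs12 Qm) (capr qq G) = (\<lambda>y. \<theta>\<^sup>2 * ct (legs23 Rm) (capl qq G) y + \<theta> * h * capr qq G y)"
    by (rule ext) (simp only: h[of "ct (legs23 Rm) (capl qq G)", unfolded cap_slide_Q])
  ultimately show ?thesis
    using theta kappa by (simp only: ct_Sm ct_linear_fun cap_Rim ct_legs23_inverse[OF Rm_Rim]) (simp add: power2_eq_square field_simps)
qed

text \<open>
  By the braid relation the outer crossing passes through \<open>Stm\<close>. What remains is two copies of \<open>Rm\<close>
  joined by a contraction, the matrix form of the multiplicativity of the change of basis in
  \<open>hat_star\<close>.
\<close>

lemma Stm_hat: "qq i * ct Stm (\<lambda>(x, k, l). of_bool (x = i) * ct Rm F (k, l)) (b, c, d) =
   ct Rm (\<lambda>(y, z). ct Rm (\<lambda>(e, j). of_bool (j = y) * (qq j * F (e, z))) (i, b)) (c, d)"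
proof -
  define F3 where "F3 = (\<lambda>(x, e, f). of_bool (x = i) * F (e, f))"
  have F3: "(\<lambda>(x, k, l). of_bool (x = i) * ct Rm F (k, l)) = ct (legs23 Rm) F3"
  proof
    fix y :: "'n \<times> 'n \<times> 'n"
    obtain x k l where y: "y = (x, k, l)" by (metis prod.exhaust)
    have "ct Rm (\<lambda>p. of_bool (x = i) * F p) (k, l) = of_bool (x = i) * ct Rm F (k, l)" by (rule ct_linear)
    thus "(\<lambda>(x, k, l). of_bool (x = i) * ct Rm F (k, l)) y = ct (legs23 Rm) F3 y"
      by (simp add: y ct_legs23 F3_def case_prod_unfold)
  qed
  have "qq i * ct Stm (ct (legs23 Rm) F3) (b, c, d) = qq i * ct (legs23 Rm) (ct (legs12 Umi) F3) (b, c, d)"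
    by (simp add: ct_Stm YB_Rm ct_legs12_inverse[OF Rm_Rim])
  also have "\<dots> = ct Rm (\<lambda>(y, z). qq i * ct Umi (\<lambda>(x, e). of_bool (x = i) * F (e, z)) (b, y)) (c, d)"
    by (simp add: ct_legs23 ct_legs12 F3_def case_prod_unfold ct_linear)
  also have "(\<lambda>(y, z). qq i * ct Umi (\<lambda>(x, e). of_bool (x = i) * F (e, z)) (b, y)) =
     (\<lambda>(y, z). ct Rm (\<lambda>(e, j). of_bool (j = y) * (qq j * F (e, z))) (i, b))"
  proof (clarsimp simp: fun_eq_iff)
    fix y z
    have "ct (legs23 Umi) (capl qq (\<lambda>e. F (e, z))) (i, b, y) = ct (legs12 Rm) (capr qq (\<lambda>e. F (e, z))) (i, b, y)"
      by (simp only: cap_slide_Umi)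
    moreover have "(\<lambda>(x, e). of_bool (i = x) * (qq i * F (e, z))) = (\<lambda>p. qq i * (case p of (x, e) \<Rightarrow> of_bool (x = i) * F (e, z)))"
      by auto
    ultimately show "qq i * ct Umi (\<lambda>(x, e). of_bool (x = i) * F (e, z)) (b, y) =
          ct Rm (\<lambda>(e, j). of_bool (j = y) * (qq j * F (e, z))) (i, b)"
      by (simp add: ct_legs23 ct_legs12 capl_def capr_def case_prod_unfold ct_linear(3)[symmetric] mult.left_commute)
  qed
  finally show ?thesis by (simp only: F3)
qed

text \<open>
  The same for input legs: inserting the invariant vector of \<open>V* \<otimes> V\<close> is a contraction of the
  value of \<open>ct\<close> instead of its argument.
\<close>

lemma cup_Rim: "(\<Sum>k\<in>UNIV. ct Rim F (k, k) / qq k) = \<theta> * \<kappa> ^ N * (\<Sum>k\<in>UNIV. F (k, k))"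
proof -
  have "(\<Sum>k\<in>UNIV. h * (\<Sum>l\<in>{l. \<phi> l < \<phi> k}. F (l, l)) / qq k) = (\<Sum>k\<in>UNIV. \<Sum>l | l \<in> UNIV \<and> \<phi> l < \<phi> k. h * F (l, l) / qq k)"
    by (simp add: sum_distrib_left sum_divide_distrib)
  also have "\<dots> = (\<Sum>l\<in>UNIV. \<Sum>k | k \<in> UNIV \<and> \<phi> l < \<phi> k. h * F (l, l) / qq k)"
    by (rule sum.swap_restrict) auto
  also have "\<dots> = (\<Sum>l\<in>UNIV. (h * (\<Sum>k\<in>{k. \<phi> l < \<phi> k}. 1 / qq k)) * F (l, l))"
    by (simp add: sum_distrib_left sum_distrib_right)
  also have "\<dots> = \<kappa> ^ N * (\<Sum>k\<in>UNIV. F (k, k)) - (\<Sum>k\<in>UNIV. \<kappa> * F (k, k) / qq k)"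
    unfolding sum_inv_qq_above by (simp add: left_diff_distrib sum_subtractf sum_distrib_left)
  finally have "(\<Sum>k\<in>UNIV. \<kappa> * F (k, k) / qq k) + (\<Sum>k\<in>UNIV. h * (\<Sum>l\<in>{l. \<phi> l < \<phi> k}. F (l, l)) / qq k) =
     \<kappa> ^ N * (\<Sum>k\<in>UNIV. F (k, k))" by simp
  moreover have "(\<Sum>k\<in>UNIV. ct Rim F (k, k) / qq k) =
     \<theta> * ((\<Sum>k\<in>UNIV. \<kappa> * F (k, k) / qq k) + (\<Sum>k\<in>UNIV. h * (\<Sum>l\<in>{l. \<phi> l < \<phi> k}. F (l, l)) / qq k))"
    unfolding sum.distrib[symmetric] sum_distrib_left[of \<theta>]
    by (intro sum.cong refl) (simp only: ct_Rim if_True simp_thms add_divide_distrib distrib_left times_divide_eq_right)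
  ultimately show ?thesis by simp
qed

lemma cup_Rm: "(\<Sum>k\<in>UNIV. ct Rm F (k, k)) = (\<Sum>k\<in>UNIV. F (k, k) / qq k) / (\<theta> * \<kappa> ^ N)"
  using cup_Rim[of "ct Rm F"] theta kappa by simp

lemma cup_slide_U: "(\<Sum>k\<in>UNIV. ct (legs23 Um) (ct (legs12 Rm) F) (k, k, e)) = (\<Sum>k\<in>UNIV. F (e, k, k))"
proof -
  define G where "G c = ct Rm (\<lambda>(x, y). F (x, y, c))" for c
  have "(\<Sum>k\<in>UNIV. ct (legs23 Um) (ct (legs12 Rm) F) (k, k, e)) = (\<Sum>k\<in>UNIV. ct Um (\<lambda>(l, c). G c (k, l)) (k, e))"
    by (simp add: ct_legs23 ct_legs12 G_def case_prod_unfold)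
  also have "\<dots> = (\<Sum>k\<in>UNIV. (if k = e then 0 else F (e, k, k)) + (of_bool (k = e) * (\<theta> * \<kappa> * G e (e, e))
       + (if \<phi> k < \<phi> e then \<theta> * h * G e (k, k) else 0)))"
    using theta by (intro sum.cong refl) (auto simp: ct_Um G_def ct_Rm algebra_simps)
  also have "\<dots> = (\<Sum>k\<in>UNIV. (if k = e then 0 else F (e, k, k))) + (\<theta> * \<kappa> * G e (e, e) + \<theta> * h * (\<Sum>k\<in>{k. \<phi> k < \<phi> e}. G e (k, k)))"
    unfolding sum.distrib sum_delta_mult by (simp add: sum.If_cases sum_distrib_left)
  also have "\<theta> * \<kappa> * G e (e, e) + \<theta> * h * (\<Sum>k\<in>{k. \<phi> k < \<phi> e}. G e (k, k)) = ct Rim (G e) (e, e)"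
    by (simp add: ct_Rim algebra_simps)
  also have "\<dots> = F (e, e, e)" by (simp add: G_def)
  also have "(\<Sum>k\<in>UNIV. (if k = e then 0 else F (e, k, k))) + F (e, e, e) = (\<Sum>k\<in>UNIV. F (e, k, k))"
    by (subst (1 2) sum.remove[of _ e]) (auto intro!: sum.cong simp: add.commute)
  finally show ?thesis .
qed

lemma Stm_cup: "(\<Sum>k\<in>UNIV. ct Stm F (k, k, e) / qq k) =
   \<kappa> ^ N / \<theta> * (\<Sum>k\<in>UNIV. F (e, k, k)) - h / \<theta> * (\<Sum>k\<in>UNIV. F (k, k, e) / qq k)"
proof -
  have "(\<Sum>k\<in>UNIV. ct Stm F (k, k, e) / qq k) = \<theta> * \<kappa> ^ N * (\<Sum>k\<in>UNIV. ct (legs23 Umi) (ct (legs12 Rm) F) (k, k, e))"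
    using cup_Rim[of "\<lambda>(x, y). ct (legs23 Umi) (ct (legs12 Rm) F) (x, y, e)"] by (simp add: ct_Stm ct_legs12)
  also have "ct (legs23 Umi) (ct (legs12 Rm) F) y = 1 / \<theta>\<^sup>2 * ct (legs23 Um) (ct (legs12 Rm) F) y - h / \<theta> * ct (legs12 Rm) F y" for y
    by (cases y) (auto simp: ct_legs23 ct_Umi)
  hence "(\<Sum>k\<in>UNIV. ct (legs23 Umi) (ct (legs12 Rm) F) (k, k, e)) =
     1 / \<theta>\<^sup>2 * (\<Sum>k\<in>UNIV. ct (legs23 Um) (ct (legs12 Rm) F) (k, k, e)) - h / \<theta> * (\<Sum>k\<in>UNIV. ct (legs12 Rm) F (k, k, e))"
    by (simp add: sum_subtractf sum_distrib_left)
  also have "(\<Sum>k\<in>UNIV. ct (legs12 Rm) F (k, k, e)) = (\<Sum>k\<in>UNIV. F (k, k, e) / qq k) / (\<theta> * \<kappa> ^ N)"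
    using cup_Rm[of "\<lambda>(x, y). F (x, y, e)"] by (simp add: ct_legs12)
  finally show ?thesis
    using theta kappa by (simp add: cup_slide_U right_diff_distrib power2_eq_square)
qed

end

section \<open>Weights of type A\<close>

lemma cpow_add: "0 < q \<Longrightarrow> cpow q (x + y) = cpow q x * cpow q y"
  and cpow_minus: "0 < q \<Longrightarrow> cpow q (- x) = 1 / cpow q x"
  and cpow_0: "0 < q \<Longrightarrow> cpow q 0 = 1"
  and cpow_1: "0 < q \<Longrightarrow> cpow q 1 = complex_of_real q"
  and cpow_nz: "0 < q \<Longrightarrow> cpow q x \<noteq> 0"
  and cpow_nat: "0 < q \<Longrightarrow> cpow q (real n) = complex_of_real q ^ n"
  and cpow_diff: "0 < q \<Longrightarrow> cpow q (x - y) = cpow q x / cpow q y"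
  by (auto simp: cpow_def powr_add powr_minus_divide powr_realpow powr_diff)

lemma cpow_inj: "0 < q \<Longrightarrow> q < 1 \<Longrightarrow> cpow q x = cpow q y \<longleftrightarrow> x = y"
  by (simp add: cpow_def powr_inj)

lemma wform_sroot:
  assumes "i \<in> {1..r}"
  shows "wform r (sroot i) l = l i - l (i + 1)"
proof -
  have "wform r (sroot i) l = (\<Sum>k=1..r+1. (if k = i then l k else 0) - (if k = i + 1 then l k else 0))"
    unfolding wform_def sroot_def by (intro sum.cong) auto
  thus ?thesis using assms by (simp add: sum_subtractf)
qed

lemma wform_sroot_sroot:
  assumes "i \<in> {1..r}"
  shows "wform r (sroot i) (sroot j) = 2 * of_bool (i = j) - of_bool (i = j + 1) - of_bool (j = i + 1)"
  unfolding wform_sroot[OF assms] by (auto simp: sroot_def)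

lemma wform_sroot_fweight:
  assumes "i \<in> {1..r}" "j \<in> {1..r}"
  shows "wform r (sroot i) (fweight r j) = of_bool (i = j)"
  using assms by (auto simp: wform_sroot fweight_def)

lemma wform_sum_right: "wform r l (\<lambda>k. \<Sum>i\<in>I. c i * f i k) = (\<Sum>i\<in>I. c i * wform r l (f i))"
  unfolding wform_def sum_distrib_left
  by (subst sum.swap) (simp add: mult_ac)

lemma wform_commute: "wform r l m = wform r m l"
  by (simp add: wform_def mult.commute)

lemma weight_lattice_expand:
  assumes "l \<in> weight_lattice r"
  shows "l = (\<lambda>k. \<Sum>i=1..r. wform r (sroot i) l * fweight r i k)"
proof -
  obtain c :: "nat \<Rightarrow> int" where l: "l = (\<lambda>k. \<Sum>i=1..r. of_int (c i) * fweight r i k)"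
    using assms by (auto simp: weight_lattice_def)
  have "wform r (sroot j) l = of_int (c j)" if "j \<in> {1..r}" for j
  proof -
    have "wform r (sroot j) l = (\<Sum>i=1..r. of_int (c i) * wform r (sroot j) (fweight r i))"
      unfolding l by (rule wform_sum_right)
    also have "\<dots> = (\<Sum>i=1..r. if i = j then of_int (c i) else 0)"
      using that by (intro sum.cong) (auto simp: wform_sroot_fweight)
    finally show ?thesis using that by simp
  qed
  thus ?thesis by (subst l) (simp add: fun_eq_iff)
qed

lemma weight_lattice_eqI:
  assumes "l \<in> weight_lattice r" "m \<in> weight_lattice r"
    and "\<And>i. i \<in> {1..r} \<Longrightarrow> wform r (sroot i) l = wform r (sroot i) m"
  shows "l = m"
  by (subst weight_lattice_expand[OF assms(1)], subst weight_lattice_expand[OF assms(2)])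
     (simp add: assms(3))

lemma fweight_lattice: "i \<in> {1..r} \<Longrightarrow> fweight r i \<in> weight_lattice r"
  unfolding weight_lattice_def
  by (rule CollectI, rule exI[of _ "\<lambda>j. of_bool (j = i)"])
     (auto simp: fun_eq_iff of_bool_def if_distrib[of real_of_int] if_distrib[of "\<lambda>x. x * _"] cong: if_cong)

lemma fweight_minus_lattice: "i \<in> {1..r} \<Longrightarrow> (\<lambda>k. - fweight r i k) \<in> weight_lattice r"
  unfolding weight_lattice_def
  by (rule CollectI, rule exI[of _ "\<lambda>j. - of_bool (j = i)"])
     (auto simp: fun_eq_iff of_bool_def sum_negf if_distrib[of real_of_int] if_distrib[of "\<lambda>x. x * _"] cong: if_cong)

lemma w0_fweight:
  assumes "i \<in> {1..r}"
  shows "w0 r (fweight r i) = (\<lambda>k. - fweight r (r + 1 - i) k)"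
proof
  fix k
  show "w0 r (fweight r i) k = - fweight r (r + 1 - i) k"
  proof (cases "k \<in> {1..r+1}")
    case True
    have 1: "(r + 2 - k \<le> i) = (\<not> k \<le> r + 1 - i)" using True assms by auto
    have "r + 2 - k \<in> {1..r+1}" using True by auto
    hence "w0 r (fweight r i) k = of_bool (\<not> k \<le> r + 1 - i) - real i / real (r + 1)"
      unfolding w0_def fweight_def 1 by simp
    moreover have "fweight r (r + 1 - i) k = of_bool (k \<le> r + 1 - i) - (real (r + 1) - real i) / real (r + 1)"
      unfolding fweight_def using True assms by (simp add: of_nat_diff)
    ultimately show ?thesis by (simp add: diff_divide_distrib of_bool_not_iff)
  next
    case False
    have "r + 2 - k \<notin> {1..r+1}" using False by auto
    thus ?thesis using False by (simp only: w0_def fweight_def if_False minus_zero)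
  qed
qed

lemma wform_fweight:
  assumes "i \<le> j" "j \<in> {1..r}"
  shows "wform r (fweight r i) (fweight r j) = real i * (real r + 1 - real j) / (real r + 1)"
proof -
  let ?N = "real r + 1"
  have sub: "{k\<in>{1..r+1}. k \<le> i} = {1..i}" if "i \<le> r" for i using that by auto
  have c: "(\<Sum>k=1..r+1. of_bool (k \<le> i)) = real i" if "i \<le> r" for i
    by (simp add: of_bool_def sum.If_cases Int_def sub[OF that, simplified] sum.inter_filter[symmetric] del: sum.cl_ivl_Suc)
  have "wform r (fweight r i) (fweight r j) =
     (\<Sum>k=1..r+1. of_bool (k \<le> i) - real j / ?N * of_bool (k \<le> i) - real i / ?N * of_bool (k \<le> j) + real i / ?N * (real j / ?N))"
    unfolding wform_def fweight_def using assms(1) by (intro sum.cong) (auto simp: algebra_simps)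
  also have "\<dots> = real i - real j / ?N * real i - real i / ?N * real j + ?N * (real i / ?N * (real j / ?N))"
  proof -
    have ij: "i \<le> r" "j \<le> r" using assms by auto
    show ?thesis
      by (simp only: sum.distrib sum_subtractf sum_distrib_left[symmetric] c[OF ij(1)] c[OF ij(2)] sum_constant card_atLeastAtMost)
         (simp add: add.commute[of 1 "real r"])
  qed
  also have "\<dots> = real i * (?N - real j) / ?N"
  proof -
    have "u - v / n * u - u / n * v + n * (u / n * (v / n)) = u * (n - v) / n" if "n \<noteq> 0" for u v n :: real
      using that by (simp add: field_simps)
    thus ?thesis by simp
  qed
  finally show ?thesis .
qed

lemma two_rho_eq: "k \<in> {1..r+1} \<Longrightarrow> two_rho r k = real r + 2 - 2 * real k"
proof -
  assume k: "k \<in> {1..r+1}"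
  have "(\<Sum>i=1..r. of_bool (k \<le> i)) = real (card {i\<in>{1..r}. k \<le> i})"
    by (simp add: of_bool_def sum.If_cases Int_def)
  also have "{i\<in>{1..r}. k \<le> i} = {k..r}" using k by auto
  finally have 1: "(\<Sum>i=1..r. of_bool (k \<le> i)) = real (r + 1 - k)" by simp
  have "(\<Sum>i=1..r. real i) = real r * (real r + 1) / 2"
    by (induction r) (auto simp: field_simps)
  hence 2: "(\<Sum>i=1..r. real i / real (r + 1)) = real r / 2"
    unfolding sum_divide_distrib[symmetric] by (simp add: field_simps)
  have "two_rho r k = 2 * ((\<Sum>i=1..r. of_bool (k \<le> i)) - (\<Sum>i=1..r. real i / real (r + 1)))"
    using k unfolding two_rho_def fweight_def by (simp add: sum_subtractf)
  thus ?thesis using k unfolding 1 2 by (simp add: of_nat_diff)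
qed

lemma wform_fweight_two_rho:
  assumes "i \<in> {1..r}"
  shows "wform r (fweight r i) (two_rho r) = real i * (real r + 1 - real i)"
proof -
  have s: "(\<Sum>k=1..n. c - 2 * real k) = real n * (c - 1 - real n)" for n and c :: real
    by (induction n) (auto simp: algebra_simps)
  have "wform r (fweight r i) (two_rho r) =
     (\<Sum>k=1..r+1. (if k \<le> i then real r + 2 - 2 * real k else 0) - real i / (real r + 1) * (real r + 2 - 2 * real k))"
    unfolding wform_def using assms by (intro sum.cong) (auto simp: two_rho_eq fweight_def algebra_simps)
  also have "\<dots> = (\<Sum>k\<in>{k\<in>{1..r+1}. k \<le> i}. real r + 2 - 2 * real k) - real i / (real r + 1) * (\<Sum>k=1..r+1. real r + 2 - 2 * real k)"
    by (subst sum.inter_filter, simp, subst sum_distrib_left, rule sum_subtractf)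
  also have "{k\<in>{1..r+1}. k \<le> i} = {1..i}" using assms by auto
  finally show ?thesis unfolding s by simp
qed

section \<open>The vector representation and its dual\<close>

text \<open>
  The eigenvalue of the \<open>i\<close>-th diagonal generator on the \<open>n\<close>-th basis vector of a chain.
\<close>

definition kw :: "complex \<Rightarrow> nat \<Rightarrow> nat \<Rightarrow> complex" where
  "kw \<kappa> i n = (if n = i then \<kappa> else if n = Suc i then 1 / \<kappa> else 1)"

text \<open>
  Modules of the shape of the vector representation: the basis, numbered by \<open>\<phi>\<close>, is a chain along
  which the \<open>i\<close>-th lowering operator takes the \<open>i\<close>-th vector to a multiple of the next one. The
  renumbering \<open>\<nu>\<close> of the nodes covers \<open>V(\<omega>\<^sub>1)\<close> and \<open>V(\<omega>\<^sub>r)\<close> at once, and makes the dual of such a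
  module a module of the same shape.
\<close>

definition chain_ops :: "nat \<Rightarrow> complex \<Rightarrow> (nat \<Rightarrow> nat) \<Rightarrow> ('n \<Rightarrow> nat) \<Rightarrow> (nat \<Rightarrow> complex) \<Rightarrow> (nat \<Rightarrow> complex) \<Rightarrow>
    ('n::finite) uq_rep \<Rightarrow> bool" where
  "chain_ops r \<kappa> \<nu> \<phi> x y X \<longleftrightarrow> bij_betw \<phi> UNIV {1..r+1} \<and>
     ((\<forall>i\<in>{1..r}. \<nu> i = i) \<or> (\<forall>i\<in>{1..r}. \<nu> i = r + 1 - i)) \<and>
     (\<forall>i\<in>{1..r}. x i * y i = 1 \<and>
       Kop X (\<nu> i) = (\<chi> a b. if a = b then kw \<kappa> i (\<phi> a) else 0) \<and>
       Eop X (\<nu> i) = (\<chi> a b. if \<phi> a = i \<and> \<phi> b = Suc i then x i else 0) \<and>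
       Fop X (\<nu> i) = (\<chi> a b. if \<phi> a = Suc i \<and> \<phi> b = i then y i else 0))"

lemma ct_kron: "ct (kron A B) F (a, b) = ct A (\<lambda>k. ct B (\<lambda>l. F (k, l)) b) a"
  by (simp add: ct_def kron_def sum_pair_UNIV sum_distrib_left mult_ac)

lemma ct_diag: "ct (\<chi> a b. if a = b then d a else 0) F b = d b * F b"
  by (simp add: ct_def if_distrib[of "\<lambda>x. x * _"] cong: if_cong)

locale chain_rep =
  fixes r :: nat and \<kappa> :: complex and \<nu> :: "nat \<Rightarrow> nat" and \<phi> :: "'n::finite \<Rightarrow> nat"
    and x y :: "nat \<Rightarrow> complex" and X :: "'n uq_rep"
  assumes ops: "chain_ops r \<kappa> \<nu> \<phi> x y X" and kap: "\<kappa> \<noteq> 0" and r1: "r \<ge> 1"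
begin

lemma phi_bij: "bij_betw \<phi> UNIV {1..r+1}" and nu_cases: "(\<forall>i\<in>{1..r}. \<nu> i = i) \<or> (\<forall>i\<in>{1..r}. \<nu> i = r + 1 - i)"
  using ops by (auto simp: chain_ops_def)

lemma phi_eq: "\<phi> a = \<phi> b \<longleftrightarrow> a = b"
  using phi_bij by (auto simp: bij_betw_def inj_def)

lemma phi_in: "\<phi> a \<in> {1..r+1}"
  using phi_bij by (auto simp: bij_betw_def)

lemma nu_alt: obtains b where "\<And>i. i \<in> {1..r} \<Longrightarrow> \<nu> i = (if b then i else r + 1 - i)"
  using nu_cases by (cases "\<forall>i\<in>{1..r}. \<nu> i = i") (meson, metis)

lemma nu_in: "i \<in> {1..r} \<Longrightarrow> \<nu> i \<in> {1..r}" and nu_inj: "i \<in> {1..r} \<Longrightarrow> j \<in> {1..r} \<Longrightarrow> \<nu> i = \<nu> j \<longleftrightarrow> i = j"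
  and nu_rev: "i \<in> {1..r} \<Longrightarrow> \<nu> (r + 1 - i) = r + 1 - \<nu> i"
  and nu_surj: "j \<in> {1..r} \<Longrightarrow> \<exists>i\<in>{1..r}. j = \<nu> i"
proof -
  obtain b where nu: "\<And>i. i \<in> {1..r} \<Longrightarrow> \<nu> i = (if b then i else r + 1 - i)" using nu_alt by blast
  have rev: "r + 1 - i \<in> {1..r}" if "i \<in> {1..r}" for i using that by auto
  show "i \<in> {1..r} \<Longrightarrow> \<nu> i \<in> {1..r}" "i \<in> {1..r} \<Longrightarrow> j \<in> {1..r} \<Longrightarrow> \<nu> i = \<nu> j \<longleftrightarrow> i = j"
    using nu[of i] nu[of j] by auto
  show "i \<in> {1..r} \<Longrightarrow> \<nu> (r + 1 - i) = r + 1 - \<nu> i"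
    using nu[of i] nu[OF rev[of i]] by (cases b) auto
  show "\<exists>i\<in>{1..r}. j = \<nu> i" if "j \<in> {1..r}"
    using that nu[OF that] nu[OF rev[OF that]] rev[OF that]
    by (cases b) (auto intro: bexI[of _ j] bexI[of _ "r + 1 - j"])
qed

definition "p n = inv_into UNIV \<phi> n"

lemma phi_p [simp]: "n \<in> {1..r+1} \<Longrightarrow> \<phi> (p n) = n"
  unfolding p_def using phi_bij by (intro f_inv_into_f) (auto simp: bij_betw_def)

lemma p_phi [simp]: "p (\<phi> a) = a"
  unfolding p_def using phi_bij by (intro inv_into_f_f) (auto simp: bij_betw_def)

lemma p_eq: "n \<in> {1..r+1} \<Longrightarrow> p n = a \<longleftrightarrow> n = \<phi> a"
  by auto

lemma kw_nz [simp]: "kw \<kappa> i n \<noteq> 0"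
  using kap by (simp add: kw_def)

lemma Kop_eq: "i \<in> {1..r} \<Longrightarrow> Kop X (\<nu> i) = (\<chi> a b. if a = b then kw \<kappa> i (\<phi> a) else 0)"
  and Eop_eq: "i \<in> {1..r} \<Longrightarrow> Eop X (\<nu> i) = (\<chi> a b. if \<phi> a = i \<and> \<phi> b = Suc i then x i else 0)"
  and Fop_eq: "i \<in> {1..r} \<Longrightarrow> Fop X (\<nu> i) = (\<chi> a b. if \<phi> a = Suc i \<and> \<phi> b = i then y i else 0)"
  and xy: "i \<in> {1..r} \<Longrightarrow> x i * y i = 1"
  using ops by (auto simp: chain_ops_def)

lemma Kinv_eq:
  assumes "i \<in> {1..r}"
  shows "matrix_inv (Kop X (\<nu> i)) = (\<chi> a b. if a = b then 1 / kw \<kappa> i (\<phi> a) else 0)"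
proof (rule matrix_inv_eqI)
  show "Kop X (\<nu> i) ** (\<chi> a b. if a = b then 1 / kw \<kappa> i (\<phi> a) else 0) = mat 1"
    by (rule ct_ext) (simp add: Kop_eq[OF assms] ct_mult ct_diag)
qed

lemma ct_K: "i \<in> {1..r} \<Longrightarrow> ct (Kop X (\<nu> i)) F b = kw \<kappa> i (\<phi> b) * F b"
  by (simp add: Kop_eq ct_diag)

lemma ct_Kinv: "i \<in> {1..r} \<Longrightarrow> ct (matrix_inv (Kop X (\<nu> i))) F b = F b / kw \<kappa> i (\<phi> b)"
  by (simp add: Kinv_eq ct_diag)

lemma ct_step:
  assumes "m \<in> {1..r+1}"
  shows "ct (\<chi> a b. if \<phi> a = m \<and> \<phi> b = n then c else 0) F b = (if \<phi> b = n then c * F (p m) else 0)"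
proof -
  have "(if \<phi> a = m \<and> \<phi> b = n then c else 0) * F a = (if a = p m then (if \<phi> b = n then c * F (p m) else 0) else 0)" for a
    using assms by auto
  thus ?thesis by (simp add: ct_def)
qed

lemma ct_E: "i \<in> {1..r} \<Longrightarrow> ct (Eop X (\<nu> i)) F b = (if \<phi> b = Suc i then x i * F (p i) else 0)"
  by (simp add: Eop_eq ct_step)

lemma ct_F: "i \<in> {1..r} \<Longrightarrow> ct (Fop X (\<nu> i)) F b = (if \<phi> b = i then y i * F (p (Suc i)) else 0)"
  by (simp add: Fop_eq ct_step)

lemma ct_dual_K: "i \<in> {1..r} \<Longrightarrow> ct (Kop (dual_rep X) (\<nu> i)) F b = F b / kw \<kappa> i (\<phi> b)"
proof -
  assume i: "i \<in> {1..r}"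
  have "Kop (dual_rep X) (\<nu> i) = (\<chi> a b. if a = b then 1 / kw \<kappa> i (\<phi> a) else 0)"
    by (auto simp: dual_rep_def Kinv_eq[OF i] transpose_def vec_eq_iff)
  thus ?thesis by (simp add: ct_diag)
qed

lemma EKinv: "i \<in> {1..r} \<Longrightarrow> Eop X (\<nu> i) ** matrix_inv (Kop X (\<nu> i)) = (\<chi> a b. if \<phi> a = i \<and> \<phi> b = Suc i then \<kappa> * x i else 0)"
  by (rule ct_ext) (simp add: ct_mult ct_E ct_Kinv ct_step, simp add: kw_def)

lemma KF: "i \<in> {1..r} \<Longrightarrow> Kop X (\<nu> i) ** Fop X (\<nu> i) = (\<chi> a b. if \<phi> a = Suc i \<and> \<phi> b = i then y i / \<kappa> else 0)"
  by (rule ct_ext) (simp add: ct_mult ct_F ct_K ct_step, simp add: kw_def)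

lemma dual_E_eq: "i \<in> {1..r} \<Longrightarrow> Eop (dual_rep X) (\<nu> i) = (\<chi> a b. if \<phi> a = Suc i \<and> \<phi> b = i then - (\<kappa> * x i) else 0)"
  by (auto simp: dual_rep_def EKinv transpose_def vec_eq_iff)

lemma dual_F_eq: "i \<in> {1..r} \<Longrightarrow> Fop (dual_rep X) (\<nu> i) = (\<chi> a b. if \<phi> a = i \<and> \<phi> b = Suc i then - (y i / \<kappa>) else 0)"
  by (auto simp: dual_rep_def KF transpose_def vec_eq_iff)

lemma ct_dual_E: "i \<in> {1..r} \<Longrightarrow> ct (Eop (dual_rep X) (\<nu> i)) F b = (if \<phi> b = i then - (\<kappa> * x i) * F (p (Suc i)) else 0)"
  by (simp add: dual_E_eq ct_step)

lemma ct_dual_F: "i \<in> {1..r} \<Longrightarrow> ct (Fop (dual_rep X) (\<nu> i)) F b = (if \<phi> b = Suc i then - (y i / \<kappa>) * F (p i) else 0)"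
  by (simp add: dual_F_eq ct_step)

lemma dual_chain_ops:
  "chain_ops r \<kappa> (\<lambda>i. \<nu> (r + 1 - i)) (\<lambda>a. r + 2 - \<phi> a) (\<lambda>i. - (\<kappa> * x (r + 1 - i))) (\<lambda>i. - (y (r + 1 - i) / \<kappa>)) (dual_rep X)"
  unfolding chain_ops_def
proof (intro conjI ballI)
  have "bij_betw (\<lambda>n. r + 2 - n) {1..r+1} {1..r+1}"
    by (rule bij_betwI[of _ _ _ "\<lambda>n. r + 2 - n"]) auto
  from bij_betw_trans[OF phi_bij this] show "bij_betw (\<lambda>a. r + 2 - \<phi> a) UNIV {1..r+1}"
    by (simp add: comp_def)
  show "(\<forall>i\<in>{1..r}. \<nu> (r + 1 - i) = i) \<or> (\<forall>i\<in>{1..r}. \<nu> (r + 1 - i) = r + 1 - i)"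
  proof -
    obtain b where nu: "\<And>i. i \<in> {1..r} \<Longrightarrow> \<nu> i = (if b then i else r + 1 - i)" using nu_alt by blast
    have rev: "r + 1 - i \<in> {1..r}" if "i \<in> {1..r}" for i using that by auto
    show ?thesis using nu[OF rev] by (cases b) auto
  qed
next
  fix i assume i: "i \<in> {1..r}"
  hence j: "r + 1 - i \<in> {1..r}" by auto
  have ph: "r + 2 - \<phi> a = i \<longleftrightarrow> \<phi> a = Suc (r + 1 - i)" "r + 2 - \<phi> a = Suc i \<longleftrightarrow> \<phi> a = r + 1 - i" for a
    using phi_in[of a] i by auto
  show "- (\<kappa> * x (r + 1 - i)) * - (y (r + 1 - i) / \<kappa>) = 1"
    using xy[OF j] kap by simp
  show "Eop (dual_rep X) (\<nu> (r + 1 - i)) = (\<chi> a b. if r + 2 - \<phi> a = i \<and> r + 2 - \<phi> b = Suc i then - (\<kappa> * x (r + 1 - i)) else 0)"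
    unfolding ph by (rule dual_E_eq[OF j])
  show "Fop (dual_rep X) (\<nu> (r + 1 - i)) = (\<chi> a b. if r + 2 - \<phi> a = Suc i \<and> r + 2 - \<phi> b = i then - (y (r + 1 - i) / \<kappa>) else 0)"
    unfolding ph by (rule dual_F_eq[OF j])
  show "Kop (dual_rep X) (\<nu> (r + 1 - i)) = (\<chi> a b. if a = b then kw \<kappa> i (r + 2 - \<phi> a) else 0)"
    by (rule ct_ext) (simp only: ct_dual_K[OF j] ct_diag kw_def ph, simp)
qed

end

section \<open>The braidings of the vector representation\<close>

lemma ct_tensor_K: "ct (Kop (tensor_rep X Y) j) G (a, b) = ct (Kop X j) (\<lambda>k. ct (Kop Y j) (\<lambda>l. G (k, l)) b) a"
  and ct_tensor_E: "ct (Eop (tensor_rep X Y) j) G (a, b) =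
     ct (Eop X j) (\<lambda>k. ct (Kop Y j) (\<lambda>l. G (k, l)) b) a + ct (Eop Y j) (\<lambda>l. G (a, l)) b"
  and ct_tensor_F: "ct (Fop (tensor_rep X Y) j) G (a, b) =
     ct (Fop X j) (\<lambda>k. G (k, b)) a + ct (matrix_inv (Kop X j)) (\<lambda>k. ct (Fop Y j) (\<lambda>l. G (k, l)) b) a"
  by (simp_all add: tensor_rep_def ct_matrix_linear ct_kron)

lemma mult_axis: "(A *v axis k 1) $ i = (A $ i $ k :: complex)"
  by (simp add: matrix_vector_mult_def axis_def if_distrib[of "(*) _"] cong: if_cong)

lemma ct_eqI_column: "A *v axis k 1 = B *v axis k 1 \<Longrightarrow> ct A F k = ct B F k"
  by (simp add: ct_def vec_eq_iff mult_axis)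

text \<open>
  The lowering operators do not see a lowest weight vector in the second factor, so they take
  \<open>v\<^sub>1 \<otimes> u\<close> through all \<open>v\<^sub>m \<otimes> u\<close>; the raising operators then reach the rest. A module map is
  therefore determined by its value on the tensor of a highest and a lowest weight vector.
\<close>

lemma module_map_unique:
  assumes X: "chain_rep r \<kappa> \<nu> \<phi> x y X" and Y: "chain_rep r \<kappa> \<nu>' \<phi>' x' y' Y"
    and E: "\<And>j. j \<in> {1..r} \<Longrightarrow> A ** Eop (tensor_rep X Y) j = Eop (tensor_rep Y X) j ** A"
           "\<And>j. j \<in> {1..r} \<Longrightarrow> B ** Eop (tensor_rep X Y) j = Eop (tensor_rep Y X) j ** B"
    and F: "\<And>j. j \<in> {1..r} \<Longrightarrow> A ** Fop (tensor_rep X Y) j = Fop (tensor_rep Y X) j ** A"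
           "\<And>j. j \<in> {1..r} \<Longrightarrow> B ** Fop (tensor_rep X Y) j = Fop (tensor_rep Y X) j ** B"
    and init: "A *v axis (chain_rep.p \<phi> 1, chain_rep.p \<phi>' (r + 1)) 1 = B *v axis (chain_rep.p \<phi> 1, chain_rep.p \<phi>' (r + 1)) 1"
  shows "A = B"
proof -
  interpret X: chain_rep r \<kappa> \<nu> \<phi> x y X by (rule X)
  interpret Y: chain_rep r \<kappa> \<nu>' \<phi>' x' y' Y by (rule Y)
  have E': "ct (Eop (tensor_rep X Y) j) (ct A G) k = ct (Eop (tensor_rep X Y) j) (ct B G) k"
    if "\<And>G. ct A G k = ct B G k" "j \<in> {1..r}" for j G k
    using that by (simp add: ct_mult[symmetric] E) (simp add: ct_mult)
  have F': "ct (Fop (tensor_rep X Y) j) (ct A G) k = ct (Fop (tensor_rep X Y) j) (ct B G) k"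
    if "\<And>G. ct A G k = ct B G k" "j \<in> {1..r}" for j G k
    using that by (simp add: ct_mult[symmetric] F) (simp add: ct_mult)
  have low: "m \<le> r \<Longrightarrow> ct A G (X.p (Suc m), Y.p (r + 1)) = ct B G (X.p (Suc m), Y.p (r + 1))" for m G
  proof (induction m arbitrary: G)
    case 0 show ?case using ct_eqI_column[OF init] by simp
  next
    case (Suc m)
    hence i: "Suc m \<in> {1..r}" by simp
    obtain i' where i': "i' \<in> {1..r}" "\<nu> (Suc m) = \<nu>' i'" using Y.nu_surj X.nu_in[OF i] by blast
    have "ct (Fop (tensor_rep X Y) (\<nu> (Suc m))) G (X.p (Suc m), Y.p (r + 1)) = y (Suc m) * G (X.p (Suc (Suc m)), Y.p (r + 1))" for G
      unfolding ct_tensor_F X.ct_F[OF i] X.ct_Kinv[OF i] unfolding i'(2) Y.ct_F[OF i'(1)]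
      using i i' by simp
    hence "y (Suc m) * ct A G (X.p (Suc (Suc m)), Y.p (r + 1)) = y (Suc m) * ct B G (X.p (Suc (Suc m)), Y.p (r + 1))"
      using F'[OF Suc.IH X.nu_in[OF i], of G] Suc.prems by simp
    moreover have "y (Suc m) \<noteq> 0" using X.xy[OF i] by auto
    ultimately show ?case by simp
  qed
  have all: "m \<le> r \<Longrightarrow> ct A G (a, Y.p (r + 1 - m)) = ct B G (a, Y.p (r + 1 - m))" for m G a
  proof (induction m arbitrary: G a)
    case 0 
    obtain n where "\<phi> a = Suc n" "n \<le> r" using X.phi_in[of a] by (cases "\<phi> a") auto
    thus ?case using low[of n G] X.p_phi[of a] by simp
  next
    case (Suc m)
    define i' where "i' = r - m"
    have i': "i' \<in> {1..r}" "r + 1 - m = Suc i'" "r + 1 - Suc m = i'" using Suc.prems by (auto simp: i'_def)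
    obtain i where i: "i \<in> {1..r}" "\<nu>' i' = \<nu> i" using X.nu_surj Y.nu_in[OF i'(1)] by blast
    have IH: "ct A G (a, Y.p (Suc i')) = ct B G (a, Y.p (Suc i'))" for G a
      using Suc by (simp only: i'(2))
    have "ct (Eop (tensor_rep X Y) (\<nu>' i')) G (a, Y.p (Suc i')) =
        (if \<phi> a = Suc i then x i * (kw \<kappa> i' (Suc i') * G (X.p i, Y.p (Suc i'))) else 0) + x' i' * G (a, Y.p i')" for G
      unfolding ct_tensor_E Y.ct_E[OF i'(1)] Y.ct_K[OF i'(1)] unfolding i(2) X.ct_E[OF i(1)]
      using i i'(1) by simp
    hence "x' i' * ct A G (a, Y.p i') = x' i' * ct B G (a, Y.p i')"
      using E'[where k = "(a, Y.p (Suc i'))" and G = G, OF IH Y.nu_in[OF i'(1)]] IH[of G "X.p i"] by (simp split: if_splits)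
    moreover have "x' i' \<noteq> 0" using Y.xy[OF i'(1)] by auto
    ultimately show ?case by (simp only: i'(3)) simp
  qed
  show ?thesis
  proof (rule ct_ext)
    fix G and k :: "'a \<times> 'b"
    obtain a b where k: "k = (a, b)" by fastforce
    have "r + 1 - (r + 1 - \<phi>' b) = \<phi>' b" "r + 1 - \<phi>' b \<le> r" using Y.phi_in[of b] by auto
    thus "ct A G k = ct B G k" using all[of "r + 1 - \<phi>' b" G a] by (simp add: k)
  qed
qed

locale chain_basis = chain_rep r \<kappa> \<nu> \<phi> x y X + numbered_basis \<phi> "Suc r" \<kappa> \<theta>
  for r \<kappa> \<nu> \<phi> x y X \<theta>
begin

lemma p_cases: "i \<in> {1..r} \<Longrightarrow> a = p i \<or> a = p (Suc i) \<or> (\<phi> a \<noteq> i \<and> \<phi> a \<noteq> Suc i)"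
  by (metis p_phi)

lemma Qm_K: "i \<in> {1..r} \<Longrightarrow> Qm ** Kop (tensor_rep X X) (\<nu> i) = Kop (tensor_rep X X) (\<nu> i) ** Qm"
  by (rule ct_ext) (auto simp: ct_mult ct_tensor_K ct_K ct_Qm split_paired_all algebra_simps)

lemma Qm_E: "i \<in> {1..r} \<Longrightarrow> Qm ** Eop (tensor_rep X X) (\<nu> i) = Eop (tensor_rep X X) (\<nu> i) ** Qm"
proof (rule ct_ext, simp only: split_paired_all)
  fix G a b assume i: "i \<in> {1..r}"
  have i': "\<phi> (p i) = i" "\<phi> (p (Suc i)) = Suc i" using i by auto
  hence ne: "p i \<noteq> p (Suc i)" "p (Suc i) \<noteq> p i" by auto
  show "ct (Qm ** Eop (tensor_rep X X) (\<nu> i)) G (a, b) = ct (Eop (tensor_rep X X) (\<nu> i) ** Qm) G (a, b)"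
    using p_cases[OF i, of a] p_cases[OF i, of b] kap
    by (elim disjE; cases "\<phi> a < \<phi> b"; cases "\<phi> b < \<phi> a")
       (auto simp: ct_mult ct_tensor_E ct_E[OF i] ct_K[OF i] ct_Qm i' ne kw_def h_def field_simps)
qed

lemma Qm_F: "i \<in> {1..r} \<Longrightarrow> Qm ** Fop (tensor_rep X X) (\<nu> i) = Fop (tensor_rep X X) (\<nu> i) ** Qm"
proof (rule ct_ext, simp only: split_paired_all)
  fix G a b assume i: "i \<in> {1..r}"
  have i': "\<phi> (p i) = i" "\<phi> (p (Suc i)) = Suc i" using i by auto
  hence ne: "p i \<noteq> p (Suc i)" "p (Suc i) \<noteq> p i" by auto
  show "ct (Qm ** Fop (tensor_rep X X) (\<nu> i)) G (a, b) = ct (Fop (tensor_rep X X) (\<nu> i) ** Qm) G (a, b)"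
    using p_cases[OF i, of a] p_cases[OF i, of b] kap
    by (elim disjE; cases "\<phi> a < \<phi> b"; cases "\<phi> b < \<phi> a")
       (auto simp: ct_mult ct_tensor_F ct_F[OF i] ct_Kinv[OF i] ct_Qm i' ne kw_def h_def field_simps)
qed

end

locale chain_rep_q = chain_rep r "complex_of_real q" \<nu> \<phi> x y X
  for r :: nat and q :: real and \<nu> :: "nat \<Rightarrow> nat" and \<phi> :: "'n::finite \<Rightarrow> nat"
    and x y :: "nat \<Rightarrow> complex" and X :: "'n uq_rep" +
  assumes q: "0 < q" "q < 1"
begin

sublocale chain_basis r "complex_of_real q" \<nu> \<phi> x y X "cpow q (- (1 / (real r + 1)))"
  using phi_bij q by unfold_locales (auto simp: cpow_nz)

abbreviation "\<theta> \<equiv> cpow q (- (1 / (real r + 1)))"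
abbreviation "\<kappa> \<equiv> complex_of_real q"

lemma dual: "chain_rep_q r q (\<lambda>i. \<nu> (r + 1 - i)) (\<lambda>a. r + 2 - \<phi> a) (\<lambda>i. - (\<kappa> * x (r + 1 - i)))
    (\<lambda>i. - (y (r + 1 - i) / \<kappa>)) (dual_rep X)"
  using dual_chain_ops q r1 by unfold_locales auto

lemma kw_cpow: "kw \<kappa> i n = cpow q (of_bool (n = i) - of_bool (n = Suc i))"
  using q by (auto simp: kw_def cpow_1 cpow_minus cpow_0)

lemma nu1: "1 \<in> {1..r}" "\<nu> 1 \<in> {1..r}" "\<nu> r = r + 1 - \<nu> 1" "r \<in> {1..r}" "\<nu> r \<in> {1..r}"
  using nu_in[of 1] nu_rev[of 1] nu_in[of r] r1 by auto

lemma wform_nu: "i \<in> {1..r} \<Longrightarrow> wform r (sroot (\<nu> i)) (fweight r (\<nu> 1)) = of_bool (i = 1)"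
  "i \<in> {1..r} \<Longrightarrow> wform r (sroot (\<nu> i)) (fweight r (\<nu> r)) = of_bool (i = r)"
  using wform_sroot_fweight[OF nu_in nu1(2)] wform_sroot_fweight[OF nu_in nu1(5)] nu_inj[OF _ nu1(1)] nu_inj[OF _ nu1(4)]
  by auto

lemma highest_weight_vector_chain:
  assumes "highest_weight_vector r q X l v"
  shows "l = fweight r (\<nu> 1)" "v = (v $ p 1) *s axis (p 1) 1"
proof -
  have v0: "v $ a = 0" if "a \<noteq> p 1" for a
  proof -
    have a: "\<phi> a \<noteq> 1" using that p_phi[of a] by metis
    define i where "i = \<phi> a - 1"
    have i: "i \<in> {1..r}" "\<phi> a = Suc i" using phi_in[of a] a by (auto simp: i_def)
    have "(Eop X (\<nu> i) *v v) $ p i = 0"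
      using assms nu_in[OF i(1)] by (auto simp: highest_weight_vector_def)
    moreover have "(Eop X (\<nu> i) *v v) $ p i = (\<Sum>b\<in>UNIV. if b = a then x i * v $ b else 0)"
      using i phi_eq[of _ a] by (auto simp: Eop_eq matrix_vector_mult_def if_distrib[of "\<lambda>x. x * _"] cong: if_cong)
    moreover have "x i \<noteq> 0" using xy[OF i(1)] by auto
    ultimately show ?thesis by simp
  qed
  show v: "v = (v $ p 1) *s axis (p 1) 1"
    by (auto simp: vec_eq_iff axis_def v0)
  have wv: "v \<noteq> 0" "l \<in> weight_lattice r" "\<And>i. i \<in> {1..r} \<Longrightarrow> Kop X i *v v = cpow q (wform r (sroot i) l) *s v"
    using assms by (auto simp: highest_weight_vector_def weight_vector_def)
  have nz: "v $ p 1 \<noteq> 0" using v wv(1) by (metis vec.scale_zero_left)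
  show "l = fweight r (\<nu> 1)"
  proof (rule weight_lattice_eqI[OF wv(2)])
    show "fweight r (\<nu> 1) \<in> weight_lattice r" by (rule fweight_lattice[OF nu1(2)])
    fix j assume "j \<in> {1..r}"
    then obtain i where i: "i \<in> {1..r}" "j = \<nu> i" using nu_surj by blast
    have "(Kop X (\<nu> i) *v v) $ p 1 = kw \<kappa> i 1 * v $ p 1"
      by (simp add: Kop_eq[OF i(1)] matrix_vector_mult_def if_distrib[of "\<lambda>x. x * _"] cong: if_cong)
    hence "kw \<kappa> i 1 = cpow q (wform r (sroot j) l)"
      using wv(3)[OF nu_in[OF i(1)]] nz i by simp
    hence "wform r (sroot (\<nu> i)) l = of_bool (i = 1)" using i q by (auto simp: kw_cpow cpow_inj)
    thus "wform r (sroot j) l = wform r (sroot j) (fweight r (\<nu> 1))"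
      unfolding i(2) wform_nu(1)[OF i(1)] by simp
  qed
qed

lemma lowest_weight_vector_chain:
  assumes "lowest_weight_vector r q X l v"
  shows "v = (v $ p (r + 1)) *s axis (p (r + 1)) 1"
proof -
  have v0: "v $ a = 0" if "a \<noteq> p (r + 1)" for a
  proof -
    define i where "i = \<phi> a"
    have "\<phi> a \<noteq> r + 1" using that p_phi[of a] by metis
    hence i: "i \<in> {1..r}" "\<phi> a = i" using phi_in[of a] by (auto simp: i_def)
    have "(Fop X (\<nu> i) *v v) $ p (Suc i) = 0"
      using assms nu_in[OF i(1)] by (auto simp: lowest_weight_vector_def)
    moreover have "(Fop X (\<nu> i) *v v) $ p (Suc i) = (\<Sum>b\<in>UNIV. if b = a then y i * v $ b else 0)"
      using i phi_eq[of _ a] by (auto simp: Fop_eq matrix_vector_mult_def if_distrib[of "\<lambda>x. x * _"] cong: if_cong)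
    moreover have "y i \<noteq> 0" using xy[OF i(1)] by auto
    ultimately show ?thesis by simp
  qed
  show "v = (v $ p (r + 1)) *s axis (p (r + 1)) 1"
    by (auto simp: vec_eq_iff axis_def v0)
qed

lemma chain_K_axis: "i \<in> {1..r} \<Longrightarrow> Kop X (\<nu> i) *v axis a 1 = kw \<kappa> i (\<phi> a) *s axis a 1"
  by (simp add: Kop_eq vec_eq_iff mult_axis, simp add: axis_def)

lemma highest_weight_vector_axis: "highest_weight_vector r q X (fweight r (\<nu> 1)) (axis (p 1) 1)"
proof -
  have "Kop X j *v axis (p 1) 1 = cpow q (wform r (sroot j) (fweight r (\<nu> 1))) *s axis (p 1) 1 \<and> Eop X j *v axis (p 1) 1 = 0"
    if j: "j \<in> {1..r}" for j
  proof -
    obtain i where i: "i \<in> {1..r}" "j = \<nu> i" using nu_surj[OF j] by blast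
    have "Eop X (\<nu> i) *v axis (p 1) 1 = 0"
      using i by (simp add: Eop_eq vec_eq_iff mult_axis)
    moreover have "kw \<kappa> i 1 = cpow q (wform r (sroot j) (fweight r (\<nu> 1)))"
      unfolding i(2) wform_nu(1)[OF i(1)] using i(1) by (auto simp: kw_cpow)
    ultimately show ?thesis using i by (simp add: chain_K_axis)
  qed
  thus ?thesis using fweight_lattice[OF nu1(2)]
    by (auto simp: highest_weight_vector_def weight_vector_def)
qed

lemma lowest_weight_vector_axis: "lowest_weight_vector r q X (w0 r (fweight r (\<nu> 1))) (axis (p (r + 1)) 1)"
proof -
  have w0: "w0 r (fweight r (\<nu> 1)) = (\<lambda>k. - fweight r (\<nu> r) k)" using w0_fweight[OF nu1(2)] nu1(3) by simp
  have "Kop X j *v axis (p (r + 1)) 1 = cpow q (wform r (sroot j) (\<lambda>k. - fweight r (\<nu> r) k)) *s axis (p (r + 1)) 1 \<and> Fop X j *v axis (p (r + 1)) 1 = 0"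
    if j: "j \<in> {1..r}" for j
  proof -
    obtain i where i: "i \<in> {1..r}" "j = \<nu> i" using nu_surj[OF j] by blast
    have "Fop X (\<nu> i) *v axis (p (r + 1)) 1 = 0"
      using i by (simp add: Fop_eq vec_eq_iff mult_axis)
    moreover have "wform r (sroot j) (\<lambda>k. - fweight r (\<nu> r) k) = - wform r (sroot j) (fweight r (\<nu> r))"
      by (simp add: wform_def sum_negf)
    moreover have "kw \<kappa> i (r + 1) = cpow q (- wform r (sroot j) (fweight r (\<nu> r)))"
      unfolding i(2) wform_nu(2)[OF i(1)] using i(1) by (auto simp: kw_cpow)
    ultimately show ?thesis using i by (simp add: chain_K_axis)
  qed
  thus ?thesis using fweight_minus_lattice[OF nu1(5)]
    unfolding lowest_weight_vector_def weight_vector_def w0 by auto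
qed

end

lemma tensv_axis: "tensv (c *s axis a 1) (d *s axis b 1) = (c * d) *s axis (a, b) 1"
  by (auto simp: tensv_def vec_eq_iff axis_def)

text \<open>
  Highest and lowest weight vectors of chain modules are multiples of the two ends of the chain, so the
  normalization of the braiding is a condition on one basis vector; uniqueness is
  \<open>module_map_unique\<close>.
\<close>

lemma braiding_eqI:
  assumes X: "chain_rep_q r q \<nu> \<phi> x y X" and Y: "chain_rep_q r q \<nu>' \<phi>' x' y' Y"
    and K: "\<And>j. j \<in> {1..r} \<Longrightarrow> R ** Kop (tensor_rep X Y) j = Kop (tensor_rep Y X) j ** R"
    and E: "\<And>j. j \<in> {1..r} \<Longrightarrow> R ** Eop (tensor_rep X Y) j = Eop (tensor_rep Y X) j ** R"
    and F: "\<And>j. j \<in> {1..r} \<Longrightarrow> R ** Fop (tensor_rep X Y) j = Fop (tensor_rep Y X) j ** R"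
    and ax: "R *v axis (chain_rep.p \<phi> 1, chain_rep.p \<phi>' (r + 1)) 1 =
       cpow q (wform r (fweight r (\<nu> 1)) (w0 r (fweight r (\<nu>' 1)))) *s axis (chain_rep.p \<phi>' (r + 1), chain_rep.p \<phi> 1) 1"
  shows "braiding r q X Y = R"
proof -
  interpret X: chain_rep_q r q \<nu> \<phi> x y X by (rule X)
  interpret Y: chain_rep_q r q \<nu>' \<phi>' x' y' Y by (rule Y)
  let ?c = "cpow q (wform r (fweight r (\<nu> 1)) (w0 r (fweight r (\<nu>' 1))))"
  have "is_braiding r q X Y R"
    unfolding is_braiding_def
  proof (intro conjI ballI allI impI; (elim conjE)?)
    fix l m v z u
    assume "highest_weight_vector r q X l v" "highest_weight_vector r q Y m z" "lowest_weight_vector r q Y (w0 r m) u"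
    hence v: "l = fweight r (\<nu> 1)" "v = (v $ X.p 1) *s axis (X.p 1) 1" "m = fweight r (\<nu>' 1)"
       "u = (u $ Y.p (r + 1)) *s axis (Y.p (r + 1)) 1"
      using X.highest_weight_vector_chain Y.highest_weight_vector_chain Y.lowest_weight_vector_chain by blast+
    have "R *v tensv v u = (v $ X.p 1 * u $ Y.p (r + 1)) *s (R *v axis (X.p 1, Y.p (r + 1)) 1)"
      by (subst v(2), subst v(4), simp only: tensv_axis vec.scale)
    also have "\<dots> = ?c *s ((u $ Y.p (r + 1) * v $ X.p 1) *s axis (Y.p (r + 1), X.p 1) 1)"
      by (simp only: ax) (simp add: vec_eq_iff mult_ac)
    also have "(u $ Y.p (r + 1) * v $ X.p 1) *s axis (Y.p (r + 1), X.p 1) 1 = tensv u v"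
      by (subst (2) v(2), subst (2) v(4), simp only: tensv_axis)
    finally show "R *v tensv v u = cpow q (wform r l (w0 r m)) *s tensv u v" by (simp only: v(1,3))
  qed (use K E F in auto)
  moreover have "R' = R" if R': "is_braiding r q X Y R'" for R'
  proof (rule module_map_unique[OF X.chain_rep_axioms Y.chain_rep_axioms])
    have "R' *v tensv (axis (X.p 1) 1) (axis (Y.p (r + 1)) 1) = ?c *s tensv (axis (Y.p (r + 1)) 1) (axis (X.p 1) 1)"
      using R' X.highest_weight_vector_axis Y.highest_weight_vector_axis Y.lowest_weight_vector_axis
      unfolding is_braiding_def by blast
    moreover have "tensv (axis (X.p 1) 1) (axis (Y.p (r + 1)) 1) = axis (X.p 1, Y.p (r + 1)) 1"
       "tensv (axis (Y.p (r + 1)) 1) (axis (X.p 1) 1) = axis (Y.p (r + 1), X.p 1) 1"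
      using tensv_axis[of 1 "X.p 1" 1 "Y.p (r + 1)"] tensv_axis[of 1 "Y.p (r + 1)" 1 "X.p 1"] by simp_all
    ultimately show "R' *v axis (X.p 1, Y.p (r + 1)) 1 = R *v axis (X.p 1, Y.p (r + 1)) 1"
      by (simp only: ax)
  qed (use R' E F in \<open>auto simp: is_braiding_def\<close>)
  ultimately show ?thesis unfolding braiding_def by (intro the_equality)
qed

context chain_basis
begin

lemma sum_if_phi: "n \<in> {1..r+1} \<Longrightarrow> (\<Sum>k\<in>{k. \<phi> k < m}. if \<phi> k = n then f k else 0) = (if n < m then f (p n) else (0::complex))"
proof -
  assume n: "n \<in> {1..r+1}"
  hence "(\<Sum>k\<in>{k. \<phi> k < m}. if \<phi> k = n then f k else 0) = (\<Sum>k\<in>{k. \<phi> k < m}. if k = p n then f (p n) else 0)"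
    by (intro sum.cong) auto
  thus ?thesis using n by simp
qed

lemma sum_phi_Suc: "i \<in> {1..r+1} \<Longrightarrow> (\<Sum>k\<in>{k. \<phi> k < Suc i}. f k) = f (p i) + (\<Sum>k\<in>{k. \<phi> k < i}. f k :: complex)"
proof -
  assume i: "i \<in> {1..r+1}"
  hence "{k. \<phi> k < Suc i} = insert (p i) {k. \<phi> k < i}" "p i \<notin> {k. \<phi> k < i}"
    by (auto simp: less_Suc_eq)
  thus ?thesis by simp
qed

lemma ct_dual_Kinv: "i \<in> {1..r} \<Longrightarrow> ct (matrix_inv (Kop (dual_rep X) (\<nu> i))) F b = kw \<kappa> i (\<phi> b) * F b"
proof -
  assume i: "i \<in> {1..r}"
  have "Kop (dual_rep X) (\<nu> i) ** (\<chi> a b. if a = b then kw \<kappa> i (\<phi> a) else 0) = mat 1"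
    by (rule ct_ext) (simp add: ct_mult ct_diag ct_dual_K[OF i])
  thus ?thesis by (simp add: matrix_inv_eqI(1) ct_diag)
qed

abbreviation "EXd i \<equiv> Eop (tensor_rep X (dual_rep X)) (\<nu> i)"
abbreviation "FXd i \<equiv> Fop (tensor_rep X (dual_rep X)) (\<nu> i)"

lemma ct_EXd: "i \<in> {1..r} \<Longrightarrow> ct (EXd i) G (a, b) =
    (if \<phi> a = Suc i then x i * (G (p i, b) / kw \<kappa> i (\<phi> b)) else 0) + (if \<phi> b = i then - (\<kappa> * x i) * G (a, p (Suc i)) else 0)"
  by (simp add: ct_tensor_E ct_E ct_dual_K ct_dual_E)

lemma ct_FXd: "i \<in> {1..r} \<Longrightarrow> ct (FXd i) G (a, b) =
    (if \<phi> a = i then y i * G (p (Suc i), b) else 0) + (if \<phi> b = Suc i then - (y i / \<kappa>) * G (a, p i) else 0) / kw \<kappa> i (\<phi> a)"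
  by (simp add: ct_tensor_F ct_F ct_Kinv ct_dual_F)

text \<open>
  \<open>Rim\<close> contains the partial sums of the diagonal tensors \<open>v\<^sub>k \<otimes> f\<^sup>k\<close>. The full sum is invariant; on a
  partial sum the raising and lowering operators leave only the boundary term.
\<close>

lemma sum_EXd:
  assumes i: "i \<in> {1..r}"
  shows "(\<Sum>k\<in>{k. \<phi> k < m}. ct (EXd i) G (k, k)) = - (if m = Suc i then \<kappa> * x i * G (p i, p (Suc i)) else 0)"
proof -
  have "(\<Sum>k\<in>{k. \<phi> k < m}. ct (EXd i) G (k, k)) = (\<Sum>k\<in>{k. \<phi> k < m}. if \<phi> k = Suc i then x i * (G (p i, k) / kw \<kappa> i (\<phi> k)) else 0)
     + (\<Sum>k\<in>{k. \<phi> k < m}. if \<phi> k = i then - (\<kappa> * x i) * G (k, p (Suc i)) else 0)"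
    by (simp only: ct_EXd[OF i] sum.distrib)
  also have "\<dots> = (if Suc i < m then \<kappa> * x i * G (p i, p (Suc i)) else 0) - (if i < m then \<kappa> * x i * G (p i, p (Suc i)) else 0)"
    using i by (subst (1 2) sum_if_phi) (auto simp: kw_def)
  finally show ?thesis by auto
qed

lemma sum_FXd:
  assumes i: "i \<in> {1..r}"
  shows "(\<Sum>k\<in>{k. \<phi> k < m}. ct (FXd i) G (k, k)) = (if m = Suc i then y i * G (p (Suc i), p i) else 0)"
proof -
  have "(\<Sum>k\<in>{k. \<phi> k < m}. ct (FXd i) G (k, k)) = (\<Sum>k\<in>{k. \<phi> k < m}. if \<phi> k = i then y i * G (p (Suc i), k) else 0)
     + (\<Sum>k\<in>{k. \<phi> k < m}. if \<phi> k = Suc i then - (y i / \<kappa>) * G (k, p i) / kw \<kappa> i (\<phi> k) else 0)"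
    unfolding ct_FXd[OF i] sum.distrib[symmetric] by (intro sum.cong) auto
  also have "\<dots> = (if i < m then y i * G (p (Suc i), p i) else 0) - (if Suc i < m then y i * G (p (Suc i), p i) else 0)"
    using i kap by (subst (1 2) sum_if_phi) (auto simp: kw_def)
  finally show ?thesis by auto
qed

lemma Rim_K: "i \<in> {1..r} \<Longrightarrow> Rim ** Kop (tensor_rep (dual_rep X) X) (\<nu> i) = Kop (tensor_rep X (dual_rep X)) (\<nu> i) ** Rim"
  by (rule ct_ext) (auto simp: ct_mult ct_tensor_K ct_K ct_dual_K ct_Rim split_paired_all field_simps)

lemma Rim_E: "i \<in> {1..r} \<Longrightarrow> Rim ** Eop (tensor_rep (dual_rep X) X) (\<nu> i) = Eop (tensor_rep X (dual_rep X)) (\<nu> i) ** Rim"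
proof (rule ct_ext, simp only: split_paired_all)
  fix G a b assume i: "i \<in> {1..r}"
  have i': "\<phi> (p i) = i" "\<phi> (p (Suc i)) = Suc i" using i by auto
  hence ne: "p i \<noteq> p (Suc i)" "p (Suc i) \<noteq> p i" by auto
  have i1: "i \<in> {1..r+1}" using i by simp
  have rhs: "ct Rim (ct (EXd i) G) (a, b) = \<theta> * (if a = b then \<kappa> * ct (EXd i) G (a, a) + h * - (if \<phi> a = Suc i then \<kappa> * x i * G (p i, p (Suc i)) else 0)
      else ct (EXd i) G (b, a))"
    by (simp only: ct_Rim sum_EXd[OF i])
  show "ct (Rim ** Eop (tensor_rep (dual_rep X) X) (\<nu> i)) G (a, b) = ct (Eop (tensor_rep X (dual_rep X)) (\<nu> i) ** Rim) G (a, b)"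
    unfolding ct_mult rhs
    using p_cases[OF i, of a] p_cases[OF i, of b] kap
    by (elim disjE; cases "a = b")
       (auto simp: ct_tensor_E[of "dual_rep X" X] ct_E[OF i] ct_K[OF i] ct_dual_E[OF i] ct_Rim i' ne
         sum_phi_Suc[OF i1] ct_EXd[OF i] kw_def h_def field_simps)
qed

lemma Rim_F: "i \<in> {1..r} \<Longrightarrow> Rim ** Fop (tensor_rep (dual_rep X) X) (\<nu> i) = Fop (tensor_rep X (dual_rep X)) (\<nu> i) ** Rim"
proof (rule ct_ext, simp only: split_paired_all)
  fix G a b assume i: "i \<in> {1..r}"
  have i': "\<phi> (p i) = i" "\<phi> (p (Suc i)) = Suc i" using i by auto
  hence ne: "p i \<noteq> p (Suc i)" "p (Suc i) \<noteq> p i" by auto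
  have i1: "i \<in> {1..r+1}" using i by simp
  have rhs: "ct Rim (ct (FXd i) G) (a, b) = \<theta> * (if a = b then \<kappa> * ct (FXd i) G (a, a) + h * (if \<phi> a = Suc i then y i * G (p (Suc i), p i) else 0)
      else ct (FXd i) G (b, a))"
    by (simp only: ct_Rim sum_FXd[OF i])
  show "ct (Rim ** Fop (tensor_rep (dual_rep X) X) (\<nu> i)) G (a, b) = ct (Fop (tensor_rep X (dual_rep X)) (\<nu> i) ** Rim) G (a, b)"
    unfolding ct_mult rhs
    using p_cases[OF i, of a] p_cases[OF i, of b] kap
    by (elim disjE; cases "a = b")
       (auto simp: ct_tensor_F[of "dual_rep X" X] ct_F[OF i] ct_dual_Kinv[OF i] ct_dual_F[OF i] ct_Rim i' ne
         sum_phi_Suc[OF i1] ct_FXd[OF i] kw_def h_def field_simps)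
qed

lemma Rm_intertwines:
  assumes "Rim ** A = B ** Rim"
  shows "Rm ** B = A ** Rm"
proof -
  have "Rm ** B = Rm ** (B ** Rim) ** Rm" by (simp only: matrix_mul_assoc[symmetric] Rim_Rm matrix_mul_rid)
  also have "\<dots> = (Rm ** Rim) ** A ** Rm" by (simp only: assms[symmetric] matrix_mul_assoc)
  finally show ?thesis by (simp only: Rm_Rim matrix_mul_lid)
qed

end

context chain_rep_q
begin

lemma wform_neg: "wform r l (\<lambda>k. - m k) = - wform r l m"
  by (simp add: wform_def sum_negf)

lemma nu1_cases: "\<nu> 1 = 1 \<or> \<nu> 1 = r"
  using nu_cases nu1(1) by fastforce

lemma braiding_VV: "braiding r q X X = Qm"
proof (rule braiding_eqI[OF chain_rep_q_axioms chain_rep_q_axioms])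
  have "wform r (fweight r (\<nu> 1)) (fweight r (r + 1 - \<nu> 1)) = 1 / (real r + 1)"
    using nu1_cases wform_fweight[of 1 r r] wform_commute[of r "fweight r 1" "fweight r r"] r1 by auto
  hence "wform r (fweight r (\<nu> 1)) (w0 r (fweight r (\<nu> 1))) = - (1 / (real r + 1))"
    unfolding w0_fweight[OF nu1(2)] wform_neg by simp
  moreover have "p 1 \<noteq> p (r + 1)" using r1 p_eq[of 1 "p (r + 1)"] by simp
  ultimately show "Qm *v axis (p 1, p (r + 1)) 1 = cpow q (wform r (fweight r (\<nu> 1)) (w0 r (fweight r (\<nu> 1)))) *s axis (p (r + 1), p 1) 1"
    by (simp add: vec_eq_iff mult_axis Qm_def hecke_mat_def) (simp add: axis_def)
qed (use nu_surj Qm_K Qm_E Qm_F in metis)+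

text \<open>
  The dual of a chain module is a chain module numbered in the opposite direction, and reversing the
  order exchanges \<open>Qm\<close> and \<open>Um\<close>.
\<close>

lemma braiding_dual_dual: "braiding r q (dual_rep X) (dual_rep X) = Um"
proof -
  interpret d: chain_rep_q r q "\<lambda>i. \<nu> (r + 1 - i)" "\<lambda>a. r + 2 - \<phi> a" "\<lambda>i. - (\<kappa> * x (r + 1 - i))"
    "\<lambda>i. - (y (r + 1 - i) / \<kappa>)" "dual_rep X" by (rule dual)
  have "(r + 2 - \<phi> j < r + 2 - \<phi> i) = (\<phi> i < \<phi> j)" for i j
    using phi_in[of i] phi_in[of j] by auto
  thus ?thesis by (simp only: d.braiding_VV d.Qm_def Um_def)
qed

lemma braiding_V_dual: "braiding r q X (dual_rep X) = Rm"
proof (rule braiding_eqI[OF chain_rep_q_axioms dual])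
  interpret d: chain_rep_q r q "\<lambda>i. \<nu> (r + 1 - i)" "\<lambda>a. r + 2 - \<phi> a" "\<lambda>i. - (\<kappa> * x (r + 1 - i))"
    "\<lambda>i. - (y (r + 1 - i) / \<kappa>)" "dual_rep X" by (rule dual)
  have pd: "chain_rep.p (\<lambda>a. r + 2 - \<phi> a) (r + 1) = p 1"
    using d.p_phi[of "p 1"] r1 by simp
  have "wform r (fweight r (\<nu> 1)) (fweight r (\<nu> 1)) = real r / (real r + 1)"
    using nu1_cases wform_fweight[of 1 1 r] wform_fweight[of r r r] r1 by auto
  moreover have "w0 r (fweight r (\<nu> (r + 1 - 1))) = (\<lambda>k. - fweight r (\<nu> 1) k)"
    using w0_fweight[OF nu1(5)] nu1 by simp
  ultimately have "wform r (fweight r (\<nu> 1)) (w0 r (fweight r (\<nu> (r + 1 - 1)))) = - real r / (real r + 1)"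
    by (simp only: wform_neg)
  also have "\<dots> = - 1 - - (1 / (real r + 1))" by (simp add: field_simps)
  finally have "cpow q (wform r (fweight r (\<nu> 1)) (w0 r (fweight r (\<nu> (r + 1 - 1))))) = 1 / \<kappa> / \<theta>"
    using q by (simp only: cpow_diff cpow_minus cpow_1)
  moreover have z: "(\<phi> a = 0) = False" for a using phi_in[of a] by simp
  have "(Rm *v axis (p 1, p 1) 1) = (1 / \<kappa> / \<theta>) *s axis (p 1, p 1) 1"
    unfolding vec_eq_iff mult_axis Rm_def by (simp add: axis_def z)
  ultimately show "Rm *v axis (p 1, chain_rep.p (\<lambda>a. r + 2 - \<phi> a) (r + 1)) 1 =
     cpow q (wform r (fweight r (\<nu> 1)) (w0 r (fweight r (\<nu> (r + 1 - 1))))) *s axis (chain_rep.p (\<lambda>a. r + 2 - \<phi> a) (r + 1), p 1) 1"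
    by (simp only: pd)
qed (use nu_surj Rm_intertwines[OF Rim_K] Rm_intertwines[OF Rim_E] Rm_intertwines[OF Rim_F] in metis)+

end

section \<open>The structure of the fundamental module\<close>

lemma invertible_matrix_inv:
  fixes A :: "complex^'n^'n"
  assumes "invertible A"
  shows "A ** matrix_inv A = mat 1" "matrix_inv A ** A = mat 1"
  using assms someI_ex[of "\<lambda>A'. A ** A' = mat 1 \<and> A' ** A = mat 1"]
  unfolding invertible_def matrix_inv_def by auto

lemma mat_vec: "mat c *v z = c *s (z :: complex^'n)"
  by (auto simp: vec_eq_iff matrix_vector_mult_def mat_def if_distrib[of "\<lambda>x. x * _"] cong: if_cong)

lemma mat_mult_vec: "(mat c ** A) *v w = c *s (A *v (w :: complex^'n))"
  by (simp add: matrix_vector_mul_assoc[symmetric] mat_vec)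

lemma conjugation_vec:
  fixes K A :: "complex^'n^'n"
  assumes "invertible K" "K ** A ** matrix_inv K = mat c ** A"
  shows "K *v (A *v w) = c *s (A *v (K *v w))"
proof -
  have "K *v (A *v w) = (K ** A ** matrix_inv K) *v (K *v w)"
    using invertible_matrix_inv[OF assms(1)] by (simp add: matrix_vector_mul_assoc matrix_mul_assoc[symmetric])
  thus ?thesis unfolding assms(2) mat_mult_vec .
qed

text \<open>
  The pairing of the \<open>i\<close>-th simple root with the weight of the \<open>n\<close>-th vector of a chain.
\<close>

definition wdelta :: "nat \<Rightarrow> nat \<Rightarrow> real" where
  "wdelta n i = of_bool (n = i) - of_bool (n = Suc i)"

lemma wdelta_inj:
  assumes "n \<in> {1..r+1}" "n' \<in> {1..r+1}" "\<And>i. i \<in> {1..r} \<Longrightarrow> wdelta n i = wdelta n' i"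
  shows "n = n'"
proof (rule ccontr)
  assume "n \<noteq> n'"
  hence "n < n' \<and> n \<in> {1..r} \<or> n' < n \<and> n' \<in> {1..r}" using assms by auto
  thus False using assms(3)[of n] assms(3)[of n'] by (auto simp: wdelta_def of_bool_def split: if_splits)
qed

text \<open>
  Applying the lowering operators in turn to the highest weight vector gives \<open>r + 1\<close> nonzero
  vectors of different weights. There is no room for more, so all weights of the module are found,
  each with multiplicity one, and the weights force the shape of the operators.
\<close>

lemma vector_rep_chain:
  fixes V :: "('n::finite) uq_rep"
  assumes r1: "r \<ge> 1" and s: "s \<in> {1, r}" and q: "0 < q" "q < 1" and card: "CARD('n) = r + 1"
    and V: "uq_module r q V" and hw: "highest_weight_vector r q V (fweight r s) v"
    and wb: "weight_basis r q V wt"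
  shows "\<exists>\<nu> \<phi> x y. chain_rep_q r q \<nu> \<phi> x y V \<and> (\<forall>a. wform r (wt a) (two_rho r) = real r + 2 - 2 * real (\<phi> a))"
proof -
  let ?\<kappa> = "complex_of_real q"
  define \<nu> where "\<nu> i = (if s = 1 then i else r + 1 - i)" for i
  have nu_in: "i \<in> {1..r} \<Longrightarrow> \<nu> i \<in> {1..r}" for i by (auto simp: \<nu>_def)
  have nuC: "wform r (sroot (\<nu> i)) (sroot (\<nu> j)) = 2 * of_bool (i = j) - of_bool (i = Suc j) - of_bool (j = Suc i)"
    if "i \<in> {1..r}" "j \<in> {1..r}" for i j
  proof (cases "s = 1")
    case True
    thus ?thesis unfolding wform_sroot_sroot[OF nu_in[OF that(1)]] by (simp add: \<nu>_def)
  next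
    case False
    have e: "(r + 1 - i = r + 1 - j) = (i = j)" "(r + 1 - i = r + 1 - j + 1) = (j = Suc i)"
      "(r + 1 - j = r + 1 - i + 1) = (i = Suc j)"
      using that by auto
    show ?thesis unfolding wform_sroot_sroot[OF nu_in[OF that(1)]]
      using False by (simp only: \<nu>_def if_False e)
  qed
  have nuw: "wform r (sroot (\<nu> i)) (fweight r s) = of_bool (i = 1)" if "i \<in> {1..r}" for i
  proof -
    have "s \<in> {1..r}" using s r1 by auto
    thus ?thesis unfolding wform_sroot_fweight[OF nu_in[OF that] \<open>s \<in> {1..r}\<close>] using that s by (cases "s = 1") (auto simp: \<nu>_def)
  qed
  note rels = V[unfolded uq_module_def]
  have inv: "invertible (Kop V (\<nu> i))" if "i \<in> {1..r}" for i
    by (rule rels[THEN conjunct1, rule_format, OF nu_in[OF that]])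
  have KE: "Kop V (\<nu> i) *v (Eop V (\<nu> j) *v w) =
      cpow q (wform r (sroot (\<nu> i)) (sroot (\<nu> j))) *s (Eop V (\<nu> j) *v (Kop V (\<nu> i) *v w))"
    and KF: "Kop V (\<nu> i) *v (Fop V (\<nu> j) *v w) =
      cpow q (- wform r (sroot (\<nu> i)) (sroot (\<nu> j))) *s (Fop V (\<nu> j) *v (Kop V (\<nu> i) *v w))"
    and EF: "Eop V (\<nu> i) ** Fop V (\<nu> j) - Fop V (\<nu> j) ** Eop V (\<nu> i) =
      (if i = j then mat (1 / (cpow q 1 - cpow q (- 1))) ** (Kop V (\<nu> i) - matrix_inv (Kop V (\<nu> i))) else 0)"
    if "i \<in> {1..r}" "j \<in> {1..r}" for i j w
  proof -
    note R = rels[THEN conjunct2, rule_format, OF nu_in[OF that(1)] nu_in[OF that(2)]]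
    show "Kop V (\<nu> i) *v (Eop V (\<nu> j) *v w) =
      cpow q (wform r (sroot (\<nu> i)) (sroot (\<nu> j))) *s (Eop V (\<nu> j) *v (Kop V (\<nu> i) *v w))"
      by (rule conjugation_vec[OF inv[OF that(1)] R[THEN conjunct2, THEN conjunct1]])
    show "Kop V (\<nu> i) *v (Fop V (\<nu> j) *v w) =
      cpow q (- wform r (sroot (\<nu> i)) (sroot (\<nu> j))) *s (Fop V (\<nu> j) *v (Kop V (\<nu> i) *v w))"
      by (rule conjugation_vec[OF inv[OF that(1)] R[THEN conjunct2, THEN conjunct2, THEN conjunct1]])
    have "\<nu> i = \<nu> j \<longleftrightarrow> i = j" using that by (auto simp: \<nu>_def)
    thus "Eop V (\<nu> i) ** Fop V (\<nu> j) - Fop V (\<nu> j) ** Eop V (\<nu> i) =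
      (if i = j then mat (1 / (cpow q 1 - cpow q (- 1))) ** (Kop V (\<nu> i) - matrix_inv (Kop V (\<nu> i))) else 0)"
      using R[THEN conjunct2, THEN conjunct2, THEN conjunct2, THEN conjunct1] by simp
  qed
  have nzh: "cpow q 1 - cpow q (- 1) \<noteq> 0" using cpow_inj[OF q, of 1 "- 1"] by simp
  \<comment> \<open>the chain of lowered vectors; each is recovered from the next one by a raising operator, so none is zero\<close>
  define u where "u = rec_nat v (\<lambda>k w. Fop V (\<nu> (Suc k)) *v w)"
  have u0: "u 0 = v" and uS: "u (Suc k) = Fop V (\<nu> (Suc k)) *v u k" for k by (simp_all add: u_def)
  have uK: "k \<le> r \<Longrightarrow> i \<in> {1..r} \<Longrightarrow> Kop V (\<nu> i) *v u k = cpow q (wdelta (Suc k) i) *s u k" for k i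
  proof (induction k)
    case 0
    have "Kop V (\<nu> i) *v v = cpow q (wform r (sroot (\<nu> i)) (fweight r s)) *s v"
      using hw nu_in[OF 0(2)] by (simp add: highest_weight_vector_def weight_vector_def)
    thus ?case using 0 by (auto simp: u0 nuw wdelta_def)
  next
    case (Suc k)
    hence j: "Suc k \<in> {1..r}" by simp
    have "Kop V (\<nu> i) *v u (Suc k) = cpow q (- wform r (sroot (\<nu> i)) (sroot (\<nu> (Suc k))) + wdelta (Suc k) i) *s u (Suc k)"
      unfolding uS KF[OF Suc.prems(2) j] using Suc q by (simp add: cpow_add[symmetric] vec.scale)
    also have "- wform r (sroot (\<nu> i)) (sroot (\<nu> (Suc k))) + wdelta (Suc k) i = wdelta (Suc (Suc k)) i"
      unfolding nuC[OF Suc.prems(2) j] by (auto simp: wdelta_def)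
    finally show ?case .
  qed
  have EFv: "Eop V (\<nu> i) *v (Fop V (\<nu> j) *v w) = Fop V (\<nu> j) *v (Eop V (\<nu> i) *v w) +
     (if i = j then (1 / (cpow q 1 - cpow q (- 1))) *s (Kop V (\<nu> i) *v w - matrix_inv (Kop V (\<nu> i)) *v w) else 0)"
    if "i \<in> {1..r}" "j \<in> {1..r}" for i j w
  proof -
    have "(Eop V (\<nu> i) ** Fop V (\<nu> j) - Fop V (\<nu> j) ** Eop V (\<nu> i)) *v w =
      (if i = j then mat (1 / (cpow q 1 - cpow q (- 1))) ** (Kop V (\<nu> i) - matrix_inv (Kop V (\<nu> i))) else 0) *v w"
      by (simp only: EF[OF that])
    thus ?thesis
      by (auto simp: matrix_vector_mult_diff_rdistrib mat_vec matrix_vector_mul_assoc[symmetric] diff_eq_eq add.commute)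
  qed
  have uE0: "k \<le> r \<Longrightarrow> i \<in> {1..r} \<Longrightarrow> k < i \<Longrightarrow> Eop V (\<nu> i) *v u k = 0" for k i
  proof (induction k)
    case 0 thus ?case using hw nu_in[OF 0(2)] by (simp add: u0 highest_weight_vector_def)
  next
    case (Suc k)
    thus ?case unfolding uS by (subst EFv) auto
  qed
  have uE: "Eop V (\<nu> (Suc k)) *v u (Suc k) = u k" if "Suc k \<le> r" for k
  proof -
    have i: "Suc k \<in> {1..r}" "k \<le> r" using that by auto
    have K: "Kop V (\<nu> (Suc k)) *v u k = cpow q 1 *s u k" using uK[OF i(2,1)] by (simp add: wdelta_def)
    have "matrix_inv (Kop V (\<nu> (Suc k))) *v (Kop V (\<nu> (Suc k)) *v u k) = u k"
      using invertible_matrix_inv[OF inv[OF i(1)]] by (simp add: matrix_vector_mul_assoc)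
    hence "cpow q 1 *s (matrix_inv (Kop V (\<nu> (Suc k))) *v u k) = u k"
      unfolding K by (simp add: vec.scale)
    hence "cpow q (- 1) *s (cpow q 1 *s (matrix_inv (Kop V (\<nu> (Suc k))) *v u k)) = cpow q (- 1) *s u k" by simp
    hence Ki: "matrix_inv (Kop V (\<nu> (Suc k))) *v u k = cpow q (- 1) *s u k"
      using q by (simp add: cpow_minus cpow_nz)
    have "Eop V (\<nu> (Suc k)) *v u (Suc k) = (1 / (cpow q 1 - cpow q (- 1))) *s ((cpow q 1 - cpow q (- 1)) *s u k)"
      unfolding uS EFv[OF i(1,1)] using uE0[OF i(2,1)] by (simp add: K Ki vec.scale_left_diff_distrib)
    also have "\<dots> = u k" unfolding vec.scale_scale using nzh by simp
    finally show ?thesis .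
  qed
  have u_nz: "k \<le> r \<Longrightarrow> u k \<noteq> 0" for k
  proof (induction k)
    case 0 thus ?case using hw by (simp add: u0 highest_weight_vector_def weight_vector_def)
  next
    case (Suc k) thus ?case using uE[of k] by auto
  qed
  have Kdiag: "Kop V (\<nu> i) $ b $ a = (if b = a then cpow q (wform r (sroot (\<nu> i)) (wt a)) else 0)"
    if "i \<in> {1..r}" for i a b
  proof -
    have "Kop V (\<nu> i) *v axis a 1 = cpow q (wform r (sroot (\<nu> i)) (wt a)) *s axis a 1"
      using wb nu_in[OF that] by (simp add: weight_basis_def weight_vector_def)
    hence "(Kop V (\<nu> i) *v axis a 1) $ b = (cpow q (wform r (sroot (\<nu> i)) (wt a)) *s axis a 1) $ b" by simp
    thus ?thesis unfolding mult_axis by (simp add: axis_def)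
  qed
  have "\<exists>a. \<forall>i\<in>{1..r}. wform r (sroot (\<nu> i)) (wt a) = wdelta n i" if n: "n \<in> {1..r+1}" for n
  proof -
    obtain k where k: "n = Suc k" "k \<le> r" using n by (cases n) auto
    obtain a where a: "u k $ a \<noteq> 0" using u_nz[OF k(2)] by (auto simp: vec_eq_iff)
    have "wform r (sroot (\<nu> i)) (wt a) = wdelta n i" if i: "i \<in> {1..r}" for i
    proof -
      have "(Kop V (\<nu> i) *v u k) $ a = cpow q (wform r (sroot (\<nu> i)) (wt a)) * u k $ a"
        by (simp add: matrix_vector_mult_def Kdiag[OF i] if_distrib[of "\<lambda>x. x * _"] cong: if_cong)
      hence "cpow q (wform r (sroot (\<nu> i)) (wt a)) = cpow q (wdelta n i)"
        using a unfolding uK[OF k(2) i] k(1) by simp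
      thus ?thesis using q by (simp add: cpow_inj)
    qed
    thus ?thesis by blast
  qed
  \<comment> \<open>the weights of the chain occur among those of the basis, and they exhaust it\<close>
  then obtain f where f: "\<And>n i. n \<in> {1..r+1} \<Longrightarrow> i \<in> {1..r} \<Longrightarrow> wform r (sroot (\<nu> i)) (wt (f n)) = wdelta n i"
    by metis
  have inj: "inj_on f {1..r+1}"
    by (rule inj_onI) (metis f wdelta_inj)
  have "f ` {1..r+1} = UNIV"
    by (rule card_subset_eq) (use card card_image[OF inj] in auto)
  hence bij: "bij_betw f {1..r+1} UNIV" using inj by (simp add: bij_betw_def)
  define \<phi> where "\<phi> = inv_into {1..r+1} f"
  have phi_bij: "bij_betw \<phi> UNIV {1..r+1}" unfolding \<phi>_def by (rule bij_betw_inv_into[OF bij])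
  have f_phi: "f (\<phi> a) = a" for a unfolding \<phi>_def using bij by (intro f_inv_into_f) (auto simp: bij_betw_def)
  have phi_f: "\<phi> (f n) = n" if "n \<in> {1..r+1}" for n unfolding \<phi>_def using inj that by (rule inv_into_f_f)
  have phi_in: "\<phi> a \<in> {1..r+1}" for a using phi_bij by (auto simp: bij_betw_def)
  have ch: "wform r (sroot (\<nu> i)) (wt a) = wdelta (\<phi> a) i" if "i \<in> {1..r}" for i a
    using f[OF phi_in that, of a] by (simp add: f_phi)
  \<comment> \<open>commutation with the diagonal generators restricts the nonzero entries to one place\<close>
  have entry: "cpow q (wdelta (\<phi> b) i) * (A $ b $ a) = c * (A $ b $ a * cpow q (wdelta (\<phi> a) i))"
    if i: "i \<in> {1..r}" and A: "\<And>w. Kop V (\<nu> i) *v (A *v w) = c *s (A *v (Kop V (\<nu> i) *v w))" for i a b A c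
  proof -
    have ax: "Kop V (\<nu> i) *v axis a 1 = cpow q (wdelta (\<phi> a) i) *s axis a 1"
      using wb nu_in[OF i] ch[OF i, of a] by (simp add: weight_basis_def weight_vector_def)
    have "(Kop V (\<nu> i) *v (A *v axis a 1)) $ b = cpow q (wdelta (\<phi> b) i) * (A *v axis a 1) $ b"
      by (simp add: matrix_vector_mult_def[of "Kop V (\<nu> i)"] Kdiag[OF i] ch[OF i] if_distrib[of "\<lambda>x. x * _"] cong: if_cong)
    thus ?thesis unfolding A ax by (auto simp: vec.scale mult_axis mult_ac)
  qed
  define x where "x i = Eop V (\<nu> i) $ f i $ f (Suc i)" for i
  define y where "y i = Fop V (\<nu> i) $ f (Suc i) $ f i" for i
  have E: "Eop V (\<nu> i) = (\<chi> a b. if \<phi> a = i \<and> \<phi> b = Suc i then x i else 0)" if i: "i \<in> {1..r}" for i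
  proof -
    have "Eop V (\<nu> i) $ a $ b = 0" if ab: "\<not> (\<phi> a = i \<and> \<phi> b = Suc i)" for a b
    proof (rule ccontr)
      assume "Eop V (\<nu> i) $ a $ b \<noteq> 0"
      hence "cpow q (wdelta (\<phi> a) i) = cpow q (2 + wdelta (\<phi> b) i)"
        using entry[OF i KE[OF i i], of a b] q by (simp add: nuC[OF i i] cpow_add mult_ac)
      thus False using ab q by (auto simp: cpow_inj wdelta_def of_bool_def split: if_splits)
    qed
    thus ?thesis by (auto simp: vec_eq_iff x_def) (metis f_phi)
  qed
  have F: "Fop V (\<nu> i) = (\<chi> a b. if \<phi> a = Suc i \<and> \<phi> b = i then y i else 0)" if i: "i \<in> {1..r}" for i
  proof -
    have "Fop V (\<nu> i) $ a $ b = 0" if ab: "\<not> (\<phi> a = Suc i \<and> \<phi> b = i)" for a b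
    proof (rule ccontr)
      assume "Fop V (\<nu> i) $ a $ b \<noteq> 0"
      hence "cpow q (wdelta (\<phi> a) i) = cpow q (- 2) * cpow q (wdelta (\<phi> b) i)"
        using entry[OF i KF[OF i i], of a b] by (simp add: nuC[OF i i] mult_ac)
      hence "cpow q (wdelta (\<phi> a) i) = cpow q (- 2 + wdelta (\<phi> b) i)"
        by (simp only: cpow_add[OF q(1)])
      thus False using ab q by (auto simp: cpow_inj wdelta_def of_bool_def split: if_splits)
    qed
    thus ?thesis by (auto simp: vec_eq_iff y_def) (metis f_phi)
  qed
  have Kc: "Kop V (\<nu> i) = (\<chi> a b. if a = b then kw ?\<kappa> i (\<phi> a) else 0)" if i: "i \<in> {1..r}" for i
    using q by (auto simp: vec_eq_iff Kdiag[OF i] ch[OF i] wdelta_def kw_def cpow_1 cpow_minus cpow_0)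
  \<comment> \<open>compare the entries of the commutator of \<open>E\<close> and \<open>F\<close> at the \<open>i\<close>-th vector\<close>
  have xy: "x i * y i = 1" if i: "i \<in> {1..r}" for i
  proof -
    have i': "\<phi> (f i) = i" "\<phi> (f (Suc i)) = Suc i" using i by (auto intro!: phi_f)
    have "(\<Sum>k\<in>UNIV. (if \<phi> k = Suc i then x i else 0) * (if \<phi> k = Suc i then y i else 0)) = (\<Sum>k\<in>UNIV. if k = f (Suc i) then x i * y i else 0)"
    proof -
      have "(\<phi> k = Suc i) = (k = f (Suc i))" for k using f_phi i'(2) by metis
      thus ?thesis by (intro sum.cong) auto
    qed
    hence 1: "(Eop V (\<nu> i) ** Fop V (\<nu> i)) $ f i $ f i = x i * y i"
      by (simp add: matrix_matrix_mult_def E[OF i] F[OF i] i')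
    have 2: "(Fop V (\<nu> i) ** Eop V (\<nu> i)) $ f i $ f i = 0"
      by (simp add: matrix_matrix_mult_def E[OF i] F[OF i] i')
    have "Kop V (\<nu> i) ** (\<chi> a b. if a = b then 1 / kw ?\<kappa> i (\<phi> a) else 0) = mat 1"
      using q by (intro ct_ext) (simp add: Kc[OF i] ct_mult ct_diag kw_def)
    hence Ki: "matrix_inv (Kop V (\<nu> i)) = (\<chi> a b. if a = b then 1 / kw ?\<kappa> i (\<phi> a) else 0)" by (rule matrix_inv_eqI)
    have "(mat (1 / (cpow q 1 - cpow q (- 1))) ** (Kop V (\<nu> i) - matrix_inv (Kop V (\<nu> i)))) $ f i $ f i =
       1 / (cpow q 1 - cpow q (- 1)) * (?\<kappa> - 1 / ?\<kappa>)"
      unfolding mult_axis[symmetric] mat_mult_vec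
      by (simp only: vector_smult_component mult_axis vector_minus_component Ki) (simp add: Kc[OF i] i' kw_def)
    also have "\<dots> = 1" using nzh q by (simp add: cpow_1 cpow_minus)
    finally have 3: "(mat (1 / (cpow q 1 - cpow q (- 1))) ** (Kop V (\<nu> i) - matrix_inv (Kop V (\<nu> i)))) $ f i $ f i = 1" .
    have "(Eop V (\<nu> i) ** Fop V (\<nu> i) - Fop V (\<nu> i) ** Eop V (\<nu> i)) $ f i $ f i =
       (mat (1 / (cpow q 1 - cpow q (- 1))) ** (Kop V (\<nu> i) - matrix_inv (Kop V (\<nu> i)))) $ f i $ f i"
      by (simp only: EF[OF i i] if_True refl)
    thus ?thesis unfolding 3 vector_minus_component 1 2 by simp
  qed
  have "chain_ops r ?\<kappa> \<nu> \<phi> x y V"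
    unfolding chain_ops_def using phi_bij E F Kc xy by (auto simp: \<nu>_def)
  hence "chain_rep_q r q \<nu> \<phi> x y V" using r1 q by unfold_locales auto
  moreover have "wform r (wt a) (two_rho r) = real r + 2 - 2 * real (\<phi> a)" for a
  proof -
    have wl: "wt a \<in> weight_lattice r" using wb by (simp add: weight_basis_def weight_vector_def)
    let ?f = "\<lambda>i. real i * (real r + 1 - real i)"
    have "wform r (wt a) (two_rho r) = (\<Sum>i=1..r. wform r (sroot i) (wt a) * wform r (two_rho r) (fweight r i))"
      by (subst weight_lattice_expand[OF wl], subst wform_commute, rule wform_sum_right)
    also have "\<dots> = (\<Sum>i=1..r. wform r (sroot i) (wt a) * ?f i)"
      by (intro sum.cong refl) (simp add: wform_commute[of r "two_rho r"] wform_fweight_two_rho)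
    also have "\<dots> = (\<Sum>i=1..r. wform r (sroot (\<nu> i)) (wt a) * ?f (\<nu> i))"
      by (rule sum.reindex_bij_witness[of _ \<nu> \<nu>]) (auto simp: \<nu>_def)
    also have "\<dots> = (\<Sum>i=1..r. wdelta (\<phi> a) i * ?f i)"
      using ch by (intro sum.cong refl) (auto simp: \<nu>_def of_nat_diff mult.commute)
    also have "\<dots> = (\<Sum>i=1..r. (if i = \<phi> a then ?f i else 0) - (if i = \<phi> a - 1 then ?f i else 0))"
      using phi_in[of a] by (intro sum.cong refl) (auto simp: wdelta_def)
    also have "\<dots> = (if \<phi> a \<in> {1..r} then ?f (\<phi> a) else 0) - (if \<phi> a - 1 \<in> {1..r} then ?f (\<phi> a - 1) else 0)"
      by (simp add: sum_subtractf)
    also have "\<dots> = ?f (\<phi> a) - ?f (\<phi> a - 1)"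
      using phi_in[of a] by (cases "\<phi> a = 1"; cases "\<phi> a = r + 1") auto
    also have "\<dots> = real r + 2 - 2 * real (\<phi> a)"
      using phi_in[of a] by (simp add: of_nat_diff algebra_simps)
    finally show ?thesis .
  qed
  ultimately show ?thesis by blast
qed

section \<open>Contractions of families\<close>

lemma ct_indicator: "ct M (\<lambda>x. of_bool (x = l)) k = M $ l $ k"
  by (simp add: ct_def of_bool_def if_distrib[of "(*) _"] cong: if_cong)

context numbered_basis
begin

text \<open>
  The contraction identities for matrix entries, obtained by applying them to indicator functions.
\<close>

lemma Stm_ev_entry: "(\<Sum>j\<in>UNIV. Stm $ (j, j, l) $ (b, c, d)) = (if c = d then if b = l then qq c / (\<theta> * \<kappa> ^ N) else 0 else 0)"
proof -
  have "(\<Sum>j\<in>UNIV. Stm $ (j, j, l) $ (b, c, d)) = (\<Sum>j\<in>UNIV. ct Stm (\<lambda>x. of_bool (x = (j, j, l))) (b, c, d))"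
    by (simp add: ct_indicator)
  also have "\<dots> = ct Stm (capl one1 (\<lambda>z. of_bool (z = l))) (b, c, d)"
    unfolding ct_sum by (rule arg_cong[where f = "\<lambda>F. ct Stm F (b, c, d)"])
      (auto simp: fun_eq_iff capl_def of_bool_def intro!: sum.neutral)
  finally show ?thesis unfolding Stm_ev by (simp add: capr_def)
qed

lemma Sm_ev_entry: "(\<Sum>j\<in>UNIV. Sm $ (i, j, j) $ (a, b, c)) =
   (if a = b then if c = i then \<theta> / \<kappa> ^ N * qq a else 0 else 0) + (if b = c then if a = i then \<theta> * h else 0 else 0)"
proof -
  have "(\<Sum>j\<in>UNIV. Sm $ (i, j, j) $ (a, b, c)) = (\<Sum>j\<in>UNIV. ct Sm (\<lambda>x. of_bool (x = (i, j, j))) (a, b, c))"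
    by (simp add: ct_indicator)
  also have "\<dots> = ct Sm (capr one1 (\<lambda>z. of_bool (z = i))) (a, b, c)"
    unfolding ct_sum by (rule arg_cong[where f = "\<lambda>F. ct Sm F (a, b, c)"])
      (auto simp: fun_eq_iff capr_def of_bool_def intro!: sum.neutral)
  finally show ?thesis unfolding Sm_ev by (simp add: capr_def capl_def)
qed

lemma Stm_trace_entry: "(\<Sum>j\<in>UNIV. qq j * Stm $ (d, j, j) $ (b, c, e)) =
   (if b = c then if d = e then \<kappa> ^ N / \<theta> else 0 else 0) - (if c = e then if b = d then h / \<theta> * qq c else 0 else 0)"
proof -
  have "(\<Sum>j\<in>UNIV. qq j * Stm $ (d, j, j) $ (b, c, e)) = (\<Sum>j\<in>UNIV. ct Stm (\<lambda>x. qq j * of_bool (x = (d, j, j))) (b, c, e))"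
    by (simp add: ct_linear_fun ct_indicator)
  also have "\<dots> = ct Stm (capr qq (\<lambda>z. of_bool (z = d))) (b, c, e)"
    unfolding ct_sum by (rule arg_cong[where f = "\<lambda>F. ct Stm F (b, c, e)"])
      (auto simp: fun_eq_iff capr_def of_bool_def if_distrib[of "(*) _"] cong: if_cong intro!: sum.neutral)
  finally show ?thesis unfolding Stm_trace by (auto simp add: capr_def capl_def)
qed

lemma Stm_cup_entry: "(\<Sum>k\<in>UNIV. Stm $ (a, b, c) $ (k, k, e) / qq k) =
   (if a = e then if b = c then \<kappa> ^ N / \<theta> else 0 else 0) - (if a = b then if c = e then h / \<theta> / qq a else 0 else 0)"
proof -
  have e: "(\<Sum>k\<in>UNIV. of_bool ((e, k, k) = (a, b, c))) = (if a = e then if b = c then 1 else 0 else (0::complex))"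
    by (auto simp: of_bool_def intro!: sum.neutral)
  have f: "(\<Sum>k\<in>UNIV. of_bool ((k, k, e) = (a, b, c)) / qq k) = (if a = b then if c = e then 1 / qq a else 0 else (0::complex))"
  proof -
    have "(\<Sum>k\<in>UNIV. of_bool ((k, k, e) = (a, b, c)) / qq k) = (\<Sum>k\<in>UNIV. if k = a then (if a = b \<and> c = e then 1 / qq a else 0) else 0)"
      by (intro sum.cong) auto
    thus ?thesis by simp
  qed
  show ?thesis using Stm_cup[of "\<lambda>x. of_bool (x = (a, b, c))" e] unfolding ct_indicator e f by auto
qed

lemma Rm_cap_entry: "(\<Sum>j\<in>UNIV. Rm $ (j, j) $ (a, b)) = (if a = b then qq a / (\<theta> * \<kappa> ^ N) else 0)"
proof -
  have "(\<Sum>j\<in>UNIV. Rm $ (j, j) $ (a, b)) = (\<Sum>j\<in>UNIV. ct Rm (\<lambda>x. of_bool (x = (j, j))) (a, b))"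
    by (simp add: ct_indicator)
  also have "\<dots> = ct Rm (\<lambda>(x, y). capl one1 one1 (x, y, a)) (a, b)"
    unfolding ct_sum by (rule arg_cong[where f = "\<lambda>F. ct Rm F (a, b)"])
      (auto simp: fun_eq_iff capl_def of_bool_def intro!: sum.neutral)
  also have "\<dots> = ct (legs12 Rm) (capl one1 one1) (a, b, a)" by (simp add: ct_legs12)
  finally show ?thesis unfolding cap_Rm by (simp add: capl_def)
qed

lemma Rm_cup_entry: "(\<Sum>k\<in>UNIV. Rm $ (e, f) $ (k, k)) = (if e = f then 1 / (qq e * (\<theta> * \<kappa> ^ N)) else 0)"
proof -
  have "(\<Sum>k\<in>UNIV. of_bool ((k, k) = (e, f)) / qq k) = (\<Sum>k\<in>UNIV. if k = e then (if e = f then 1 / qq e else 0) else 0)"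
    by (intro sum.cong) auto
  thus ?thesis using cup_Rm[of "\<lambda>x. of_bool (x = (e, f))"] unfolding ct_indicator by simp
qed

lemma Stm_hat_entry: "(\<Sum>k\<in>UNIV. \<Sum>l\<in>UNIV. Rm $ (e, f) $ (k, l) * (qq i * Stm $ (i, k, l) $ (b, c, d))) =
   (\<Sum>j\<in>UNIV. qq j * (Rm $ (e, j) $ (i, b) * Rm $ (j, f) $ (c, d)))"
proof -
  have 1: "ct Stm (\<lambda>(x, k, l). of_bool (x = i) * G (k, l)) (b, c, d) = (\<Sum>k\<in>UNIV. \<Sum>l\<in>UNIV. G (k, l) * Stm $ (i, k, l) $ (b, c, d))" for G
    by (simp add: ct_def sum_pair_UNIV of_bool_def if_distrib[of "(*) _"] if_distrib[of "\<lambda>x. x * _"] if_conj_sum mult.commute cong: if_cong)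
  have "ct Rm (\<lambda>(u, j). of_bool (j = y) * (qq j * of_bool ((u, z) = (e, f)))) (i, b) = of_bool (z = f) * (qq y * Rm $ (e, y) $ (i, b))" for y z
  proof -
    have "(\<lambda>(u, j). of_bool (j = y) * (qq j * of_bool ((u, z) = (e, f)))) = (\<lambda>x. (of_bool (z = f) * qq y) * of_bool (x = (e, y)))"
      by auto
    thus ?thesis by (simp only: ct_linear ct_indicator mult.assoc)
  qed
  hence "ct Rm (\<lambda>(y, z). ct Rm (\<lambda>(u, j). of_bool (j = y) * (qq j * of_bool ((u, z) = (e, f)))) (i, b)) (c, d) =
    (\<Sum>y\<in>UNIV. \<Sum>z\<in>UNIV. Rm $ (y, z) $ (c, d) * (of_bool (z = f) * (qq y * Rm $ (e, y) $ (i, b))))"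
    by (simp add: ct_def sum_pair_UNIV)
  also have "\<dots> = (\<Sum>j\<in>UNIV. qq j * (Rm $ (e, j) $ (i, b) * Rm $ (j, f) $ (c, d)))"
    by (simp add: of_bool_def if_distrib[of "(*) _"] if_distrib[of "\<lambda>x. x * _"] mult_ac cong: if_cong)
  finally show ?thesis
    using Stm_hat[of i "\<lambda>x. of_bool (x = (e, f))" b c d] unfolding ct_indicator 1[of "\<lambda>x. Rm $ (e, f) $ x"]
    by (simp add: sum_distrib_left mult_ac)
qed

lemma sum_qq: "h * (\<Sum>i\<in>UNIV. qq i) = \<kappa> ^ N - 1 / \<kappa> ^ N" and sum_inv_qq: "h * (\<Sum>i\<in>UNIV. 1 / qq i) = \<kappa> ^ N - 1 / \<kappa> ^ N"
proof -
  have s: "{n \<in> {1..N}. True} = {0<..<Suc N}" "{n \<in> {1..N}. True} = {0<..0 + N}" by auto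
  show "h * (\<Sum>i\<in>UNIV. qq i) = \<kappa> ^ N - 1 / \<kappa> ^ N"
    using sum_phi[where P = "\<lambda>_. True" and f = qf] qf_between[of 0 "Suc N"] kappa
    unfolding s(1) by (simp add: qq_def) (simp add: qf_def power_add mult_2)
  have "\<kappa> / qf N = \<kappa> ^ N" "\<kappa> / qf 0 = 1 / \<kappa> ^ N" using kappa by (simp_all add: qf_def mult_2 power_add)
  thus "h * (\<Sum>i\<in>UNIV. 1 / qq i) = \<kappa> ^ N - 1 / \<kappa> ^ N"
    using sum_phi[where P = "\<lambda>_. True" and f = "\<lambda>n. 1 / qf n"] qinv_telescope[of 0 N]
    unfolding s(2) by (simp add: qq_def)
qed

end

lemma leg_map_hom:
  assumes "Modules.additive f" "\<And>c v. f (sc c v) = sc' c (f v)"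
  shows "f (leg_map sc M z k) = leg_map sc' M (\<lambda>l. f (z l)) k"
  unfolding leg_map_def additive.sum[OF assms(1)] assms(2) ..

lemma leg_map_mult:
  assumes "module sc"
  shows "leg_map sc (A ** B) z = leg_map sc A (leg_map sc B z)"
proof
  interpret module sc by fact
  fix k
  have "leg_map sc (A ** B) z k = (\<Sum>l\<in>UNIV. \<Sum>j\<in>UNIV. sc (A $ k $ j * B $ j $ l) (z l))"
    by (simp add: leg_map_def matrix_matrix_mult_def scale_sum_left)
  also have "\<dots> = (\<Sum>j\<in>UNIV. \<Sum>l\<in>UNIV. sc (A $ k $ j * B $ j $ l) (z l))" by (rule sum.swap)
  also have "\<dots> = leg_map sc A (leg_map sc B z) k" by (simp add: leg_map_def scale_sum_right)
  finally show "leg_map sc (A ** B) z k = leg_map sc A (leg_map sc B z) k" .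
qed

lemma leg_map_sum_rows:
  assumes "module sc"
  shows "(\<Sum>j\<in>J. sc (u j) (leg_map sc M z (k j))) = (\<Sum>l\<in>UNIV. sc (\<Sum>j\<in>J. u j * M $ k j $ l) (z l))"
proof -
  interpret module sc by fact
  show ?thesis by (simp add: leg_map_def scale_sum_right scale_sum_left) (rule sum.swap)
qed

locale qps_rep = chain_rep_q r q \<nu> \<phi> x y V
  for r :: nat and q :: real and \<nu> :: "nat \<Rightarrow> nat" and \<phi> :: "'n::finite \<Rightarrow> nat"
    and x y :: "nat \<Rightarrow> complex" and V :: "'n uq_rep" +
  fixes D :: "'n qps_data" and s :: nat and wt :: "'n \<Rightarrow> weight"
  assumes D: "D = \<lparr>rk = r, node = s, qpar = q, Vrep = V, wts = wt\<rparr>"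
    and s: "s \<in> {1, r}"
    and wt: "wform r (wt a) (two_rho r) = real r + 2 - 2 * real (\<phi> a)"
begin

lemma qpow_D: "qpow D z = cpow q z"
  by (simp add: qpow_def D)

lemma s_in: "s \<in> {1..r}" using s r1 by auto

lemma ca_D: "ca D = 2"
  by (simp add: ca_def D wform_sroot_sroot[OF s_in])

lemma cm_D: "cm D = real r"
proof -
  have "real s * (real r + 1 - real s) = real r" using s by (auto simp: algebra_simps)
  thus ?thesis by (simp add: cm_def D wform_fweight_two_rho[OF s_in])
qed

lemma cw_D: "cw D = 1 - 1 / (real r + 1)"
proof -
  have "cw D = real s * (real r + 1 - real s) / (real r + 1)"
    by (simp add: cw_def D wform_fweight[OF order_refl s_in])
  also have "real s * (real r + 1 - real s) = real r" using s by (auto simp: algebra_simps)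
  finally show ?thesis by (simp add: field_simps)
qed

lemma qq_wrho: "cpow q (wrho D i) = qq i" "cpow q (- wrho D i) = 1 / qq i"
proof -
  have w: "wrho D i = real (r + 2) - real (2 * \<phi> i)" by (simp add: wrho_def D wt)
  have "cpow q (wrho D i) = \<kappa> ^ (r + 2) / \<kappa> ^ (2 * \<phi> i)" unfolding w by (simp only: cpow_diff[OF q(1)] cpow_nat[OF q(1)])
  also have "\<dots> = qq i" by (simp add: qq_def qf_def)
  finally show "cpow q (wrho D i) = qq i" .
  thus "cpow q (- wrho D i) = 1 / qq i" using q by (simp add: cpow_minus)
qed

lemma Smat_D: "Smat D = Sm"
  by (simp only: Smat_def RVd_def RVV_def D qps_data.select_convs braiding_V_dual braiding_VV matrix_inv_Rm Sm_def)

lemma Stmat_D: "Stmat D = Stm"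
  by (simp only: Stmat_def RVd_def Rdd_def D qps_data.select_convs braiding_V_dual braiding_dual_dual matrix_inv_Rm matrix_inv_Um Stm_def)

lemma S123_entry: "S123 D $ (a, b, c, d) $ (a', b', c', d') = (if d = d' then Sm $ (a, b, c) $ (a', b', c') else 0)"
  by (simp only: S123_def Smat_D) simp

lemma S234_entry: "S234 D $ (a, b, c, d) $ (a', b', c', d') = (if a = a' then Stm $ (b, c, d) $ (b', c', d') else 0)"
  by (simp only: S234_def Stmat_D kron_def) (simp add: mat_def)

text \<open>
  \<open>star\<close> is the opposite product of \<open>V \<otimes> V*\<close>, twisted by the braiding. The change of basis
  \<open>hatm\<close> to \<open>V* \<otimes> V\<close> turns it into the product of matrices.
\<close>

definition star :: "(complex \<Rightarrow> 'v \<Rightarrow> 'v::ab_group_add) \<Rightarrow> ('n \<times> 'n \<times> 'n \<times> 'n \<Rightarrow> 'v) \<Rightarrow> 'n \<times> 'n \<Rightarrow> 'v" where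
  "star sc z = (\<lambda>(k, l). \<Sum>i\<in>UNIV. sc (\<theta> * \<kappa> / \<kappa> ^ r * qq i) (leg_map sc (S234 D) z (i, i, k, l)))"

definition hatm :: "complex^('n \<times> 'n)^('n \<times> 'n)" where
  "hatm = (\<chi> x y. \<theta> * \<kappa> / \<kappa> ^ r * qq (fst x) * Rm $ x $ y)"

lemma kn [simp]: "q \<noteq> 0" "\<theta> \<noteq> 0" using q theta by auto

lemma kappa_2r: "\<kappa> ^ (2 * r) = \<kappa> ^ r * \<kappa> ^ r"
  by (simp add: mult_2 power_add)

lemma ev_S234:
  assumes "module sc"
  shows "(\<Sum>j\<in>UNIV. leg_map sc (S234 D) z (i, j, j, l)) = (\<Sum>c\<in>UNIV. sc (qq c / (\<theta> * \<kappa> ^ (r + 1))) (z (i, l, c, c)))"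
proof -
  interpret module sc by fact
  have "(\<Sum>j\<in>UNIV. leg_map sc (S234 D) z (i, j, j, l)) = (\<Sum>k\<in>UNIV. sc (\<Sum>j\<in>UNIV. S234 D $ (i, j, j, l) $ k) (z k))"
    using leg_map_sum_rows[OF assms, where J = UNIV and u = "\<lambda>_. 1" and M = "S234 D" and z = z and k = "\<lambda>j. (i, j, j, l)"] by simp
  also have "\<dots> = (\<Sum>c\<in>UNIV. sc (qq c / (\<theta> * \<kappa> ^ (r + 1))) (z (i, l, c, c)))"
    unfolding sum_pair_UNIV S234_entry if_conj_sum Stm_ev_entry
    by (simp only: if_distrib[of "\<lambda>c. sc c _"] scale_zero_left if_conj_sum)
       (simp add: if_conj_sum if_distrib[of "\<lambda>c. sc c _"] cong: if_cong)
  finally show ?thesis .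
qed

lemma ev_S123:
  assumes "module sc"
  shows "(\<Sum>j\<in>UNIV. leg_map sc (S123 D) z (i, j, j, l)) =
    (\<Sum>b\<in>UNIV. sc (\<theta> / \<kappa> ^ (r + 1) * qq b) (z (b, b, i, l))) + sc (\<theta> * h) (\<Sum>j\<in>UNIV. z (i, j, j, l))"
proof -
  interpret module sc by fact
  have "(\<Sum>j\<in>UNIV. leg_map sc (S123 D) z (i, j, j, l)) = (\<Sum>k\<in>UNIV. sc (\<Sum>j\<in>UNIV. S123 D $ (i, j, j, l) $ k) (z k))"
    using leg_map_sum_rows[OF assms, where J = UNIV and u = "\<lambda>_. 1" and M = "S123 D" and z = z and k = "\<lambda>j. (i, j, j, l)"] by simp
  also have "\<dots> = (\<Sum>a\<in>UNIV. \<Sum>b\<in>UNIV. \<Sum>c\<in>UNIV. \<Sum>d\<in>UNIV. if l = d then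
      (if a = b then if c = i then sc (\<theta> / \<kappa> ^ (r + 1) * qq a) (z (a, b, c, d)) else 0 else 0) +
      (if b = c then if a = i then sc (\<theta> * h) (z (a, b, c, d)) else 0 else 0) else 0)"
    unfolding sum_pair_UNIV S123_entry if_conj_sum Sm_ev_entry
    by (intro sum.cong refl) (auto simp: scale_left_distrib)
  also have "\<dots> = (\<Sum>b\<in>UNIV. sc (\<theta> / \<kappa> ^ (r + 1) * qq b) (z (b, b, i, l))) + sc (\<theta> * h) (\<Sum>j\<in>UNIV. z (i, j, j, l))"
    by (simp add: sum.distrib if_conj_sum scale_sum_right cong: if_cong)
  finally show ?thesis .
qed

text \<open>
  On the families of interest the last sum contains a quantum trace of a differential and is zero, so
  contracting the middle legs after \<open>T\<close> amounts to the twisted product \<open>star\<close>.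
\<close>

lemma ev_T1234:
  assumes "module sc"
  shows "(\<Sum>j\<in>UNIV. leg_map sc (T1234 D) z (i, j, j, l)) =
    sc (1 / \<kappa>\<^sup>2) (star sc z (i, l)) + (\<Sum>c\<in>UNIV. sc (h / \<kappa> ^ (r + 1) * qq c) (z (i, l, c, c)))"
proof -
  interpret module sc by fact
  have 1: "\<kappa> / (\<kappa>\<^sup>2 * \<kappa> ^ r) = 1 / \<kappa> ^ (r + 1)" by (simp add: power2_eq_square)
  have "(\<Sum>b\<in>UNIV. sc (\<theta> / \<kappa> ^ (r + 1) * qq b) (leg_map sc (S234 D) z (b, b, i, l))) = sc (1 / \<kappa>\<^sup>2) (star sc z (i, l))"
    unfolding star_def by (simp add: scale_sum_right power2_eq_square)
  thus ?thesis
    unfolding T1234_def leg_map_mult[OF assms] ev_S123[OF assms] ev_S234[OF assms]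
    by (simp add: scale_sum_right)
qed

lemma trace_star:
  assumes "module sc"
  shows "(\<Sum>k\<in>UNIV. sc (qq k) (star sc z (k, k))) = sc (\<kappa>\<^sup>2) (\<Sum>i\<in>UNIV. \<Sum>j\<in>UNIV. sc (qq i) (z (i, j, j, i)))
     - (\<Sum>i\<in>UNIV. \<Sum>j\<in>UNIV. sc (h * \<kappa> / \<kappa> ^ r * qq i * qq j) (z (i, i, j, j)))"
proof -
  interpret module sc by fact
  have "(\<Sum>k\<in>UNIV. sc (qq k) (star sc z (k, k))) =
    (\<Sum>i\<in>UNIV. sc (\<theta> * \<kappa> / \<kappa> ^ r * qq i) (\<Sum>k\<in>UNIV. sc (qq k) (leg_map sc (S234 D) z (i, i, k, k))))"
    unfolding star_def by (simp add: scale_sum_right) (subst sum.swap, simp add: mult_ac)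
  also have "\<dots> = (\<Sum>i\<in>UNIV. sc (\<theta> * \<kappa> / \<kappa> ^ r * qq i) (sc (\<kappa> ^ (r + 1) / \<theta>) (\<Sum>j\<in>UNIV. z (i, j, j, i))
      - (\<Sum>j\<in>UNIV. sc (h / \<theta> * qq j) (z (i, i, j, j)))))"
  proof (intro sum.cong refl arg_cong[where f = "sc _"])
    fix i
    have "(\<Sum>k\<in>UNIV. sc (qq k) (leg_map sc (S234 D) z (i, i, k, k))) = (\<Sum>l\<in>UNIV. sc (\<Sum>k\<in>UNIV. qq k * S234 D $ (i, i, k, k) $ l) (z l))"
      by (rule leg_map_sum_rows[OF assms])
    also have "\<dots> = (\<Sum>a\<in>UNIV. \<Sum>b\<in>UNIV. \<Sum>c\<in>UNIV. \<Sum>d\<in>UNIV. if i = a then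
      (if b = c then if i = d then sc (\<kappa> ^ (r + 1) / \<theta>) (z (a, b, c, d)) else 0 else 0) -
      (if c = d then if b = i then sc (h / \<theta> * qq c) (z (a, b, c, d)) else 0 else 0) else 0)"
    proof -
      have "(\<Sum>k\<in>UNIV. qq k * S234 D $ (i, i, k, k) $ (a, b, c, d)) = (if i = a then
        (if b = c then if i = d then \<kappa> ^ (r + 1) / \<theta> else 0 else 0) - (if c = d then if b = i then h / \<theta> * qq c else 0 else 0) else 0)"
        for a b c d
        by (cases "i = a") (simp_all add: S234_entry Stm_trace_entry)
      thus ?thesis unfolding sum_pair_UNIV
        by (intro sum.cong refl) (auto simp: scale_left_diff_distrib)
    qed
    also have "\<dots> = sc (\<kappa> ^ (r + 1) / \<theta>) (\<Sum>j\<in>UNIV. z (i, j, j, i)) - (\<Sum>j\<in>UNIV. sc (h / \<theta> * qq j) (z (i, i, j, j)))"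
      by (simp add: sum_subtractf if_conj_sum scale_sum_right cong: if_cong)
    finally show "(\<Sum>k\<in>UNIV. sc (qq k) (leg_map sc (S234 D) z (i, i, k, k))) =
       sc (\<kappa> ^ (r + 1) / \<theta>) (\<Sum>j\<in>UNIV. z (i, j, j, i)) - (\<Sum>j\<in>UNIV. sc (h / \<theta> * qq j) (z (i, i, j, j)))" .
  qed
  also have "\<dots> = sc (\<kappa>\<^sup>2) (\<Sum>i\<in>UNIV. \<Sum>j\<in>UNIV. sc (qq i) (z (i, j, j, i)))
     - (\<Sum>i\<in>UNIV. \<Sum>j\<in>UNIV. sc (h * \<kappa> / \<kappa> ^ r * qq i * qq j) (z (i, i, j, j)))"
    by (simp add: scale_right_diff_distrib scale_sum_right sum_subtractf power2_eq_square mult_ac)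
  finally show ?thesis .
qed

lemma trace_hat:
  assumes "module sc"
  shows "(\<Sum>i\<in>UNIV. sc (\<kappa> ^ (2 * r) / qq i) (leg_map sc hatm z (i, i))) = (\<Sum>k\<in>UNIV. sc (qq k) (z (k, k)))"
proof -
  interpret module sc by fact
  have "(\<Sum>i\<in>UNIV. sc (\<kappa> ^ (2 * r) / qq i) (leg_map sc hatm z (i, i))) =
     (\<Sum>l\<in>UNIV. sc (\<Sum>i\<in>UNIV. \<kappa> ^ (2 * r) / qq i * hatm $ (i, i) $ l) (z l))"
    by (rule leg_map_sum_rows[OF assms])
  also have "\<dots> = (\<Sum>a\<in>UNIV. \<Sum>b\<in>UNIV. if a = b then sc (qq a) (z (a, b)) else 0)"
  proof -
    have "(\<Sum>i\<in>UNIV. \<kappa> ^ (2 * r) / qq i * hatm $ (i, i) $ (a, b)) = \<theta> * \<kappa> * \<kappa> ^ r * (\<Sum>i\<in>UNIV. Rm $ (i, i) $ (a, b))" for a b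
      unfolding kappa_2r by (simp add: hatm_def sum_distrib_left mult_ac)
    thus ?thesis unfolding sum_pair_UNIV Rm_cap_entry by (intro sum.cong refl) simp
  qed
  also have "\<dots> = (\<Sum>k\<in>UNIV. sc (qq k) (z (k, k)))" by simp
  finally show ?thesis .
qed

lemma hat_delta: "(\<Sum>k\<in>UNIV. hatm $ (e, f) $ (k, k)) = (if e = f then 1 / \<kappa> ^ (2 * r) else 0)"
proof -
  have "(\<Sum>k\<in>UNIV. hatm $ (e, f) $ (k, k)) = \<theta> * \<kappa> / \<kappa> ^ r * qq e * (\<Sum>k\<in>UNIV. Rm $ (e, f) $ (k, k))"
    by (simp add: hatm_def sum_distrib_left)
  thus ?thesis unfolding Rm_cup_entry by (simp add: mult_2 power_add)
qed

lemma hat_star: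
  assumes "module sc" and bi: "\<And>u. Modules.additive (f u)" "\<And>v. Modules.additive (\<lambda>u. f u v)"
    and f1: "\<And>c u v. f (sca c u) v = sc c (f u v)" and f2: "\<And>c u v. f u (scb c v) = sc c (f u v)"
  shows "(\<Sum>j\<in>UNIV. f (leg_map sca hatm X (e, j)) (leg_map scb hatm Y (j, f'))) = leg_map sc hatm (star sc (fam_prod f X Y)) (e, f')"
proof -
  interpret module sc by fact
  let ?g = "\<theta> * \<kappa> / \<kappa> ^ r"
  have "(\<Sum>j\<in>UNIV. f (leg_map sca hatm X (e, j)) (leg_map scb hatm Y (j, f'))) =
     (\<Sum>j\<in>UNIV. \<Sum>m\<in>UNIV. \<Sum>n\<in>UNIV. sc (hatm $ (e, j) $ m * hatm $ (j, f') $ n) (f (X m) (Y n)))"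
    by (simp add: leg_map_def additive.sum[OF bi(1)] additive.sum[OF bi(2)] f1 f2 scale_sum_right)
       (rule sum.cong[OF refl], subst sum.swap, simp add: mult.commute)
  also have "\<dots> = (\<Sum>m\<in>UNIV. \<Sum>n\<in>UNIV. sc (\<Sum>j\<in>UNIV. hatm $ (e, j) $ m * hatm $ (j, f') $ n) (f (X m) (Y n)))"
    by (subst sum.swap, rule sum.cong[OF refl], subst sum.swap) (simp add: scale_sum_left)
  also have "\<dots> = (\<Sum>a\<in>UNIV. \<Sum>b\<in>UNIV. \<Sum>c\<in>UNIV. \<Sum>d\<in>UNIV. sc (\<Sum>j\<in>UNIV. hatm $ (e, j) $ (a, b) * hatm $ (j, f') $ (c, d)) (f (X (a, b)) (Y (c, d))))"
    by (simp add: sum_pair_UNIV)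
  also have "\<dots> = (\<Sum>a\<in>UNIV. \<Sum>b\<in>UNIV. \<Sum>c\<in>UNIV. \<Sum>d\<in>UNIV. sc (\<Sum>m\<in>UNIV. hatm $ (e, f') $ m * (\<Sum>i\<in>UNIV. ?g * qq i * S234 D $ (i, i, m) $ (a, b, c, d))) (f (X (a, b)) (Y (c, d))))"
  proof (intro sum.cong refl arg_cong2[where f = sc])
    fix a b c d
    have "(\<Sum>j\<in>UNIV. hatm $ (e, j) $ (a, b) * hatm $ (j, f') $ (c, d)) =
       ?g * ?g * qq e * (\<Sum>j\<in>UNIV. qq j * (Rm $ (e, j) $ (a, b) * Rm $ (j, f') $ (c, d)))"
      by (simp add: hatm_def sum_distrib_left mult_ac)
    also have "\<dots> = (\<Sum>k\<in>UNIV. \<Sum>l\<in>UNIV. hatm $ (e, f') $ (k, l) * (?g * (qq a * Stm $ (a, k, l) $ (b, c, d))))"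
      unfolding Stm_hat_entry[symmetric] by (simp add: hatm_def sum_distrib_left mult_ac)
    also have "\<dots> = (\<Sum>m\<in>UNIV. hatm $ (e, f') $ m * (\<Sum>i\<in>UNIV. ?g * qq i * S234 D $ (i, i, m) $ (a, b, c, d)))"
      unfolding sum_pair_UNIV S234_entry by (simp add: if_distrib[of "(*) _"] mult.assoc cong: if_cong)
    finally show "(\<Sum>j\<in>UNIV. hatm $ (e, j) $ (a, b) * hatm $ (j, f') $ (c, d)) =
      (\<Sum>m\<in>UNIV. hatm $ (e, f') $ m * (\<Sum>i\<in>UNIV. ?g * qq i * S234 D $ (i, i, m) $ (a, b, c, d)))" .
  qed
  also have "\<dots> = (\<Sum>l\<in>UNIV. sc (\<Sum>m\<in>UNIV. hatm $ (e, f') $ m * (\<Sum>i\<in>UNIV. ?g * qq i * S234 D $ (i, i, m) $ l)) (fam_prod f X Y l))"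
    by (simp add: sum_pair_UNIV fam_prod_def)
  also have "\<dots> = (\<Sum>m\<in>UNIV. sc (hatm $ (e, f') $ m) (\<Sum>l\<in>UNIV. sc (\<Sum>i\<in>UNIV. ?g * qq i * S234 D $ (i, i, m) $ l) (fam_prod f X Y l)))"
  proof -
    have "(\<Sum>l\<in>UNIV. sc (\<Sum>m\<in>UNIV. a m * b m l) (z l)) = (\<Sum>m\<in>UNIV. sc (a m) (\<Sum>l\<in>UNIV. sc (b m l) (z l)))"
      for a :: "'n \<times> 'n \<Rightarrow> complex" and b and z :: "'n \<times> 'n \<times> 'n \<times> 'n \<Rightarrow> _"
      by (simp add: scale_sum_left scale_sum_right) (rule sum.swap)
    thus ?thesis .
  qed
  also have "\<dots> = leg_map sc hatm (star sc (fam_prod f X Y)) (e, f')"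
    unfolding leg_map_sum_rows[OF assms(1), symmetric] by (simp add: leg_map_def[of sc hatm] star_def case_prod_unfold)
  finally show ?thesis .
qed

end

section \<open>The two projections\<close>

context fodc
begin

lemma left_comb_additive: "Modules.additive (left_comb lm d)"
  by (simp add: Modules.additive_def left_comb_def lm_simps sum.distrib)

lemma left_comb_smult: "left_comb lm d (b *s v) = lm b (left_comb lm d v)"
  by (simp add: left_comb_def lm_simps additive.sum[OF lm_additive(1)])

lemma left_comb_axis: "left_comb lm d (axis k 1) = d k"
proof -
  have "left_comb lm d (axis k 1) = (\<Sum>i\<in>UNIV. if i = k then d k else 0)"
    unfolding left_comb_def axis_def by (intro sum.cong refl) (auto simp: lm_simps additive.zero[OF lm_additive(2)])
  thus ?thesis by simp
qed

text \<open>
  In a module presented by generators and relations, every relation becomes an equation between the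
  generators.
\<close>

lemma left_presented_zero:
  assumes "left_presented lm d R" "v \<in> R"
  shows "left_comb lm d v = 0"
proof -
  have "v \<in> left_comb lm d -` {0}"
    unfolding assms(1)[unfolded left_presented_def] by (rule hull_inc[OF assms(2)])
  thus ?thesis by simp
qed

lemma left_presented_eigen:
  assumes "left_presented lm d (eigen_rels (\<lambda>c v. scal A c *s v) M c (fam_prod (*s) (pgen A) (\<lambda>ij. axis ij 1)) \<union> E)"
  shows "leg_map (sc1 A) M (fam_prod lm (pgen A) d) k = sc1 A c (fam_prod lm (pgen A) d k)"
proof -
  let ?e = "fam_prod (*s) (pgen A) (\<lambda>ij. axis ij 1)"
  have "left_comb lm d (leg_map (\<lambda>c v. scal A c *s v) M ?e k - scal A c *s ?e k) = 0"
    by (rule left_presented_zero[OF assms]) (unfold eigen_rels_def, rule UnI1, rule rangeI)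
  moreover have "left_comb lm d (?e k) = fam_prod lm (pgen A) d k" for k
    by (simp add: fam_prod_def case_prod_unfold left_comb_smult left_comb_axis)
  moreover have "left_comb lm d (leg_map (\<lambda>c v. scal A c *s v) M ?e k) = leg_map (sc1 A) M (\<lambda>k. left_comb lm d (?e k)) k"
    by (rule leg_map_hom[where sc' = "sc1 A", OF left_comb_additive]) (simp add: left_comb_smult sc1_def)
  ultimately show ?thesis
    by (simp add: additive.diff[OF left_comb_additive] left_comb_smult sc1_def)
qed

lemma left_presented_trace:
  assumes "left_presented lm d (E \<union> {E'12 D (\<lambda>c v. scal A c *s v) (\<lambda>ij. axis ij 1)})"
  shows "(\<Sum>i\<in>UNIV. sc1 A (qpow D (wrho D i)) (d (i, i))) = 0"
proof -
  have "left_comb lm d (E'12 D (\<lambda>c v. scal A c *s v) (\<lambda>ij. axis ij 1)) = 0"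
    by (rule left_presented_zero[OF assms]) simp
  thus ?thesis
    by (simp add: E'12_def additive.sum[OF left_comb_additive] left_comb_smult left_comb_axis sc1_def)
qed

end

locale qps_fodc = fodc D A + qps_rep r q \<nu> \<phi> x y V D s wt
  for D :: "('n::finite) qps_data" and A :: "('n, 'b::ring_1, 'o::ab_group_add) calculus"
    and r :: nat and q :: real and \<nu> \<phi> x y V s wt
begin

abbreviation "pg \<equiv> pgen A"

lemma qpow_cw: "qpow D (cw D) = \<theta> * \<kappa>" "qpow D (- cw D) = 1 / (\<theta> * \<kappa>)"
proof -
  have w: "cw D = - (1 / (real r + 1)) + 1" by (simp add: cw_D)
  show "qpow D (cw D) = \<theta> * \<kappa>" unfolding qpow_D w by (simp only: cpow_add[OF q(1)] cpow_1[OF q(1)])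
  thus "qpow D (- cw D) = 1 / (\<theta> * \<kappa>)" unfolding qpow_D cpow_minus[OF q(1)] by simp
qed

lemma qpow_cm: "qpow D (cm D) = \<kappa> ^ r" "qpow D (- cm D) = 1 / \<kappa> ^ r"
  and qpow_ca: "qpow D (ca D) = \<kappa>\<^sup>2" "qpow D (- ca D) = 1 / \<kappa>\<^sup>2"
  unfolding qpow_D cm_D ca_D cpow_minus[OF q(1)] using cpow_nat[OF q(1), of r] cpow_nat[OF q(1), of 2] by simp_all

lemma pp_S234: "leg_map sc0 (S234 D) (fam_prod (*) pg pg) k = sc0 (1 / (\<theta> * \<kappa>)) (fam_prod (*) pg pg k)"
  and p_trace: "(\<Sum>i\<in>UNIV. sc0 (qq i) (pg (i, i))) = scal A (\<kappa> ^ r)"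
proof -
  let ?fs = "\<lambda>c v. fconst c * v" and ?ff = "fam_prod (*) fgen fgen"
  have ker: "bproj A -` {0} = two_sided_ideal hull (B_rels D)"
    using algB unfolding is_algebra_B_def by (elim conjE)
  have z: "bproj A v = 0" if "v \<in> B_rels D" for v
  proof -
    have "v \<in> bproj A -` {0}" unfolding ker by (rule hull_inc[OF that])
    thus ?thesis by simp
  qed
  have ff: "bproj A (?ff k) = fam_prod (*) pg pg k" for k
    by (simp add: fam_prod_def case_prod_unfold bproj_hom pgen_def)
  have sc: "bproj A (fconst c * v) = sc0 c (bproj A v)" for c v by (simp add: bproj_hom scal_def)
  have lm: "bproj A (leg_map ?fs M ?ff k) = leg_map sc0 M (fam_prod (*) pg pg) k" for M k
    using leg_map_hom[where f = "bproj A" and sc = ?fs and sc' = sc0 and z = ?ff and M = M and k = k, OF bproj_additive sc]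
    by (simp only: ff)
  have "leg_map ?fs (S234 D) ?ff k - ?fs (qpow D (- cw D)) (?ff k) \<in> B_rels D"
    unfolding B_rels_def eigen_rels_def Let_def by (rule UnI1, rule UnI2, rule rangeI)
  from z[OF this] show "leg_map sc0 (S234 D) (fam_prod (*) pg pg) k = sc0 (1 / (\<theta> * \<kappa>)) (fam_prod (*) pg pg k)"
    unfolding additive.diff[OF bproj_additive] lm sc ff qpow_cw by (simp only: right_minus_eq)
  have "E'12 D ?fs fgen - fconst (qpow D (cm D)) \<in> B_rels D"
    unfolding B_rels_def Let_def by (rule UnI2, rule singletonI)
  from z[OF this] show "(\<Sum>i\<in>UNIV. sc0 (qq i) (pg (i, i))) = scal A (\<kappa> ^ r)"
    unfolding additive.diff[OF bproj_additive] E'12_def additive.sum[OF bproj_additive] sc qpow_cm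
    unfolding qpow_D qq_wrho pgen_def[symmetric] scal_def[symmetric] by (simp only: right_minus_eq)
qed

lemma dp_S234: "leg_map (sc1 A) (S234 D) (fam_prod lm pg (dp A)) k = sc1 A (1 / (\<theta> * \<kappa>)) (fam_prod lm pg (dp A) k)"
  and bp_S123: "leg_map (sc1 A) (S123 D) (fam_prod lm pg (bp A)) k = sc1 A (\<theta> * \<kappa>) (fam_prod lm pg (bp A) k)"
  and dp_trace: "(\<Sum>i\<in>UNIV. sc1 A (qq i) (dp A (i, i))) = 0"
  and bp_trace: "(\<Sum>i\<in>UNIV. sc1 A (qq i) (bp A (i, i))) = 0"
proof -
  have "left_presented lm (dp A) (plus_rels D A)" "left_presented lm (bp A) (minus_rels D A)"
    using HK unfolding is_HK_calculus_def by - ((elim conjE), assumption)+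
  note P = this[unfolded plus_rels_def minus_rels_def Let_def]
  show "leg_map (sc1 A) (S234 D) (fam_prod lm pg (dp A)) k = sc1 A (1 / (\<theta> * \<kappa>)) (fam_prod lm pg (dp A) k)"
    "leg_map (sc1 A) (S123 D) (fam_prod lm pg (bp A)) k = sc1 A (\<theta> * \<kappa>) (fam_prod lm pg (bp A) k)"
    using left_presented_eigen[OF P(1)] left_presented_eigen[OF P(2)] by (simp_all only: qpow_cw)
  show "(\<Sum>i\<in>UNIV. sc1 A (qq i) (dp A (i, i))) = 0" "(\<Sum>i\<in>UNIV. sc1 A (qq i) (bp A (i, i))) = 0"
    using left_presented_trace[OF P(1)] left_presented_trace[OF P(2)] by (simp_all only: qpow_D qq_wrho)
qed

lemma bp_right: "rm (bp A (i, j)) (pg (k, l)) = sc1 A (1 / \<kappa>\<^sup>2) (leg_map (sc1 A) (T1234 D) (fam_prod lm pg (bp A)) (i, j, k, l))"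
  and dp_right: "rm (dp A (i, j)) (pg (k, l)) = sc1 A (\<kappa>\<^sup>2) (leg_map (sc1 A) (T1234 D) (fam_prod lm pg (dp A)) (i, j, k, l))"
proof -
  have "\<forall>k. fam_prod rm (dp A) pg k = sc1 A (qpow D (ca D)) (leg_map (sc1 A) (T1234 D) (fam_prod lm pg (dp A)) k)"
    "\<forall>k. fam_prod rm (bp A) pg k = sc1 A (qpow D (- ca D)) (leg_map (sc1 A) (T1234 D) (fam_prod lm pg (bp A)) k)"
    using HK unfolding is_HK_calculus_def by - ((elim conjE), assumption)+
  from this[THEN spec, of "(i, j, k, l)"] show
   "rm (bp A (i, j)) (pg (k, l)) = sc1 A (1 / \<kappa>\<^sup>2) (leg_map (sc1 A) (T1234 D) (fam_prod lm pg (bp A)) (i, j, k, l))"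
   "rm (dp A (i, j)) (pg (k, l)) = sc1 A (\<kappa>\<^sup>2) (leg_map (sc1 A) (T1234 D) (fam_prod lm pg (dp A)) (i, j, k, l))"
    unfolding qpow_ca fam_prod_def by simp_all
qed

lemma scale_cancel:
  fixes sc :: "complex \<Rightarrow> 'v \<Rightarrow> 'v::ab_group_add"
  assumes "module sc" "sc c u = sc c v" "c \<noteq> 0"
  shows "u = v"
proof -
  interpret module sc by fact
  have "sc (1 / c) (sc c u) = sc (1 / c) (sc c v)" by (simp only: assms(2))
  thus ?thesis using assms(3) by simp
qed

lemma mult_sum_sc0: "(\<Sum>c\<in>UNIV. sc0 (u c) (b * v c)) = b * (\<Sum>c\<in>UNIV. sc0 (u c) (v c :: 'b))" for u :: "'n \<Rightarrow> complex"
proof -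
  have "sc0 c (b * v') = b * sc0 c v'" for c v' by (simp only: mult.assoc[symmetric] scal_central)
  thus ?thesis by (simp add: sum_distrib_left)
qed

lemma lm_sum_sc1: "(\<Sum>c\<in>UNIV. sc1 A (u c) (lm b (v c))) = lm b (\<Sum>c\<in>UNIV. sc1 A (u c) (v c))" for u :: "'n \<Rightarrow> complex"
  by (simp add: lm_sc1[symmetric] additive.sum[OF lm_additive(1)])

lemma sum_sc_factor: "module sc \<Longrightarrow> (\<Sum>c\<in>UNIV. sc (d * u c) (v c)) = sc d (\<Sum>c\<in>UNIV. sc (u c) (v c))" for u :: "'n \<Rightarrow> complex"
  by (simp add: module.scale_sum_right module.scale_scale)

text \<open>
  Contracting the middle legs of a relation \<open>S~ x = q\<^sup>-\<^sup>w x\<close> turns the left side into a quantum trace of the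
  right factor, which is \<open>q\<^sup>r\<close> for \<open>p p\<close> and zero for \<open>p \<partial>p\<close>; a relation with \<open>S\<close> gives a trace of the left
  factor, for \<open>p \<partial>'p\<close>, and a second term which is absorbed by the other side.
\<close>

lemma p_p: "(\<Sum>j\<in>UNIV. pg (i, j) * pg (j, l)) = pg (i, l)"
proof (rule scale_cancel[OF module0])
  interpret module sc0 by (rule module0)
  have "sc0 (1 / (\<theta> * \<kappa>)) (\<Sum>j\<in>UNIV. pg (i, j) * pg (j, l)) = (\<Sum>j\<in>UNIV. leg_map sc0 (S234 D) (fam_prod (*) pg pg) (i, j, j, l))"
    unfolding pp_S234 scale_sum_right by (simp add: fam_prod_def)
  also have "\<dots> = sc0 (1 / (\<theta> * \<kappa> ^ (r + 1))) (pg (i, l) * (\<Sum>c\<in>UNIV. sc0 (qq c) (pg (c, c))))"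
    unfolding ev_S234[OF module0] fam_prod_def
    using sum_sc_factor[OF module0, of "1 / (\<theta> * \<kappa> ^ (r + 1))" qq "\<lambda>c. pg (i, l) * pg (c, c)"] mult_sum_sc0[of qq "pg (i, l)" "\<lambda>c. pg (c, c)"]
    by simp
  also have "\<dots> = sc0 (1 / (\<theta> * \<kappa> ^ (r + 1)) * \<kappa> ^ r) (pg (i, l))"
    unfolding p_trace scal_central[of "pg (i, l)"] by (simp add: mult.assoc)
  also have "1 / (\<theta> * \<kappa> ^ (r + 1)) * \<kappa> ^ r = 1 / (\<theta> * \<kappa>)" by simp
  finally show "sc0 (1 / (\<theta> * \<kappa>)) (\<Sum>j\<in>UNIV. pg (i, j) * pg (j, l)) = sc0 (1 / (\<theta> * \<kappa>)) (pg (i, l))" .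
qed simp

lemma p_dp: "(\<Sum>j\<in>UNIV. lm (pg (i, j)) (dp A (j, l))) = 0"
proof (rule scale_cancel[OF module1])
  interpret module "sc1 A" by (rule module1)
  have "sc1 A (1 / (\<theta> * \<kappa>)) (\<Sum>j\<in>UNIV. lm (pg (i, j)) (dp A (j, l))) = (\<Sum>j\<in>UNIV. leg_map (sc1 A) (S234 D) (fam_prod lm pg (dp A)) (i, j, j, l))"
    unfolding dp_S234 scale_sum_right by (simp add: fam_prod_def)
  also have "\<dots> = sc1 A (1 / (\<theta> * \<kappa> ^ (r + 1))) (lm (pg (i, l)) (\<Sum>c\<in>UNIV. sc1 A (qq c) (dp A (c, c))))"
    unfolding ev_S234[OF module1] fam_prod_def
    using sum_sc_factor[OF module1, of "1 / (\<theta> * \<kappa> ^ (r + 1))" qq "\<lambda>c. lm (pg (i, l)) (dp A (c, c))"] lm_sum_sc1[of qq "pg (i, l)" "\<lambda>c. dp A (c, c)"]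
    by simp
  finally show "sc1 A (1 / (\<theta> * \<kappa>)) (\<Sum>j\<in>UNIV. lm (pg (i, j)) (dp A (j, l))) = sc1 A (1 / (\<theta> * \<kappa>)) 0"
    by (simp add: dp_trace additive.zero[OF lm_additive(1)])
qed simp

lemma p_bp: "(\<Sum>j\<in>UNIV. lm (pg (i, j)) (bp A (j, l))) = bp A (i, l)"
proof (rule scale_cancel[OF module1])
  interpret module "sc1 A" by (rule module1)
  let ?S = "\<Sum>j\<in>UNIV. lm (pg (i, j)) (bp A (j, l))"
  have "sc1 A (\<theta> * \<kappa>) ?S = (\<Sum>j\<in>UNIV. leg_map (sc1 A) (S123 D) (fam_prod lm pg (bp A)) (i, j, j, l))"
    unfolding bp_S123 scale_sum_right by (simp add: fam_prod_def)
  also have "\<dots> = sc1 A (\<theta> / \<kappa> ^ (r + 1)) (lm (\<Sum>b\<in>UNIV. sc0 (qq b) (pg (b, b))) (bp A (i, l))) + sc1 A (\<theta> * h) ?S"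
    unfolding ev_S123[OF module1] fam_prod_def
    using sum_sc_factor[OF module1, of "\<theta> / \<kappa> ^ (r + 1)" qq "\<lambda>b. lm (pg (b, b)) (bp A (i, l))"]
    by (simp add: additive.sum[OF lm_additive(2)] lm_sc0)
  also have "\<dots> = sc1 A (\<theta> / \<kappa> ^ (r + 1) * \<kappa> ^ r) (bp A (i, l)) + sc1 A (\<theta> * h) ?S"
    unfolding p_trace by (simp add: sc1_def[of A "\<kappa> ^ r", symmetric])
  finally have "sc1 A (\<theta> * \<kappa> - \<theta> * h) ?S = sc1 A (\<theta> / \<kappa> ^ (r + 1) * \<kappa> ^ r) (bp A (i, l))"
    unfolding scale_left_diff_distrib by simp
  moreover have "\<theta> * \<kappa> - \<theta> * h = \<theta> / \<kappa>" by (simp add: h_def right_diff_distrib)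
  moreover have "\<theta> / \<kappa> ^ (r + 1) * \<kappa> ^ r = \<theta> / \<kappa>" by simp
  ultimately show "sc1 A (\<theta> / \<kappa>) ?S = sc1 A (\<theta> / \<kappa>) (bp A (i, l))" by simp
qed simp

lemma derivations: "is_derivation A (del A)" "del A (pg k) = dp A k" "is_derivation A (delbar A)" "delbar A (pg k) = bp A k"
proof -
  have "is_derivation A (del A)" "\<forall>ij. del A (pg ij) = dp A ij" "is_derivation A (delbar A)" "\<forall>ij. delbar A (pg ij) = bp A ij"
    using HK unfolding is_HK_calculus_def by - ((elim conjE), assumption)+
  thus "is_derivation A (del A)" "del A (pg k) = dp A k" "is_derivation A (delbar A)" "delbar A (pg k) = bp A k"
    by blast+
qed

text \<open>Differentiating \<open>P P = P\<close> gives the right multiplications by \<open>P\<close> from the left ones.\<close>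

lemma derivation_idempotent:
  assumes f: "is_derivation A f" and PP: "\<And>i l. (\<Sum>j\<in>UNIV. P (i, j) * P (j, l)) = (P (i, l) :: 'b)" and fP: "\<And>k. f (P k) = Z k"
  shows "(\<Sum>j\<in>UNIV. rm (Z (i, j)) (P (j, l))) = Z (i, l) - (\<Sum>j\<in>UNIV. lm (P (i, j)) (Z (j :: 'n, l)))"
proof -
  have "Modules.additive f" using f by (simp add: Modules.additive_def is_derivation_def)
  hence "f (\<Sum>j\<in>UNIV. P (i, j) * P (j, l)) = (\<Sum>j\<in>UNIV. rm (Z (i, j)) (P (j, l)) + lm (P (i, j)) (Z (j, l)))"
    using f by (simp add: additive.sum is_derivation_def fP)
  thus ?thesis by (simp add: PP fP sum.distrib)
qed

lemma dp_p: "(\<Sum>j\<in>UNIV. rm (dp A (i, j)) (pg (j, l))) = dp A (i, l)"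
  and bp_p: "(\<Sum>j\<in>UNIV. rm (bp A (i, j)) (pg (j, l))) = 0"
  using derivation_idempotent[OF derivations(1) p_p derivations(2)] derivation_idempotent[OF derivations(3) p_p derivations(4)]
  by (simp_all add: p_dp p_bp)

text \<open>
  The forms \<open>a \<partial>'p\<close> are combinations of forms \<open>a db\<close> because \<open>\<partial>'p = p dp\<close>, and then so are the forms
  \<open>a \<partial>p = a dp - a \<partial>'p\<close>.
\<close>

lemma dif_spans_all:
  assumes zero: "P 0" and add: "\<And>u v. P u \<Longrightarrow> P v \<Longrightarrow> P (u + v)" and d: "\<And>a b. P (lm a (dif A b))"
  shows "P z"
proof -
  have sm: "P (\<Sum>i\<in>I. g i)" if "finite I" "\<And>i. P (g i)" for I :: "'k set" and g
    using that by (induction I rule: finite_induct) (auto intro: zero add)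
  have b: "P (lm a (bp A (i, l)))" for a i l
  proof -
    have "bp A (i, l) = (\<Sum>j\<in>UNIV. lm (pg (i, j)) (dif A (pg (j, l))))"
      by (simp add: dif_pgen lm_simps sum.distrib p_dp p_bp)
    hence e: "lm a (bp A (i, l)) = (\<Sum>j\<in>UNIV. lm (a * pg (i, j)) (dif A (pg (j, l))))"
      by (simp add: additive.sum[OF lm_additive(1)] lm_simps)
    have "finite I \<Longrightarrow> P (\<Sum>j\<in>I. lm (a * pg (i, j)) (dif A (pg (j, l))))" for I
      by (induction I rule: finite_induct) (auto intro: zero add d)
    thus ?thesis by (simp add: e)
  qed
  have dd: "P (lm a (dp A k))" for a k
  proof -
    obtain i l where k: "k = (i, l)" by fastforce
    have "lm a (dp A k) = lm a (dif A (pg k)) + lm (- a) (bp A k)"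
      by (simp add: dif_pgen lm_simps additive.minus[OF lm_additive(2)])
    thus ?thesis using add[OF d b[of "- a" i l]] by (simp add: k)
  qed
  obtain u v where z: "u \<in> Omega_plus A" "v \<in> Omega_minus A" "z = u + v" using Omega_split[of z] by blast
  have "finite I \<Longrightarrow> P (\<Sum>k\<in>I. lm (c $ k) (dp A k))" "finite I \<Longrightarrow> P (\<Sum>k\<in>I. lm (c $ k) (bp A k))" for I :: "('n \<times> 'n) set" and c :: "'b^('n \<times> 'n)"
    by (induction I rule: finite_induct) (auto intro: zero add dd b)
  hence "P u" "P v" using z(1,2) by (auto simp: Omega_plus_def Omega_minus_def left_comb_def)
  thus ?thesis using add z(3) by blast
qed

text \<open>
  The second projection and its two differentials, in the basis in which the twisted product is the
  product of matrices.
\<close>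

abbreviation "ph \<equiv> leg_map sc0 hatm pg"
abbreviation "dph \<equiv> leg_map (sc1 A) hatm (dp A)"
abbreviation "bph \<equiv> leg_map (sc1 A) hatm (bp A)"

text \<open>
  Where \<open>S~\<close> acts as a scalar, \<open>star\<close> is the product with the quantum trace of the left factor. This
  settles \<open>p p\<close> and \<open>p \<partial>p\<close>. For \<open>p \<partial>'p\<close> there is no relation with \<open>S~\<close>; there \<open>star\<close> is obtained
  from the matrix product \<open>\<partial>'p p = 0\<close> by the right module structure.
\<close>

lemma star_eigen:
  assumes "module sc" "\<And>k. leg_map sc (S234 D) z k = sc (1 / (\<theta> * \<kappa>)) (z k)"
  shows "star sc z (k, l) = (\<Sum>i\<in>UNIV. sc (qq i / \<kappa> ^ r) (z (i, i, k, l)))"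
proof -
  interpret module sc by fact
  show ?thesis by (simp add: star_def assms(2))
qed

lemma star_p_p: "star sc0 (fam_prod (*) pg pg) = pg"
proof
  fix m :: "'n \<times> 'n"
  obtain k l where m: "m = (k, l)" by fastforce
  interpret module sc0 by (rule module0)
  have "star sc0 (fam_prod (*) pg pg) (k, l) = sc0 (1 / \<kappa> ^ r) ((\<Sum>i\<in>UNIV. sc0 (qq i) (pg (i, i))) * pg (k, l))"
    unfolding star_eigen[OF module0 pp_S234] by (simp add: fam_prod_def sum_distrib_right scale_sum_right mult.assoc)
  thus "star sc0 (fam_prod (*) pg pg) m = pg m"
    by (simp add: m p_trace mult.assoc[symmetric] scal_hom(4)[symmetric] del: scal_hom(4))
qed

lemma star_p_dp: "star (sc1 A) (fam_prod lm pg (dp A)) = dp A"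
proof
  fix m :: "'n \<times> 'n"
  obtain k l where m: "m = (k, l)" by fastforce
  interpret module "sc1 A" by (rule module1)
  have "star (sc1 A) (fam_prod lm pg (dp A)) (k, l) = sc1 A (1 / \<kappa> ^ r) (lm (\<Sum>i\<in>UNIV. sc0 (qq i) (pg (i, i))) (dp A (k, l)))"
    unfolding star_eigen[OF module1 dp_S234]
    by (simp add: fam_prod_def additive.sum[OF lm_additive(2)] lm_sc0 scale_sum_right)
  also have "\<dots> = sc1 A (1 / \<kappa> ^ r * \<kappa> ^ r) (dp A (k, l))"
    unfolding p_trace by (simp add: sc1_def[of A "\<kappa> ^ r", symmetric])
  finally show "star (sc1 A) (fam_prod lm pg (dp A)) m = dp A m" by (simp add: m)
qed

lemma star_p_bp: "star (sc1 A) (fam_prod lm pg (bp A)) = (\<lambda>_. 0)"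
proof
  fix m :: "'n \<times> 'n"
  obtain i l where m: "m = (i, l)" by fastforce
  interpret module "sc1 A" by (rule module1)
  let ?z = "fam_prod lm pg (bp A)"
  have "sc1 A (1 / \<kappa>\<^sup>2) (\<Sum>j\<in>UNIV. leg_map (sc1 A) (T1234 D) ?z (i, j, j, l)) = 0"
    using bp_p[of i l] by (simp add: bp_right scale_sum_right)
  hence "sc1 A (1 / \<kappa>\<^sup>2) (\<Sum>j\<in>UNIV. leg_map (sc1 A) (T1234 D) ?z (i, j, j, l)) = sc1 A (1 / \<kappa>\<^sup>2) 0" by simp
  hence 1: "(\<Sum>j\<in>UNIV. leg_map (sc1 A) (T1234 D) ?z (i, j, j, l)) = 0"
    by (rule scale_cancel[OF module1]) simp
  have "(\<Sum>c\<in>UNIV. sc1 A (h / \<kappa> ^ (r + 1) * qq c) (?z (i, l, c, c))) = sc1 A (h / \<kappa> ^ (r + 1)) (lm (pg (i, l)) (\<Sum>c\<in>UNIV. sc1 A (qq c) (bp A (c, c))))"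
    using sum_sc_factor[OF module1, of "h / \<kappa> ^ (r + 1)" qq "\<lambda>c. lm (pg (i, l)) (bp A (c, c))"] lm_sum_sc1[of qq "pg (i, l)" "\<lambda>c. bp A (c, c)"]
    by (simp add: fam_prod_def)
  hence "(\<Sum>c\<in>UNIV. sc1 A (h / \<kappa> ^ (r + 1) * qq c) (?z (i, l, c, c))) = 0"
    by (simp add: bp_trace additive.zero[OF lm_additive(1)])
  hence "sc1 A (1 / \<kappa>\<^sup>2) (star (sc1 A) ?z (i, l)) = sc1 A (1 / \<kappa>\<^sup>2) 0"
    using ev_T1234[OF module1, of ?z i l] 1 by simp
  hence "star (sc1 A) ?z (i, l) = 0" by (rule scale_cancel[OF module1]) simp
  thus "star (sc1 A) ?z m = 0" by (simp add: m)
qed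

lemma mult_bi: "Modules.additive ((*) (u::'b))" "Modules.additive (\<lambda>u. u * (v::'b))"
   "(sc0 c u) * v = sc0 c (u * v)" "u * (sc0 c v) = sc0 c (u * v)"
  by (auto simp: Modules.additive_def distrib_left distrib_right mult.assoc)
     (simp only: mult.assoc[symmetric] scal_central)

lemma ph_ph: "(\<Sum>j\<in>UNIV. ph (i, j) * ph (j, l)) = ph (i, l)"
  using hat_star[OF module0, of "(*)" sc0 sc0 pg i pg l] mult_bi by (simp add: star_p_p)

lemma ph_dph: "(\<Sum>j\<in>UNIV. lm (ph (i, j)) (dph (j, l))) = dph (i, l)"
  using hat_star[OF module1, of lm sc0 "sc1 A" pg i "dp A" l] lm_additive lm_sc0 lm_sc1 by (simp add: star_p_dp)

lemma ph_bph: "(\<Sum>j\<in>UNIV. lm (ph (i, j)) (bph (j, l))) = 0"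
proof -
  interpret module "sc1 A" by (rule module1)
  show ?thesis
    using hat_star[OF module1, of lm sc0 "sc1 A" pg i "bp A" l] lm_additive lm_sc0 lm_sc1
    by (simp add: star_p_bp leg_map_def)
qed

lemma derivation_hat:
  assumes "is_derivation A f" "\<And>k. f (pg k) = Z k"
  shows "f (ph k) = leg_map (sc1 A) hatm Z k"
proof -
  have "Modules.additive f" using assms by (simp add: Modules.additive_def is_derivation_def)
  moreover have "f (sc0 c b) = sc1 A c (f b)" for c b
    using assms(1) by (simp add: is_derivation_def sc1_def additive.zero[OF rm_additive(1)])
  ultimately show ?thesis using leg_map_hom[of f sc0 "sc1 A" hatm pg k] assms(2) by simp
qed

lemma dph_ph: "(\<Sum>j\<in>UNIV. rm (dph (i, j)) (ph (j, l))) = 0"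
  and bph_ph: "(\<Sum>j\<in>UNIV. rm (bph (i, j)) (ph (j, l))) = bph (i, l)"
  using derivation_idempotent[OF derivations(1) ph_ph derivation_hat[OF derivations(1,2)]]
    derivation_idempotent[OF derivations(3) ph_ph derivation_hat[OF derivations(3,4)]]
  by (simp_all add: ph_dph ph_bph)

lemma dif_ph: "dif A (ph k) = bph k + dph k"
  using derivation_hat[OF derivations(1,2)] derivation_hat[OF derivations(3,4)] by (simp add: dif_def)

lemma bph_trace: "(\<Sum>i\<in>UNIV. sc1 A (\<kappa> ^ (2 * r) / qq i) (bph (i, i))) = 0"
  and ph_trace: "(\<Sum>i\<in>UNIV. sc0 (\<kappa> ^ (2 * r) / qq i) (ph (i, i))) = scal A (\<kappa> ^ r)"
  unfolding trace_hat[OF module1] trace_hat[OF module0] by (rule bp_trace p_trace)+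

lemma in_Omega: "dp A k \<in> Omega_plus A" "bp A k \<in> Omega_minus A"
  unfolding Omega_plus_def Omega_minus_def by (rule image_eqI[of _ _ "axis k 1"]; simp add: left_comb_axis)+

end

section \<open>The Ricci tensor of quantum projective space\<close>

text \<open>
  \<open>sw\<close> is the splitting map with the coefficients \<open>cpm\<close> and \<open>cmp\<close>, and \<open>sig\<close> the generalized braiding.
\<close>

locale qps_ricci = ricci_setup D A t \<pi> t21 t3 t4 t4' d1 ip nab sw + qps_fodc D A r q \<nu> \<phi> x y V s wt
  for D :: "('n::finite) qps_data" and A :: "('n, 'b::ring_1, 'o::ab_group_add) calculus"
    and t :: "'o \<Rightarrow> 'o \<Rightarrow> 't::ab_group_add" and \<pi> :: "'t \<Rightarrow> 'w::ab_group_add"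
    and t21 :: "'w \<Rightarrow> 'o \<Rightarrow> 'u::ab_group_add" and t3 :: "'t \<Rightarrow> 'o \<Rightarrow> 'x::ab_group_add"
    and t4 :: "'o \<Rightarrow> 'u \<Rightarrow> 'y::ab_group_add" and t4' :: "'o \<Rightarrow> 'x \<Rightarrow> 'z::ab_group_add"
    and d1 ip nab sw r q \<nu> \<phi> x y V s wt +
  fixes sig :: "'t \<Rightarrow> 't" and cpm cmp :: complex
  assumes metric: "is_inverse_metric D A t ip" and levi_civita: "is_levi_civita D A t nab"
    and braiding: "is_gen_braiding D A t sig" and splitting: "is_splitting D A t \<pi> sig cpm cmp sw"
begin

abbreviation "scT \<equiv> sc2 A t"

lemma qpow_wm: "qpow D (- cw D - cm D) = 1 / (\<theta> * \<kappa> * \<kappa> ^ r)"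
proof -
  have "qpow D (- cw D - cm D) = qpow D (- cw D) / qpow D (cm D)"
    unfolding qpow_D by (rule cpow_diff[OF q(1)])
  thus ?thesis unfolding qpow_cw qpow_cm by simp
qed

lemma ip_values:
  "ip (t (dp A k) (dp A k')) = 0" "ip (t (bp A k) (bp A k')) = 0"
  "ip (t (dp A (i, j)) (bp A (k'', l))) = sc0 (\<kappa>\<^sup>2 * (1 / (\<theta> * \<kappa> * \<kappa> ^ r))) (leg_map sc0 (S123 D) (C3 pg) (i, j, k'', l)) -
     sc0 (\<kappa>\<^sup>2 * (1 / \<kappa> ^ r)) (pg (i, j) * pg (k'', l))"
  "ip (t (bp A (i, j)) (dp A (k'', l))) = C'2 D sc0 pg (i, j, k'', l) - sc0 (1 / \<kappa> ^ r) (pg (i, j) * pg (k'', l))"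
proof -
  note M = metric[unfolded is_inverse_metric_def Let_def]
  have z: "\<forall>k. ip (fam_prod t (dp A) (dp A) k) = 0" "\<forall>k. ip (fam_prod t (bp A) (bp A) k) = 0"
    "\<forall>k. ip (fam_prod t (dp A) (bp A) k) =
         scal A (qpow D (ca D) * qpow D (- cw D - cm D)) * leg_map sc0 (S123 D) (C3 pg) k
           - scal A (qpow D (ca D) * qpow D (- cm D)) * fam_prod (*) pg pg k"
    "\<forall>k. ip (fam_prod t (bp A) (dp A) k) = C'2 D sc0 pg k - scal A (qpow D (- cm D)) * fam_prod (*) pg pg k"
    using M by - ((elim conjE), assumption)+
  obtain a b c d where k: "k = (a, b)" "k' = (c, d)" by fastforce
  show "ip (t (dp A k) (dp A k')) = 0" "ip (t (bp A k) (bp A k')) = 0"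
    using z(1,2)[THEN spec, of "(a, b, c, d)"] by (simp_all add: k fam_prod_def)
  show "ip (t (dp A (i, j)) (bp A (k'', l))) = sc0 (\<kappa>\<^sup>2 * (1 / (\<theta> * \<kappa> * \<kappa> ^ r))) (leg_map sc0 (S123 D) (C3 pg) (i, j, k'', l)) -
     sc0 (\<kappa>\<^sup>2 * (1 / \<kappa> ^ r)) (pg (i, j) * pg (k'', l))"
    using z(3)[THEN spec, of "(i, j, k'', l)"] unfolding qpow_wm qpow_ca qpow_cm fam_prod_def by simp
  show "ip (t (bp A (i, j)) (dp A (k'', l))) = C'2 D sc0 pg (i, j, k'', l) - sc0 (1 / \<kappa> ^ r) (pg (i, j) * pg (k'', l))"
    using z(4)[THEN spec, of "(i, j, k'', l)"] unfolding qpow_cm fam_prod_def by simp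
qed

text \<open>
  The two matrix products of differentials under the inverse metric, in the ordinary and in the
  twisted sense, are multiples of \<open>1 - P\<close> for the respective projection \<open>P\<close>. The unit matrix arises
  from the inserted invariant vector.
\<close>

lemma ip_dp_bp: "(\<Sum>j\<in>UNIV. ip (t (dp A (i, j)) (bp A (j, k)))) = scal A (1 / \<kappa> ^ r) * (of_bool (i = k) - pg (i, k))"
proof -
  interpret module sc0 by (rule module0)
  let ?c = "\<kappa>\<^sup>2 * (1 / (\<theta> * \<kappa> * \<kappa> ^ r))"
  have 1: "(\<Sum>b\<in>UNIV. sc0 (\<theta> / \<kappa> ^ (r + 1) * qq b) (C3 pg (b, b, i, k))) = sc0 (\<theta> / \<kappa> ^ (r + 1)) (scal A (\<kappa> ^ r) * of_bool (i = k))"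
    using sum_sc_factor[OF module0, of "\<theta> / \<kappa> ^ (r + 1)" qq "\<lambda>b. pg (b, b)"] by (auto simp: C3_def p_trace scal_hom(4)[symmetric] simp del: scal_hom(4))
  have 2: "(\<Sum>j\<in>UNIV. C3 pg (i, j, j, k)) = pg (i, k)" by (simp add: C3_def)
  have "(\<Sum>j\<in>UNIV. ip (t (dp A (i, j)) (bp A (j, k)))) =
     sc0 ?c (\<Sum>j\<in>UNIV. leg_map sc0 (S123 D) (C3 pg) (i, j, j, k)) - sc0 (\<kappa>\<^sup>2 * (1 / \<kappa> ^ r)) (\<Sum>j\<in>UNIV. pg (i, j) * pg (j, k))"
    unfolding ip_values sum_subtractf scale_sum_right ..
  also have "\<dots> = sc0 (?c * (\<theta> / \<kappa> ^ (r + 1)) * \<kappa> ^ r) (of_bool (i = k)) - sc0 (\<kappa>\<^sup>2 * (1 / \<kappa> ^ r) - ?c * (\<theta> * h)) (pg (i, k))"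
    unfolding ev_S123[OF module0] 1 2 p_p by (simp only: scale_right_distrib scale_left_diff_distrib scale_scale) (simp add: mult_ac)
  also have "?c * (\<theta> / \<kappa> ^ (r + 1)) * \<kappa> ^ r = 1 / \<kappa> ^ r" by (simp add: power2_eq_square)
  also have "\<kappa>\<^sup>2 * (1 / \<kappa> ^ r) - ?c * (\<theta> * h) = 1 / \<kappa> ^ r"
  proof -
    have e: "?c * (\<theta> * h) = \<kappa> * h / \<kappa> ^ r" by (simp add: power2_eq_square)
    show ?thesis unfolding e by (simp add: h_def power2_eq_square field_simps)
  qed
  finally show ?thesis by (simp add: right_diff_distrib)
qed

lemma star_cup: "star sc0 (C'2 D sc0 pg) (k, l) = scal A (\<kappa>\<^sup>2 * \<kappa> ^ r) * of_bool (k = l) - sc0 (h * \<kappa> / \<kappa> ^ r) (pg (k, l))"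
proof -
  interpret module sc0 by (rule module0)
  have C: "C'2 D sc0 pg (a, b, c, d) = (if b = c then sc0 (1 / qq b) (pg (a, d)) else 0)" for a b c d
    by (simp add: C'2_def qpow_D qq_wrho)
  have L: "leg_map sc0 (S234 D) (C'2 D sc0 pg) (i, i, k, l) =
     (if k = l then sc0 (\<kappa> ^ (r + 1) / \<theta>) (pg (i, i)) else 0) - (if i = k then sc0 (h / \<theta> / qq i) (pg (i, l)) else 0)" for i
  proof -
    have "leg_map sc0 (S234 D) (C'2 D sc0 pg) (i, i, k, l) =
      (\<Sum>b\<in>UNIV. \<Sum>d\<in>UNIV. sc0 (Stm $ (i, k, l) $ (b, b, d) / qq b) (pg (i, d)))"
      unfolding leg_map_def sum_pair_UNIV S234_entry C
      by (simp only: if_distrib[of "\<lambda>c. scal A c * _"] if_distrib[of "(*) _"] scale_zero_left mult_zero_right scal_hom(1) mult_zero_left if_conj_sum cong: if_cong)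
         (simp add: mult.assoc[symmetric] scal_hom(4)[symmetric] if_conj_sum del: scal_hom(4) cong: if_cong)
    also have "\<dots> = (\<Sum>d\<in>UNIV. sc0 (\<Sum>b\<in>UNIV. Stm $ (i, k, l) $ (b, b, d) / qq b) (pg (i, d)))"
      by (subst sum.swap) (simp add: scale_sum_left)
    also have "\<dots> = (\<Sum>d\<in>UNIV. (if d = i then if k = l then sc0 (\<kappa> ^ (r + 1) / \<theta>) (pg (i, i)) else 0 else 0)
       - (if d = l then if i = k then sc0 (h / \<theta> / qq i) (pg (i, l)) else 0 else 0))"
      unfolding Stm_cup_entry by (intro sum.cong refl) (auto simp: left_diff_distrib)
    finally show ?thesis by (simp add: sum_subtractf)
  qed
  let ?g = "\<theta> * \<kappa> / \<kappa> ^ r"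
  have "star sc0 (C'2 D sc0 pg) (k, l) = (\<Sum>i\<in>UNIV. sc0 (\<kappa>\<^sup>2 * qq i) (if k = l then pg (i, i) else 0)
     - (if i = k then sc0 (h * \<kappa> / \<kappa> ^ r) (pg (k, l)) else 0))"
    unfolding star_def case_prod_conv L
    by (intro sum.cong refl; cases "k = l"; simp add: scale_right_diff_distrib power2_eq_square mult_ac del: scal_hom(4))
  also have "\<dots> = sc0 (\<kappa>\<^sup>2) (\<Sum>i\<in>UNIV. sc0 (qq i) (if k = l then pg (i, i) else 0)) - sc0 (h * \<kappa> / \<kappa> ^ r) (pg (k, l))"
    unfolding sum_subtractf sum_sc_factor[OF module0] by simp
  finally show ?thesis by (auto simp: p_trace)
qed

lemma leg_map_zero: "module sc \<Longrightarrow> leg_map sc M (\<lambda>_. 0) k = 0"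
  by (simp add: leg_map_def module.scale_zero_right)

lemma leg_map_diff: "module sc \<Longrightarrow> leg_map sc M (\<lambda>k. u k - w k) k = leg_map sc M u k - leg_map sc M w k"
  by (simp add: leg_map_def module.scale_right_diff_distrib sum_subtractf)

lemma leg_map_scale: "module sc \<Longrightarrow> leg_map sc M (\<lambda>k. sc c (w k)) k = sc c (leg_map sc M w k)"
  by (simp add: leg_map_def module.scale_sum_right module.scale_scale mult.commute)

lemma star_diff_scale: "module sc \<Longrightarrow> star sc (\<lambda>k. u k - sc c (w k)) m = star sc u m - sc c (star sc w m)"
  by (simp add: star_def case_prod_unfold leg_map_diff leg_map_scale module.scale_right_diff_distrib sum_subtractf
      module.scale_sum_right module.scale_scale mult.commute)

lemma ip_bph_dph: "(\<Sum>j\<in>UNIV. ip (t (bph (e, j)) (dph (j, f)))) = scal A (\<kappa>\<^sup>2 / \<kappa> ^ r) * (of_bool (e = f) - ph (e, f))"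
proof -
  interpret module sc0 by (rule module0)
  have "(\<Sum>j\<in>UNIV. ip (t (bph (e, j)) (dph (j, f)))) = leg_map sc0 hatm (star sc0 (fam_prod (\<lambda>u v. ip (t u v)) (bp A) (dp A))) (e, f)"
  proof (rule hat_star[OF module0])
    show "Modules.additive (\<lambda>v. ip (t u v))" "Modules.additive (\<lambda>u. ip (t u v))" for u v
      by (auto simp: Modules.additive_def t_add ip_t)
    have sc: "ip (scT c z) = sc0 c (ip z)" for c z by (simp add: sc2_def ip_simps)
    show "ip (t (sc1 A c u) v) = sc0 c (ip (t u v))" "ip (t u (sc1 A c v)) = sc0 c (ip (t u v))" for c u v
      by (simp_all only: t_sc sc)
  qed
  also have "fam_prod (\<lambda>u v. ip (t u v)) (bp A) (dp A) = (\<lambda>k. C'2 D sc0 pg k - sc0 (1 / \<kappa> ^ r) (fam_prod (*) pg pg k))"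
    by (auto simp: fun_eq_iff fam_prod_def ip_values)
  also have "star sc0 \<dots> = (\<lambda>m. scal A (\<kappa>\<^sup>2 * \<kappa> ^ r) * of_bool (fst m = snd m) - sc0 (h * \<kappa> / \<kappa> ^ r + 1 / \<kappa> ^ r) (pg m))"
  proof
    fix m :: "'n \<times> 'n"
    obtain k l where m: "m = (k, l)" by fastforce
    show "star sc0 (\<lambda>k. C'2 D sc0 pg k - sc0 (1 / \<kappa> ^ r) (fam_prod (*) pg pg k)) m =
      scal A (\<kappa>\<^sup>2 * \<kappa> ^ r) * of_bool (fst m = snd m) - sc0 (h * \<kappa> / \<kappa> ^ r + 1 / \<kappa> ^ r) (pg m)"
      unfolding star_diff_scale[OF module0] star_p_p m star_cup by (simp add: distrib_right)
  qed
  also have "h * \<kappa> / \<kappa> ^ r + 1 / \<kappa> ^ r = \<kappa>\<^sup>2 / \<kappa> ^ r"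
    by (simp add: h_def power2_eq_square field_simps)
  also have "leg_map sc0 hatm (\<lambda>m. scal A (\<kappa>\<^sup>2 * \<kappa> ^ r) * of_bool (fst m = snd m) - sc0 (\<kappa>\<^sup>2 / \<kappa> ^ r) (pg m)) (e, f) =
      leg_map sc0 hatm (\<lambda>m. scal A (\<kappa>\<^sup>2 * \<kappa> ^ r) * of_bool (fst m = snd m)) (e, f) - sc0 (\<kappa>\<^sup>2 / \<kappa> ^ r) (ph (e, f))"
    unfolding leg_map_diff[OF module0] leg_map_scale[OF module0] ..
  also have "leg_map sc0 hatm (\<lambda>m. scal A (\<kappa>\<^sup>2 * \<kappa> ^ r) * of_bool (fst m = snd m)) (e, f) =
     sc0 (\<Sum>k\<in>UNIV. hatm $ (e, f) $ (k, k)) (scal A (\<kappa>\<^sup>2 * \<kappa> ^ r))"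
    unfolding leg_map_def sum_pair_UNIV scale_sum_left
    by (simp add: of_bool_def if_distrib[of "(*) _"] cong: if_cong del: scal_hom(4))
  also have "\<dots> = scal A (\<kappa>\<^sup>2 / \<kappa> ^ r) * of_bool (e = f)"
    unfolding hat_delta by (simp add: scal_hom(4)[symmetric] kappa_2r del: scal_hom(4))
  finally show ?thesis by (simp add: right_diff_distrib)
qed

lemma nab_values:
  "nab (dp A k) = scT (\<kappa>\<^sup>2) (E23 (leg_map scT (T1234 D) (fam_prod t (bp A) (dp A))) k) - scT (\<kappa>\<^sup>2 * (1 / \<kappa> ^ r)) (lm2 (pg k) (g_mp D A t))"
  "nab (bp A k) = E23 (fam_prod t (dp A) (bp A)) k - scT (1 / \<kappa> ^ r) (lm2 (pg k) (g_pm D A t))"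
proof -
  have "\<forall>k. nab (dp A k) = scT (qpow D (ca D)) (E23 (leg_map scT (T1234 D) (fam_prod t (bp A) (dp A))) k)
           - scT (qpow D (ca D) * qpow D (- cm D)) (lm2 (pg k) (g_mp D A t))"
    "\<forall>k. nab (bp A k) = E23 (fam_prod t (dp A) (bp A)) k - scT (qpow D (- cm D)) (lm2 (pg k) (g_pm D A t))"
    using levi_civita[unfolded is_levi_civita_def Let_def] by - ((elim conjE), assumption)+
  from this[THEN spec, of k] show
    "nab (dp A k) = scT (\<kappa>\<^sup>2) (E23 (leg_map scT (T1234 D) (fam_prod t (bp A) (dp A))) k) - scT (\<kappa>\<^sup>2 * (1 / \<kappa> ^ r)) (lm2 (pg k) (g_mp D A t))"
    "nab (bp A k) = E23 (fam_prod t (dp A) (bp A)) k - scT (1 / \<kappa> ^ r) (lm2 (pg k) (g_pm D A t))"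
    by (simp_all only: qpow_ca qpow_cm)
qed

lemma t_trace: "(\<Sum>c\<in>UNIV. scT (u c) (t v (w c))) = t v (\<Sum>c\<in>UNIV. sc1 A (u c) (w c))" for u :: "'n \<Rightarrow> complex"
  by (simp add: t_sum t_sc)

text \<open>
  The connection on \<open>\<partial>p\<close> is defined with the operator \<open>T\<close>, hence with the twisted product; after the
  change of basis it has the same form as the connection on \<open>\<partial>'p\<close>.
\<close>

lemma nab_dp: "nab (dp A k) = star scT (fam_prod t (bp A) (dp A)) k - scT (\<kappa>\<^sup>2 / \<kappa> ^ r) (lm2 (pg k) (g_mp D A t))"
proof -
  interpret module scT by (rule module2)
  obtain i l where k: "k = (i, l)" by fastforce
  let ?z = "fam_prod t (bp A) (dp A)"
  have "(\<Sum>c\<in>UNIV. scT (h / \<kappa> ^ (r + 1) * qq c) (?z (i, l, c, c))) = 0"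
    unfolding sum_sc_factor[OF module2] fam_prod_def by (simp add: t_trace dp_trace t_0)
  hence "E23 (leg_map scT (T1234 D) ?z) k = scT (1 / \<kappa>\<^sup>2) (star scT ?z k)"
    using ev_T1234[OF module2, of ?z i l] by (simp add: E23_def k)
  thus ?thesis unfolding nab_values by simp
qed

lemma hat_star_t: "(\<Sum>j\<in>UNIV. t (bph (e, j)) (dph (j, f))) = leg_map scT hatm (star scT (fam_prod t (bp A) (dp A))) (e, f)"
  by (rule hat_star[OF module2]) (auto simp: Modules.additive_def t_add t_sc)

lemma nab_dph: "nab (dph (e, f)) = (\<Sum>j\<in>UNIV. t (bph (e, j)) (dph (j, f))) - scT (\<kappa>\<^sup>2 / \<kappa> ^ r) (lm2 (ph (e, f)) (g_mp D A t))"
proof -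
  have n: "nab (sc1 A c u) = scT c (nab u)" for c u
    by (simp add: sc1_def sc2_def nab_leibniz dif_derivation t_0)
  have "nab (dph (e, f)) = leg_map scT hatm (\<lambda>k. nab (dp A k)) (e, f)"
    by (rule leg_map_hom[where f = nab and sc = "sc1 A" and sc' = scT, OF nab_add n])
  also have "\<dots> = leg_map scT hatm (star scT (fam_prod t (bp A) (dp A))) (e, f) -
      scT (\<kappa>\<^sup>2 / \<kappa> ^ r) (leg_map scT hatm (\<lambda>k. lm2 (pg k) (g_mp D A t)) (e, f))"
    unfolding nab_dp leg_map_diff[OF module2] leg_map_scale[OF module2] ..
  also have "leg_map scT hatm (\<lambda>k. lm2 (pg k) (g_mp D A t)) (e, f) = lm2 (ph (e, f)) (g_mp D A t)"
    by (rule leg_map_hom[where f = "\<lambda>b. lm2 b (g_mp D A t)" and sc = sc0 and sc' = scT, symmetric])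
      (auto simp: Modules.additive_def lm2_simps sc2_def)
  finally show ?thesis unfolding hat_star_t .
qed

lemma g_pm_eq: "g_pm D A t = (\<Sum>i\<in>UNIV. scT (qq i) (\<Sum>j\<in>UNIV. t (dp A (i, j)) (bp A (j, i))))"
  and g_mp_eq: "g_mp D A t = (\<Sum>i\<in>UNIV. scT (qq i) (\<Sum>j\<in>UNIV. t (bp A (i, j)) (dp A (j, i))))"
  by (simp_all add: g_pm_def g_mp_def E'12_def E23_def fam_prod_def qpow_D qq_wrho)

lemma g_mp_hat: "g_mp D A t = scT (1 / \<kappa>\<^sup>2) (\<Sum>i\<in>UNIV. scT (\<kappa> ^ (2 * r) / qq i) (\<Sum>j\<in>UNIV. t (bph (i, j)) (dph (j, i))))"
proof -
  interpret module scT by (rule module2)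
  let ?z = "fam_prod t (bp A) (dp A)"
  have "(\<Sum>j\<in>UNIV. scT (h * \<kappa> / \<kappa> ^ r * qq i * qq j) (?z (i, i, j, j))) = 0" for i
    unfolding sum_sc_factor[OF module2] fam_prod_def by (simp add: t_trace dp_trace t_0)
  hence "(\<Sum>k\<in>UNIV. scT (qq k) (star scT ?z (k, k))) = scT (\<kappa>\<^sup>2) (g_mp D A t)"
    unfolding trace_star[OF module2] g_mp_eq by (simp add: fam_prod_def scale_sum_right)
  thus ?thesis unfolding hat_star_t trace_hat[OF module2] by simp
qed

lemma contr1_scale: "contr1 u v (scT c z) = scT c (contr1 u v z)"
  by (simp add: sc2_def contr1_simps(2)[symmetric] rm_scal sc1_def contr1_lm)

text \<open>
  A term \<open>p g p\<close> of the generalized braiding, with \<open>g\<close> the trace of \<open>Z \<otimes> Z'\<close>, is annihilated by contraction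
  with \<open>Z\<close>: the left factor \<open>p\<close> moves to \<open>Z\<close>, where the right module structure expresses \<open>Z p\<close> by products
  \<open>p Z\<close>.
\<close>

lemma contr1_sandwich:
  assumes g: "g = (\<Sum>i\<in>UNIV. scT (qq i) (\<Sum>j\<in>UNIV. t (Z (i, j)) (Z' (j, i))))"
    and 0: "\<And>k k'. ip (t (Z k) (Z k')) = 0"
    and Zp: "\<And>i j k l. rm (Z (i, j)) (pg (k, l)) = sc1 A c (leg_map (sc1 A) (T1234 D) (fam_prod lm pg Z) (i, j, k, l))"
  shows "contr1 (Z m) v (sandwich A t g kk) = 0"
proof -
  obtain a b i' j' where kk: "kk = (a, b, i', j')" by (metis prod.exhaust)
  obtain m1 m2 where m: "m = (m1, m2)" by fastforce
  have scip: "ip (t (sc1 A c u) w) = sc0 c (ip (t u w))" for c u w by (simp add: t_sc sc2_def ip_simps)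
  have 1: "ip (t (rm (Z m) (pg (a, b))) (Z l)) = 0" for l
  proof -
    have a: "ip (t (leg_map (sc1 A) (T1234 D) (fam_prod lm pg Z) k) (Z l)) = leg_map sc0 (T1234 D) (\<lambda>k. ip (t (fam_prod lm pg Z k) (Z l))) k" for k
      by (rule leg_map_hom[where f = "\<lambda>u. ip (t u (Z l))" and sc = "sc1 A" and sc' = sc0]) (auto simp: Modules.additive_def t_add ip_t scip)
    have b: "ip (t (fam_prod lm pg Z k) (Z l)) = 0" for k
      by (cases k) (simp add: fam_prod_def ip_t 0)
    show ?thesis by (simp add: m Zp scip a b leg_map_zero[OF module0])
  qed
  have "contr1 (Z m) v (rm2 (lm2 (pg (a, b)) (t (Z l) w)) (pg (i', j'))) = 0" for l w
    using 1[of l] by (simp add: lm2_pure rm2_pure contr1_pure t_add(3)[symmetric] additive.zero[OF lm_additive(2)] t_0)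
  moreover have "sandwich A t g kk = (\<Sum>i\<in>UNIV. scT (qq i) (\<Sum>j\<in>UNIV. rm2 (lm2 (pg (a, b)) (t (Z (i, j)) (Z' (j, i)))) (pg (i', j'))))"
  proof -
    have "lm2 b (scT c z) = scT c (lm2 b z)" "rm2 (scT c z) b = scT c (rm2 z b)" for b c z
      by (simp_all add: sc2_def lm2_simps(3)[symmetric] scal_central lm2_rm2)
    thus ?thesis unfolding g sandwich_def fam_prod_def kk
      by (simp add: additive.sum[OF lm2_additive] additive.sum[OF rm2_additive])
  qed
  ultimately show ?thesis
    by (simp add: additive.sum[OF contr1_additive] contr1_scale module.scale_zero_right[OF module2])
qed

text \<open>
  The generalized braiding exchanges the two types, up to the terms of \<open>contr1_sandwich\<close>. So after it
  \<open>\<partial>p\<close> is paired with \<open>\<partial>p\<close>, and \<open>\<partial>'p\<close> with \<open>\<partial>'p\<close>, where the inverse metric vanishes.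
\<close>

lemma contr1_sig:
  "contr1 (dp A m) v (sig (t (bp A k) (dp A l))) = 0" "contr1 (bp A m) v (sig (t (dp A k) (bp A l))) = 0"
proof -
  have S: "\<forall>k. sig (fam_prod t (dp A) (bp A) k) =
         scT (qpow D (2 * ca D - 2 * cw D)) (leg_map scT (S123 D ** matrix_inv (S234 D)) (fam_prod t (bp A) (dp A)) k)
         + scT ((1 - qpow D (ca D)) * qpow D (ca D) * qpow D (- cm D)) (sandwich A t (g_mp D A t) k)"
      "\<forall>k. sig (fam_prod t (bp A) (dp A) k) =
         scT (qpow D (2 * cw D - 2 * ca D)) (leg_map scT (matrix_inv (S123 D) ** S234 D) (fam_prod t (dp A) (bp A)) k)
         + scT ((1 - qpow D (- ca D)) * qpow D (- cm D)) (sandwich A t (g_pm D A t) k)"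
    using braiding[unfolded is_gen_braiding_def Let_def] by - ((elim conjE), assumption)+
  obtain a b c d where k: "k = (a, b)" "l = (c, d)" by fastforce
  have z: "contr1 (Z m) v (leg_map scT M (fam_prod t Z Z') kk) = 0" if "\<And>k k'. ip (t (Z k) (Z k')) = 0"
    for Z Z' :: "'n \<times> 'n \<Rightarrow> 'o" and M :: "complex^('n \<times> 'n \<times> 'n \<times> 'n)^('n \<times> 'n \<times> 'n \<times> 'n)" and kk
  proof -
    have "contr1 (Z m) v (leg_map scT M (fam_prod t Z Z') kk) = leg_map scT M (\<lambda>l. contr1 (Z m) v (fam_prod t Z Z' l)) kk"
      by (rule leg_map_hom[where f = "contr1 (Z m) v" and sc = scT and sc' = scT, OF contr1_additive contr1_scale])
    also have "(\<lambda>l. contr1 (Z m) v (fam_prod t Z Z' l)) = (\<lambda>_. 0)"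
      by (auto simp: fam_prod_def contr1_pure that additive.zero[OF lm_additive(2)] t_0)
    finally show ?thesis by (simp add: leg_map_zero[OF module2])
  qed
  note zero = additive.add[OF contr1_additive] contr1_scale module.scale_zero_right[OF module2]
  have "contr1 (dp A m) v (sig (fam_prod t (bp A) (dp A) (a, b, c, d))) = 0"
    unfolding S(2)[THEN spec] by (simp only: zero z[of "dp A", OF ip_values(1)] contr1_sandwich[OF g_pm_eq ip_values(1) dp_right]) simp
  thus "contr1 (dp A m) v (sig (t (bp A k) (dp A l))) = 0" by (simp add: k fam_prod_def)
  have "contr1 (bp A m) v (sig (fam_prod t (dp A) (bp A) (a, b, c, d))) = 0"
    unfolding S(1)[THEN spec] by (simp only: zero z[of "bp A", OF ip_values(2)] contr1_sandwich[OF g_mp_eq ip_values(2) bp_right]) simp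
  thus "contr1 (bp A m) v (sig (t (dp A k) (bp A l))) = 0" by (simp add: k fam_prod_def)
qed

lemma split_values:
  "sw (\<pi> (t (dp A k) (bp A l))) = scT cpm (t (dp A k) (bp A l)) - scT cmp (sig (t (dp A k) (bp A l)))"
  "sw (\<pi> (t (bp A k) (dp A l))) = scT cmp (t (bp A k) (dp A l)) - scT cpm (sig (t (bp A k) (dp A l)))"
proof -
  have "\<forall>u\<in>Omega_plus A. \<forall>v\<in>Omega_minus A. sw (\<pi> (t u v)) = scT cpm (t u v) - scT cmp (sig (t u v))"
    "\<forall>u\<in>Omega_minus A. \<forall>v\<in>Omega_plus A. sw (\<pi> (t u v)) = scT cmp (t u v) - scT cpm (sig (t u v))"
    using splitting[unfolded is_splitting_def Let_def] by - ((elim conjE), assumption)+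
  thus "sw (\<pi> (t (dp A k) (bp A l))) = scT cpm (t (dp A k) (bp A l)) - scT cmp (sig (t (dp A k) (bp A l)))"
    "sw (\<pi> (t (bp A k) (dp A l))) = scT cmp (t (bp A k) (dp A l)) - scT cpm (sig (t (bp A k) (dp A l)))"
    using in_Omega by blast+
qed

lemma contr1_split:
  "contr1 (dp A m) v (sw (\<pi> (t (bp A k) (dp A l)))) = scT cmp (contr1 (dp A m) v (t (bp A k) (dp A l)))"
  "contr1 (bp A m) v (sw (\<pi> (t (dp A k) (bp A l)))) = scT cpm (contr1 (bp A m) v (t (dp A k) (bp A l)))"
  by (simp_all only: split_values additive.diff[OF contr1_additive] contr1_scale contr1_sig
       module.scale_zero_right[OF module2] diff_zero)

lemma contr1_split_hat:
  "contr1 (bph m) v (sw (\<pi> (t (dph k) (bph l)))) = scT cpm (contr1 (bph m) v (t (dph k) (bph l)))"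
proof -
  interpret module scT by (rule module2)
  \<comment> \<open>the difference of both sides is linear in all three forms, so it suffices to treat the original families\<close>
  define T where "T u y z = contr1 u v (sw (\<pi> (t y z))) - scT cpm (contr1 u v (t y z))" for u y z
  have pisc: "sw (\<pi> (scT c z)) = scT c (sw (\<pi> z))" for c z
    by (simp add: sc2_def lmw_pi[symmetric] s_simps)
  have add: "Modules.additive (\<lambda>u. T u y z)" "Modules.additive (\<lambda>y. T u y z)" "Modules.additive (\<lambda>z. T u y z)" for u y z
    by (auto simp: T_def Modules.additive_def contr1_simps t_add pi_add additive.add[OF s_simps(1)]
        additive.add[OF contr1_additive] scale_right_distrib)
  have c1: "contr1 (sc1 A c u) v z = scT c (contr1 u v z)" for c u z by (simp add: sc1_def sc2_def contr1_lm)
  have sc: "T (sc1 A c u) y z = scT c (T u y z)" "T u (sc1 A c y) z = scT c (T u y z)" "T u y (sc1 A c z) = scT c (T u y z)" for c u y z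
    by (simp_all add: T_def c1 t_sc pisc contr1_scale scale_right_diff_distrib mult.commute)
  have 0: "T (bp A m) (dp A k) (bp A l) = 0" for m k l by (simp add: T_def contr1_split)
  have 1: "T (bp A m) (dp A k) (bph l) = 0" for m k l
    by (simp add: 0 leg_map_zero[OF module2]
        leg_map_hom[where f = "\<lambda>z. T (bp A m) (dp A k) z" and sc = "sc1 A" and sc' = scT, OF add(3) sc(3)])
  have 2: "T (bp A m) (dph k) (bph l) = 0" for m k l
    by (simp add: 1 leg_map_zero[OF module2]
        leg_map_hom[where f = "\<lambda>y. T (bp A m) y (bph l)" and sc = "sc1 A" and sc' = scT, OF add(2) sc(2)])
  have "T (bph m) (dph k) (bph l) = 0" for m k l
    by (simp add: 2 leg_map_zero[OF module2]
        leg_map_hom[where f = "\<lambda>u. T u (dph k) (bph l)" and sc = "sc1 A" and sc' = scT, OF add(1) sc(1)])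
  thus ?thesis by (simp add: T_def)
qed

lemma ric_g_pm: "ric (g_pm D A t) = scT (- (cmp * (1 / \<kappa> ^ r) * (1 + 1 * (1 / \<kappa> ^ r) * ((\<Sum>i\<in>UNIV. qq i) - \<kappa> ^ r)))) (g_pm D A t)"
proof (rule ricci_of_projection[where P = pg and X = "dp A" and Y = "bp A" and v = qq and lam = 1])
  interpret module scT by (rule module2)
  show "g_pm D A t = scT 1 (\<Sum>i\<in>UNIV. scT (qq i) (\<Sum>j\<in>UNIV. t (dp A (i, j)) (bp A (j, i))))"
    by (simp add: g_pm_eq)
  show "nab (bp A (i, k)) = (\<Sum>j\<in>UNIV. t (dp A (i, j)) (bp A (j, k))) - scT (1 / \<kappa> ^ r) (lm2 (pg (i, k)) (g_pm D A t))" for i k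
    by (simp add: nab_values E23_def fam_prod_def)
qed (simp_all only: dif_pgen p_bp p_dp dp_p bp_p dp_trace p_trace ip_dp_bp contr1_split)

lemma ric_g_mp: "ric (g_mp D A t) = scT (- (cpm * (\<kappa>\<^sup>2 / \<kappa> ^ r) * (1 + (1 / \<kappa>\<^sup>2) * (\<kappa>\<^sup>2 / \<kappa> ^ r) * ((\<Sum>i\<in>UNIV. \<kappa> ^ (2 * r) / qq i) - \<kappa> ^ r)))) (g_mp D A t)"
  by (rule ricci_of_projection[where P = ph and X = bph and Y = dph and v = "\<lambda>i. \<kappa> ^ (2 * r) / qq i"])
     (rule g_mp_hat dif_ph ph_dph ph_bph bph_ph dph_ph bph_trace ph_trace nab_dph ip_bph_dph contr1_split_hat)+

lemma h_nz: "h \<noteq> 0"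
proof
  assume "h = 0"
  hence "\<kappa>\<^sup>2 = 1" unfolding h_def power2_eq_square by (simp add: field_simps)
  hence "complex_of_real (q\<^sup>2) = complex_of_real 1" by simp
  hence "q\<^sup>2 = 1" unfolding of_real_eq_iff .
  thus False using q by (simp add: power2_eq_1_iff)
qed

lemma sum_inv_qq_eq: "(\<Sum>i\<in>UNIV. 1 / qq i) = (\<Sum>i\<in>UNIV. qq i)"
proof -
  have "h * (\<Sum>i\<in>UNIV. 1 / qq i) = h * (\<Sum>i\<in>UNIV. qq i)" by (simp only: sum_qq sum_inv_qq)
  thus ?thesis using h_nz by simp
qed

lemma qdim_D: "qdim D = (\<Sum>i\<in>UNIV. qq i)"
  by (simp add: qdim_def qpow_D qq_wrho)

lemma qnumber_eq: "qnumber q (real r + 1) = (\<Sum>i\<in>UNIV. qq i)"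
proof -
  have "cpow q (real r + 1) = \<kappa> ^ (r + 1)" using cpow_nat[OF q(1), of "r + 1"] by (simp add: add.commute)
  hence "qnumber q (real r + 1) = (\<kappa> ^ (r + 1) - 1 / \<kappa> ^ (r + 1)) / h"
    unfolding qnumber_def h_def cpow_minus[OF q(1)] cpow_1[OF q(1)] by simp
  also have "\<dots> = h * (\<Sum>i\<in>UNIV. qq i) / h" unfolding sum_qq by simp
  finally show ?thesis using h_nz by simp
qed

text \<open>
  The only place where the coefficients of the splitting map matter: they are the ones for which the
  scalars of \<open>ric_g_pm\<close> and \<open>ric_g_mp\<close> agree.
\<close>

lemma ricci_metric:
  assumes cpm: "cpm = 1 / (1 + \<kappa> ^ (2 * r + 2))" and cmp: "cmp = \<kappa> ^ (2 * r + 2) / (1 + \<kappa> ^ (2 * r + 2))"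
  shows "ric (q_metric D A t) = scT (- (\<kappa>\<^sup>2 / (1 + \<kappa> ^ (2 * r + 2)) * (\<Sum>i\<in>UNIV. qq i))) (q_metric D A t)"
proof -
  interpret module scT by (rule module2)
  let ?S = "\<Sum>i\<in>UNIV. qq i" and ?d = "1 + \<kappa> ^ (2 * r + 2)"
  have "- (cmp * (1 / \<kappa> ^ r) * (1 + 1 * (1 / \<kappa> ^ r) * (?S - \<kappa> ^ r))) = - (cmp / (\<kappa> ^ r * \<kappa> ^ r) * ?S)"
    by (simp add: field_simps)
  also have "cmp / (\<kappa> ^ r * \<kappa> ^ r) = \<kappa>\<^sup>2 / ?d"
    unfolding cmp by (simp add: power_add mult_2 power2_eq_square)
  finally have 1: "- (cmp * (1 / \<kappa> ^ r) * (1 + 1 * (1 / \<kappa> ^ r) * (?S - \<kappa> ^ r))) = - (\<kappa>\<^sup>2 / ?d * ?S)" .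
  have "(\<Sum>i\<in>UNIV. \<kappa> ^ (2 * r) / qq i) = \<kappa> ^ r * \<kappa> ^ r * ?S"
    unfolding sum_inv_qq_eq[symmetric] by (simp add: sum_distrib_left power_add mult_2)
  hence 2: "- (cpm * (\<kappa>\<^sup>2 / \<kappa> ^ r) * (1 + (1 / \<kappa>\<^sup>2) * (\<kappa>\<^sup>2 / \<kappa> ^ r) * ((\<Sum>i\<in>UNIV. \<kappa> ^ (2 * r) / qq i) - \<kappa> ^ r))) = - (cpm * \<kappa>\<^sup>2 * ?S)"
    by (simp add: right_diff_distrib)
  show ?thesis
    unfolding q_metric_def additive.add[OF ric_additive] ric_g_pm ric_g_mp 1 2 unfolding scale_right_distrib cpm by simp
qed

end

theorem theorem6p5:
  fixes r s :: nat and q :: real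
    and V :: "('n::finite) uq_rep" and wt :: "'n \<Rightarrow> weight"
    and D :: "'n qps_data"
    and A :: "('n, 'b::ring_1, 'o::ab_group_add) calculus"
    and t :: "'o \<Rightarrow> 'o \<Rightarrow> 't::ab_group_add"
    and \<pi> :: "'t \<Rightarrow> 'w::ab_group_add"
    and t21 :: "'w \<Rightarrow> 'o \<Rightarrow> 'u::ab_group_add"
    and t3 :: "'t \<Rightarrow> 'o \<Rightarrow> 'x::ab_group_add"
    and t4 :: "'o \<Rightarrow> 'u \<Rightarrow> 'y::ab_group_add"
    and t4' :: "'o \<Rightarrow> 'x \<Rightarrow> 'z::ab_group_add"
    and d1 :: "'o \<Rightarrow> 'w" and ip :: "'t \<Rightarrow> 'b" and nab :: "'o \<Rightarrow> 't"
    and sig :: "'t \<Rightarrow> 't" and s_wedge :: "'w \<Rightarrow> 't"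
    and a m :: real and Ric g :: 't
  assumes "r \<ge> 1" and "s \<in> {1, r}" and "0 < q" and "q < 1"
    and "CARD('n) = r + 1"
    and "simple_uq_module r q V"
    and "\<exists>v. highest_weight_vector r q V (fweight r s) v"
    and "weight_basis r q V wt"
    and "D = \<lparr>rk = r, node = s, qpar = q, Vrep = V, wts = wt\<rparr>"
    and "is_algebra_B D A"
    and "is_HK_calculus D A"
    and "is_tensor (rmul A) (lmul A) t"
    and "is_Omega2 A t \<pi>"
    and "is_tensor (rmulw A t \<pi>) (lmul A) t21"
    and "is_tensor (rmul2 A t) (lmul A) t3"
    and "is_tensor (rmul A) (tleft t21 (lmulw A t \<pi>)) t4"
    and "is_tensor (rmul A) (tleft t3 (lmul2 A t)) t4'"
    and "is_diff1 A t \<pi> d1"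
    and "is_inverse_metric D A t ip"
    and "is_levi_civita D A t nab"
    and "is_gen_braiding D A t sig"
    and "a = wform r (sroot s) (sroot s)"
    and "m = wform r (fweight r s) (two_rho r)"
    and "is_splitting D A t \<pi> sig
           (1 / (1 + cpow q a * cpow q (2 * m)))
           (1 / (1 + cpow q (- a) * cpow q (- 2 * m))) s_wedge"
    and "g = q_metric D A t"
    and "Ric = ricci D A t \<pi> t21 t3 t4 t4' d1 ip nab s_wedge"
  shows "Ric = sc2 A t (- (cpow q a / (1 + cpow q a * cpow q (2 * m))) * qdim D) g \<and>
     Ric = sc2 A t (- (complex_of_real q ^ 2 / (1 + complex_of_real q ^ (2 * r + 2)))
                     * qnumber q (real r + 1)) g \<and>
     (\<exists>k. Ric = sc2 A t k g)"
proof -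
  let ?\<kappa> = "complex_of_real q" and ?cpm = "1 / (1 + cpow q a * cpow q (2 * m))"
    and ?cmp = "1 / (1 + cpow q (- a) * cpow q (- 2 * m))"
  obtain hv where hv: "highest_weight_vector r q V (fweight r s) hv" using assms(7) by blast
  have V: "uq_module r q V" using assms(6) unfolding simple_uq_module_def by (rule conjunct1)
  obtain \<nu> \<phi> x y where chain: "chain_rep_q r q \<nu> \<phi> x y V"
    and wt: "\<And>c. wform r (wt c) (two_rho r) = real r + 2 - 2 * real (\<phi> c)"
    using vector_rep_chain[OF assms(1,2,3,4,5) V hv assms(8)] by (elim exE conjE) blast
  have fodc: "fodc D A" by (rule fodc.intro[OF assms(10,11)])
  have rep: "qps_rep r q \<nu> \<phi> x y V D s wt"
    by (intro qps_rep.intro[OF chain] qps_rep_axioms.intro assms(9,2) wt)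
  interpret F: qps_fodc D A r q \<nu> \<phi> x y V s wt
    by (rule qps_fodc.intro[OF fodc rep])
  note bim = assms(19)[unfolded is_inverse_metric_def Let_def, THEN conjunct1]
    assms(24)[unfolded is_splitting_def Let_def, THEN conjunct1]
  have nab: "Modules.additive nab" "\<forall>b x. nab (lmul A b x) = t (dif A b) x + lmul2 A t b (nab x)"
    using assms(20)[unfolded is_levi_civita_def Let_def] by - ((elim conjE), assumption)+
  have R: "ricci_setup D A t \<pi> t21 t3 t4 t4' d1 ip nab s_wedge"
    by (rule ricci_setup.intro[OF fodc], rule ricci_setup_axioms.intro)
      (fact assms(12) assms(13) assms(14) assms(15) assms(16) assms(17) assms(18) bim nab(1) nab(2)[THEN spec, THEN spec] F.dif_spans_all)+
  interpret Q: qps_ricci D A t \<pi> t21 t3 t4 t4' d1 ip nab s_wedge r q \<nu> \<phi> x y V s wt sig ?cpm ?cmp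
    by (rule qps_ricci.intro[OF R F.qps_fodc_axioms], rule qps_ricci_axioms.intro)
      (fact assms(19) assms(20) assms(21) assms(24))+
  have a: "cpow q a = ?\<kappa>\<^sup>2" using F.qpow_ca assms(22) unfolding F.qpow_D ca_def by (simp add: assms(9))
  have "m = real r" using F.cm_D assms(23) unfolding cm_def by (simp add: assms(9))
  hence m: "cpow q (2 * m) = ?\<kappa> ^ (2 * r)" using cpow_nat[OF assms(3), of "2 * r"] by simp
  have am: "cpow q a * cpow q (2 * m) = ?\<kappa> ^ (2 * r + 2)" unfolding a m by (simp add: power_add power2_eq_square)
  have "cpow q (- a) * cpow q (- 2 * m) = 1 / ?\<kappa> ^ (2 * r + 2)"
    using cpow_minus[OF assms(3), of a] cpow_minus[OF assms(3), of "2 * m"] am by simp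
  moreover have "1 / (1 + 1 / X) = X / (1 + X)" if "X \<noteq> 0" for X :: complex
    using that by (simp add: divide_simps add.commute)
  ultimately have cmp: "?cmp = ?\<kappa> ^ (2 * r + 2) / (1 + ?\<kappa> ^ (2 * r + 2))"
    using assms(3) by simp
  have Ric: "Ric = sc2 A t (- (?\<kappa>\<^sup>2 / (1 + ?\<kappa> ^ (2 * r + 2)) * (\<Sum>i\<in>UNIV. F.qq i))) g"
    unfolding assms(25,26) Q.ricci_eq by (rule Q.ricci_metric) (simp_all only: am cmp)
  show ?thesis
  proof (intro conjI exI)
    show "Ric = sc2 A t (- (cpow q a / (1 + cpow q a * cpow q (2 * m))) * qdim D) g"
      using Ric unfolding am unfolding Q.qdim_D a by simp
    show "Ric = sc2 A t (- (?\<kappa> ^ 2 / (1 + ?\<kappa> ^ (2 * r + 2))) * qnumber q (real r + 1)) g"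
      using Ric unfolding Q.qnumber_eq by simp
  qed (rule Ric)
qed

end
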